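(* Let $x,y>0$ and consider the weighted Bratteli diagram of finite binary trees in which adding the node $ij$ to a tree in which $i$ is a leaf has weight $x$ if $j=1$ and $y$ if $j=2$, and every other addition has weight $1$. Then there exists a unique MERW on this diagram. The corresponding positive harmonic function is given, for every finite binary tree $\tau$, by $$\varphi(\tau)=\frac{1}{|\tau|!}\left(\frac{2}{x+y}\right)^{|\overset{\circ}{\tau}|}.$$ In particular, the non-zero transition probabilities of the MERW are $$p(\tau,\tau\sqcup\{ij\})=\begin{cases}\dfrac{2x}{x+y}\,\dfrac{1}{|\tau|+1}, & i\in\partial\tau,\ j=1,\\[6pt] \dfrac{2y}{x+y}\,\dfrac{1}{|\tau|+1}, & i\in\partial\tau,\ j=2,\\[6pt] \dfrac{1}{|\tau|+1}, & i\in\overset{\circ}{\tau},\ ij\notin\tau.\end{cases}$$ Furthermore, let $(\tau_n)_{n\ge 0}$ be the MERW starting from the root. Then for all $i\in\mathcal S_2$ and $j\in\{1,2\}$, $$\lim_{n\to\infty}\frac{|\tau_n^{(ij)}|}{|\tau_n^{(i)}|}=V_{i,j}\quad\text{almost surely},$$ where $(V_{i,1},V_{i,2})_{i\in\mathcal S_2}$ are i.i.d. random variables on the simplex $\{(t,1-t):0\le t\le 1\}$ with density $$h_{x,y}(t)=\frac{2xt+2y(1-t)}{x+y}.$$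
   Context: $\mathcal S_2=\bigcup_{k\ge 0}\{1,2\}^k$ is the complete infinite binary tree, whose elements are finite words, with root the empty word $\emptyset$; $ij$ denotes concatenation. A finite binary tree is a finite set $\tau\subset\mathcal S_2$ containing $\emptyset$ and closed under taking prefixes; $|\tau|$ is its cardinality, and $\tau^{(i)}=\{j\in\mathcal S_2: ij\in\tau\}$. A node $i\in\tau$ is internal if it has at least one child $ij\in\tau$; $\overset{\circ}{\tau}$ is the set of internal nodes and $\partial\tau=\tau\setminus\overset{\circ}{\tau}$ the set of leaves. The Bratteli diagram $\mathbb X=\bigsqcup_{n\ge0}\mathbb X_n$ has level $\mathbb X_n$ = set of binary trees of size $n+1$, root $\varnothing=\{\emptyset\}$, and edges $\tau\nearrow\tau\sqcup\{ij\}$ for $i\in\tau$, $j\in\{1,2\}$, $ij\notin\tau$, with the weights $w$ of the claim. The weight of a finite path is the product of the weights of its edges; $d(\tau,\sigma)$ is the sum of the weights of all directed paths from $\tau$ to $\sigma$ (with $d(\tau,\tau)=1$), and $d(\tau,\mathbb X_n)=\sum_{\sigma\in\mathbb X_n}d(\tau,\sigma)$. Definition of MERW: let $\varphi_n(\tau)=d(\tau,\mathbb X_n)/d(\varnothing,\mathbb X_n)$. If $\varphi^*$ is a pointwise limit of $\varphi_{n_k}$ along some subsequence $n_k\to\infty$, then $\varphi^*$ satisfies $\varphi^*(\varnothing)=1$ and $\varphi^*(\tau)=\sum_{\tau\nearrow\sigma}w(\tau,\sigma)\varphi^*(\sigma)$ (it is a non-negative harmonic function; a positive harmonic function if $\varphi^*>0$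 everywhere), and the associated MERW is the Markov chain started at $\varnothing$ with transition probabilities $p(\tau,\sigma)=w(\tau,\sigma)\varphi^*(\sigma)/\varphi^*(\tau)$ on $\{\varphi^*>0\}$. MERWs are the Markov chains arising in this way; uniqueness means there is only one limit point $\varphi^*$. *)

theory Defs
  imports "HOL-Probability.Probability" "HOL-Library.Sublist"
begin

section \<open>Finite binary trees\<close>

text \<open>
  The alphabet \<open>{1,2}\<close> is the type \<open>letter\<close>; words over it, i.e. the nodes of the complete
  infinite binary tree, form the full type \<open>letter list\<close>.
\<close>

datatype letter = L1 | L2

type_synonym word = "letter list"
type_synonym tree = "word set"

definition bin_trees :: "tree set" where
  "bin_trees = {\<tau>. finite \<tau> \<and> [] \<in> \<tau> \<and> (\<forall>v\<in>\<tau>. \<forall>u. prefix u v \<longrightarrow> u \<in> \<tau>)}"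

definition root_tree :: tree where
  "root_tree = {[]}"

definition subtree :: "tree \<Rightarrow> word \<Rightarrow> tree" where
  "subtree \<tau> i = {j. i @ j \<in> \<tau>}"

definition internal :: "tree \<Rightarrow> word set" where
  "internal \<tau> = {i \<in> \<tau>. \<exists>j. i @ [j] \<in> \<tau>}"

definition leaves :: "tree \<Rightarrow> word set" where
  "leaves \<tau> = \<tau> - internal \<tau>"

section \<open>The weighted Bratteli diagram\<close>

definition level :: "nat \<Rightarrow> tree set" where
  "level n = {\<tau> \<in> bin_trees. card \<tau> = n + 1}"

definition edge :: "tree \<Rightarrow> tree \<Rightarrow> bool" where
  "edge \<tau> \<sigma> \<longleftrightarrow> \<tau> \<in> bin_trees \<and> (\<exists>i\<in>\<tau>. \<exists>j. i @ [j] \<notin> \<tau> \<and> \<sigma> = insert (i @ [j]) \<tau>)"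

text \<open>
  An edge \<open>\<tau> \<nearrow> \<sigma>\<close> determines the added node \<open>v = ij\<close>, hence its parent \<open>i\<close> (\<open>butlast v\<close>) and
  the letter \<open>j\<close> (\<open>last v\<close>).  Pairs that are not edges get weight 0.
\<close>

definition weight :: "real \<Rightarrow> real \<Rightarrow> tree \<Rightarrow> tree \<Rightarrow> real" where
  "weight x y \<tau> \<sigma> =
     (if edge \<tau> \<sigma> then
        let v = the_elem (\<sigma> - \<tau>) in
          if butlast v \<in> leaves \<tau> then (case last v of L1 \<Rightarrow> x | L2 \<Rightarrow> y) else 1
      else 0)"

text \<open>
  A directed path is the nonempty list of its vertices; the one-element list is the path without
  edges, of weight 1.
\<close>

definition paths :: "tree \<Rightarrow> tree \<Rightarrow> tree list set" where
  "paths \<tau> \<sigma> = {p. p \<noteq> [] \<and> hd p = \<tau> \<and> last p = \<sigma> \<and> successively edge p}"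

definition path_weight :: "real \<Rightarrow> real \<Rightarrow> tree list \<Rightarrow> real" where
  "path_weight x y p = prod_list (map2 (weight x y) p (tl p))"

definition paths_weight :: "real \<Rightarrow> real \<Rightarrow> tree \<Rightarrow> tree \<Rightarrow> real" where
  "paths_weight x y \<tau> \<sigma> = (\<Sum>p\<in>paths \<tau> \<sigma>. path_weight x y p)"

definition paths_weight_level :: "real \<Rightarrow> real \<Rightarrow> tree \<Rightarrow> nat \<Rightarrow> real" where
  "paths_weight_level x y \<tau> n = (\<Sum>\<sigma>\<in>level n. paths_weight x y \<tau> \<sigma>)"

section \<open>Maximal entropy random walks\<close>

definition level_ratio :: "real \<Rightarrow> real \<Rightarrow> nat \<Rightarrow> tree \<Rightarrow> real" where
  "level_ratio x y n \<tau> = paths_weight_level x y \<tau> n / paths_weight_level x y root_tree n"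

text \<open>
  Functions on the vertex set are represented by elements of \<open>extensional bin_trees\<close>, so that
  equality of functions is equality on \<open>bin_trees\<close>.
\<close>

definition limit_point :: "real \<Rightarrow> real \<Rightarrow> (tree \<Rightarrow> real) \<Rightarrow> bool" where
  "limit_point x y \<phi> \<longleftrightarrow>
     \<phi> \<in> extensional bin_trees \<and>
     (\<exists>r :: nat \<Rightarrow> nat. strict_mono r \<and>
        (\<forall>\<tau>\<in>bin_trees. (\<lambda>k. level_ratio x y (r k) \<tau>) \<longlonglongrightarrow> \<phi> \<tau>))"

definition positive_harmonic :: "real \<Rightarrow> real \<Rightarrow> (tree \<Rightarrow> real) \<Rightarrow> bool" where
  "positive_harmonic x y \<phi> \<longleftrightarrow>
     \<phi> root_tree = 1 \<and>
     (\<forall>\<tau>\<in>bin_trees. \<phi> \<tau> > 0 \<and> \<phi> \<tau> = (\<Sum>\<sigma> | edge \<tau> \<sigma>. weight x y \<tau> \<sigma> * \<phi> \<sigma>))"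

definition trans_prob :: "real \<Rightarrow> real \<Rightarrow> (tree \<Rightarrow> real) \<Rightarrow> tree \<Rightarrow> tree \<Rightarrow> real" where
  "trans_prob x y \<phi> \<tau> \<sigma> = weight x y \<tau> \<sigma> * \<phi> \<sigma> / \<phi> \<tau>"

text \<open>Time-homogeneous Markov chains with discrete state space \<open>S\<close>, started at \<open>s0\<close>.\<close>

definition markov_chain ::
  "'a measure \<Rightarrow> 's set \<Rightarrow> 's \<Rightarrow> ('s \<Rightarrow> 's \<Rightarrow> real) \<Rightarrow> (nat \<Rightarrow> 'a \<Rightarrow> 's) \<Rightarrow> bool" where
  "markov_chain M S s0 P T \<longleftrightarrow>
     prob_space M \<and>
     (\<forall>n. T n \<in> M \<rightarrow>\<^sub>M count_space S) \<and>
     (AE \<omega> in M. T 0 \<omega> = s0) \<and>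
     (\<forall>n s. \<forall>t\<in>S. \<P>(\<omega> in M. \<forall>k\<le>n. T k \<omega> = s k) > 0 \<longrightarrow>
        \<P>(\<omega> in M. T (Suc n) \<omega> = t \<bar> \<forall>k\<le>n. T k \<omega> = s k) = P (s n) t)"

definition merw :: "real \<Rightarrow> real \<Rightarrow> 'a measure \<Rightarrow> (nat \<Rightarrow> 'a \<Rightarrow> tree) \<Rightarrow> bool" where
  "merw x y M T \<longleftrightarrow>
     (\<exists>\<phi>. limit_point x y \<phi> \<and>
        markov_chain M {\<tau> \<in> bin_trees. \<phi> \<tau> > 0} root_tree (trans_prob x y \<phi>) T)"

section \<open>The limiting splitting law\<close>

definition h_density :: "real \<Rightarrow> real \<Rightarrow> real \<Rightarrow> real" where
  "h_density x y t = (2 * x * t + 2 * y * (1 - t)) / (x + y)"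

definition std_simplex :: "(real \<times> real) set" where
  "std_simplex = (\<lambda>t. (t, 1 - t)) ` {0..1}"

text \<open>The law on the simplex whose density in the coordinate \<open>t\<close> is \<open>h_density\<close>.\<close>

definition split_law :: "real \<Rightarrow> real \<Rightarrow> (real \<times> real) measure" where
  "split_law x y =
     distr (density lborel (\<lambda>t. ennreal (h_density x y t) * indicator {0..1} t))
       borel (\<lambda>t. (t, 1 - t))"

end

theory Submission
  imports Defs
begin

text \<open>
  In a growing tree every leaf and every free slot below an internal node evolves independently of the
  others, so the exponential generating function of the weighted paths out of a tree with \<open>l\<close> leaves
  and \<open>a\<close> such slots is \<open>F ^ l * G ^ a\<close>, where \<open>F = G'\<close> and \<open>F' = (x + y) F G\<close>, hence
  \<open>F = \<alpha> G\<^sup>2 + (1 - \<alpha>)\<close> with \<open>\<alpha> = (x + y) / 2\<close>.  Since consecutive coefficients of \<open>G\<close> have ratio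
  bounded below, the relation \<open>(G ^ k)' = k (\<alpha> G ^ (k + 1) + (1 - \<alpha>) G ^ (k - 1))\<close> determines the
  coefficients of all these products up to a factor \<open>1 + o(1)\<close> in terms of those of \<open>G\<close> alone, and the
  level ratios converge.

  For the splits, the law of the walk at a fixed time is a recursive splitting law: a node with \<open>N\<close>
  proper descendants sends \<open>a\<close> of them to the left with probability
  \<open>2 (x a + y (N - a)) / ((x + y) N (N + 1))\<close>, independently of the other nodes given the sizes.  Letting
  \<open>N\<close> tend to infinity gives the joint limit law of the split ratios.  Their almost sure convergence
  follows from the second moment of the increments of (size of the subtree + 1) / (size of the tree + 1),
  which is a martingale up to a drift of order \<open>1 / n\<^sup>2\<close>.
\<close>

text \<open>No growth rate of the coefficients of G is needed. The identity F = \<alpha> G^2 + (1 -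
  \<alpha>) makes a leaf count as two slots and one factor \<alpha>. A tree with l leaves and a
  further slots has 2 l + a = |\<tau>| + 1, so iterating the relation for (G ^ k)' produces both
  |\<tau>|! and the powers of 1 / \<alpha> = 2 / (x + y). The terms with 1 - \<alpha> belong to an
  index smaller by two, and the factorial in the normalisation
  \<open>fact N * slot_coeff \<alpha> N\<close> suppresses them. The second half combines two facts
  of different nature: the law of the tree at one fixed time, and convergence along a path. All
  split ratios are functions of the same tree, so the one-time law already yields their joint law. A
  quotient of masses converges only if the limit of the denominator is positive; the second moments
  do not give this, so it is taken from the limit law, by induction along the word.\<close>

lemma UNIV_letter: "(UNIV :: letter set) = {L1, L2}"
  using letter.exhaust by auto

instance letter :: finite
  by standard (simp add: UNIV_letter)

section \<open>Finite trees, the empty one included, as joins of two subtrees\<close>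

definition prefix_closed :: "tree \<Rightarrow> bool" where
  "prefix_closed \<tau> \<longleftrightarrow> finite \<tau> \<and> (\<forall>v\<in>\<tau>. \<forall>u. prefix u v \<longrightarrow> u \<in> \<tau>)"

text \<open>Unlike \<open>level\<close>, this family is indexed by the cardinality and contains the empty tree, so
  that both subtrees of a node always belong to it.\<close>

definition sized_trees :: "nat \<Rightarrow> tree set" where
  "sized_trees m = {\<tau>. prefix_closed \<tau> \<and> card \<tau> = m}"

definition join_trees :: "tree \<Rightarrow> tree \<Rightarrow> tree" where
  "join_trees \<tau>1 \<tau>2 = insert [] ((#) L1 ` \<tau>1 \<union> (#) L2 ` \<tau>2)"

lemma bin_trees_iff: "\<tau> \<in> bin_trees \<longleftrightarrow> prefix_closed \<tau> \<and> \<tau> \<noteq> {}"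
  by (auto simp: bin_trees_def prefix_closed_def)

lemma level_eq_sized_trees: "level n = sized_trees (Suc n)"
  by (auto simp: level_def sized_trees_def bin_trees_iff)

lemma prefix_closed_finite: "prefix_closed \<tau> \<Longrightarrow> finite \<tau>"
  by (simp add: prefix_closed_def)

lemma prefix_closedD: "prefix_closed \<tau> \<Longrightarrow> u @ v \<in> \<tau> \<Longrightarrow> u \<in> \<tau>"
  by (auto simp: prefix_closed_def)

lemma prefix_closed_Nil: "prefix_closed \<tau> \<Longrightarrow> \<tau> \<noteq> {} \<Longrightarrow> [] \<in> \<tau>"
  using prefix_closedD[of \<tau> "[]"] by auto

lemma prefix_closedI:
  assumes "finite \<tau>" and "\<And>u j. u @ [j] \<in> \<tau> \<Longrightarrow> u \<in> \<tau>"
  shows "prefix_closed \<tau>"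
proof -
  have "u @ w \<in> \<tau> \<longrightarrow> u \<in> \<tau>" for u w
    by (induction w rule: rev_induct) (auto simp del: append_assoc
        simp: append_assoc[symmetric] dest: assms(2))
  then show ?thesis
    using assms(1) by (auto simp: prefix_closed_def prefix_def)
qed

lemma bin_trees_finite: "\<tau> \<in> bin_trees \<Longrightarrow> finite \<tau>"
  by (simp add: bin_trees_def)

lemma bin_trees_Nil: "\<tau> \<in> bin_trees \<Longrightarrow> [] \<in> \<tau>"
  by (simp add: bin_trees_def)

lemma bin_trees_card_pos: "\<tau> \<in> bin_trees \<Longrightarrow> card \<tau> > 0"
  using bin_trees_finite bin_trees_Nil by (auto simp: card_gt_0_iff)

lemma root_tree_bin_tree: "root_tree \<in> bin_trees"
  by (auto simp: root_tree_def bin_trees_def)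

lemma prefix_closed_subtree:
  assumes "prefix_closed \<tau>"
  shows "prefix_closed (subtree \<tau> i)"
proof (rule prefix_closedI)
  have "(@) i ` subtree \<tau> i \<subseteq> \<tau>"
    by (auto simp: subtree_def)
  then have "finite ((@) i ` subtree \<tau> i)"
    using assms prefix_closed_finite finite_subset by blast
  then show "finite (subtree \<tau> i)"
    by (rule finite_imageD) (simp add: inj_on_def)
next
  fix u j assume "u @ [j] \<in> subtree \<tau> i"
  then show "u \<in> subtree \<tau> i"
    using prefix_closedD[OF assms, of "i @ u" "[j]"] by (simp add: subtree_def)
qed

lemma subtree_append: "subtree \<tau> (i @ j) = subtree (subtree \<tau> i) j"
  by (simp add: subtree_def)

lemma subtree_Nil [simp]: "subtree \<tau> [] = \<tau>"
  by (simp add: subtree_def)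

lemma subtree_Cons: "subtree \<tau> (a # i) = subtree (subtree \<tau> [a]) i"
  by (simp add: subtree_def)

lemma subtree_empty [simp]: "subtree {} i = {}"
  by (simp add: subtree_def)

lemma subtree_join [simp]:
  "subtree (join_trees \<tau>1 \<tau>2) [L1] = \<tau>1" "subtree (join_trees \<tau>1 \<tau>2) [L2] = \<tau>2"
  by (auto simp: subtree_def join_trees_def)

lemma join_subtrees:
  assumes "[] \<in> \<tau>"
  shows "join_trees (subtree \<tau> [L1]) (subtree \<tau> [L2]) = \<tau>"
proof -
  have "v \<in> \<tau> \<longleftrightarrow> v = [] \<or> v \<in> (#) L1 ` subtree \<tau> [L1] \<or> v \<in> (#) L2 ` subtree \<tau> [L2]" for v
  proof (cases v)
    case (Cons a w)
    then show ?thesis by (cases a) (auto simp: subtree_def)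
  qed (use assms in simp)
  then show ?thesis by (auto simp: join_trees_def)
qed

lemma prefix_closed_join:
  assumes "prefix_closed \<tau>1" "prefix_closed \<tau>2"
  shows "prefix_closed (join_trees \<tau>1 \<tau>2)"
proof (rule prefix_closedI)
  show "finite (join_trees \<tau>1 \<tau>2)"
    using assms by (simp add: join_trees_def prefix_closed_finite)
  fix u j assume "u @ [j] \<in> join_trees \<tau>1 \<tau>2"
  then show "u \<in> join_trees \<tau>1 \<tau>2"
    using prefix_closedD[OF assms(1)] prefix_closedD[OF assms(2)]
    by (cases u) (auto simp: join_trees_def)
qed

lemma card_join:
  assumes "finite \<tau>1" "finite \<tau>2"
  shows "card (join_trees \<tau>1 \<tau>2) = Suc (card \<tau>1 + card \<tau>2)"
proof -
  have "card ((#) L1 ` \<tau>1 \<union> (#) L2 ` \<tau>2) = card \<tau>1 + card \<tau>2"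
    using assms by (subst card_Un_disjoint) (auto simp: card_image inj_on_def)
  then show ?thesis
    using assms unfolding join_trees_def by (subst card_insert_disjoint) auto
qed

lemma card_eq_subtrees:
  assumes "prefix_closed \<tau>" "\<tau> \<noteq> {}"
  shows "card \<tau> = Suc (card (subtree \<tau> [L1]) + card (subtree \<tau> [L2]))"
  using card_join[of "subtree \<tau> [L1]" "subtree \<tau> [L2]"] assms
  by (simp add: join_subtrees prefix_closed_Nil prefix_closed_subtree prefix_closed_finite)

lemma card_subtree_le:
  assumes "prefix_closed \<tau>"
  shows "card (subtree \<tau> i) \<le> card \<tau>"
proof -
  have "card ((@) i ` subtree \<tau> i) \<le> card \<tau>"
    using assms by (intro card_mono) (auto simp: subtree_def prefix_closed_finite)
  then show ?thesis by (simp add: card_image inj_on_def)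
qed

text \<open>The \<open>length v + 1\<close> prefixes of \<open>v\<close> are distinct nodes.
  Bounding depth by size is what makes every level finite.\<close>

lemma length_less_card:
  assumes "prefix_closed \<tau>" "v \<in> \<tau>"
  shows "length v < card \<tau>"
proof -
  have "(\<lambda>k. take k v) ` {..length v} \<subseteq> \<tau>"
    using assms by (auto simp: prefix_closed_def take_is_prefix)
  moreover have "inj_on (\<lambda>k. take k v) {..length v}"
    by (rule inj_onI) (metis atMost_iff length_take min.absorb2)
  ultimately have "card {..length v} \<le> card \<tau>"
    using assms(1) by (metis card_image card_mono prefix_closed_finite)
  then show ?thesis by simp
qed

lemma finite_sized_trees: "finite (sized_trees m)"
proof (rule finite_subset)
  show "sized_trees m \<subseteq> Pow {w. length w \<le> m}"
    using length_less_card by (fastforce simp: sized_trees_def)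
  have "{w :: word. length w \<le> m} = (\<Union>k\<le>m. {w. length w = k})"
    by auto
  then show "finite (Pow {w :: word. length w \<le> m})"
    using finite_lists_length_eq[of "UNIV :: letter set"] by simp
qed

lemma finite_level: "finite (level n)"
  by (simp add: level_eq_sized_trees finite_sized_trees)

section \<open>Slots\<close>

definition slots :: "tree \<Rightarrow> word set" where
  "slots \<tau> = {v. v \<notin> \<tau> \<and> (\<exists>i\<in>\<tau>. \<exists>j. v = i @ [j])}"

text \<open>The two first-child weights are parameters: \<open>x\<close>, \<open>y\<close> give the
  diagram, while \<open>2 * x / (x + y)\<close>, \<open>2 * y / (x + y)\<close> give the transition
  probabilities up to the factor \<open>1 / (card \<tau> + 1)\<close>. Over the empty tree the word
  \<open>[]\<close> gets weight 1, since \<open>leaves {}\<close> is empty; the removal of a root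
  relies on this value.\<close>

definition slot_weight :: "real \<Rightarrow> real \<Rightarrow> tree \<Rightarrow> word \<Rightarrow> real" where
  "slot_weight a b \<tau> v = (if butlast v \<in> leaves \<tau> then (case last v of L1 \<Rightarrow> a | L2 \<Rightarrow> b) else 1)"

lemma edge_iff_slot: "edge \<tau> \<sigma> \<longleftrightarrow> \<tau> \<in> bin_trees \<and> (\<exists>v\<in>slots \<tau>. \<sigma> = insert v \<tau>)"
  by (auto simp: edge_def slots_def)

lemma edges_eq_image: "\<tau> \<in> bin_trees \<Longrightarrow> {\<sigma>. edge \<tau> \<sigma>} = (\<lambda>v. insert v \<tau>) ` slots \<tau>"
  by (auto simp: edge_iff_slot)

lemma inj_on_insert_slots: "inj_on (\<lambda>v. insert v \<tau>) (slots \<tau>)"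
  by (auto simp: inj_on_def slots_def)

lemma weight_insert:
  assumes "\<tau> \<in> bin_trees" "v \<in> slots \<tau>"
  shows "weight x y \<tau> (insert v \<tau>) = slot_weight x y \<tau> v"
proof -
  have "insert v \<tau> - \<tau> = {v}"
    using assms(2) by (auto simp: slots_def)
  moreover have "edge \<tau> (insert v \<tau>)"
    using assms by (auto simp: edge_iff_slot)
  ultimately show ?thesis
    by (simp add: weight_def slot_weight_def)
qed

lemma sum_edges:
  assumes "\<tau> \<in> bin_trees"
  shows "(\<Sum>\<sigma> | edge \<tau> \<sigma>. f \<sigma>) = (\<Sum>v\<in>slots \<tau>. f (insert v \<tau>))"
  using assms by (simp add: edges_eq_image sum.reindex[OF inj_on_insert_slots])

lemma insert_slot_bin_tree:
  assumes "\<tau> \<in> bin_trees" "v \<in> slots \<tau>"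
  shows "insert v \<tau> \<in> bin_trees"
proof -
  have *: "prefix_closed \<tau>"
    using assms(1) by (simp add: bin_trees_iff)
  have "prefix_closed (insert v \<tau>)"
    using assms(2) prefix_closed_finite[OF *] prefix_closedD[OF *]
    by (intro prefix_closedI) (auto simp: slots_def)
  then show ?thesis by (simp add: bin_trees_iff)
qed

lemma card_insert_slot: "\<tau> \<in> bin_trees \<Longrightarrow> v \<in> slots \<tau> \<Longrightarrow> card (insert v \<tau>) = Suc (card \<tau>)"
  by (simp add: slots_def bin_trees_finite)

lemma edge_bin_tree: "edge \<tau> \<sigma> \<Longrightarrow> \<sigma> \<in> bin_trees"
  by (auto simp: edge_iff_slot insert_slot_bin_tree)

lemma edge_card: "edge \<tau> \<sigma> \<Longrightarrow> card \<sigma> = Suc (card \<tau>)"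
  by (auto simp: edge_iff_slot card_insert_slot)

lemma children_eq: "\<tau> \<in> bin_trees \<Longrightarrow>
    (\<lambda>(i, j). i @ [j]) ` (\<tau> \<times> UNIV) = slots \<tau> \<union> (\<tau> - {[]})"
proof -
  assume \<tau>: "\<tau> \<in> bin_trees"
  have "\<exists>i\<in>\<tau>. \<exists>j. v = i @ [j]" if "v \<in> \<tau>" "v \<noteq> []" for v
    using that prefix_closedD[of \<tau> "butlast v" "[last v]"] \<tau> append_butlast_last_id[of v]
    by (metis bin_trees_iff)
  then show ?thesis
    by (force simp: slots_def image_iff)
qed

lemma finite_slots: "\<tau> \<in> bin_trees \<Longrightarrow> finite (slots \<tau>)"
  using finite_imageI[OF finite_cartesian_product[OF bin_trees_finite finite], of \<tau> "\<lambda>(i, j). i @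
      [j]" UNIV]
  using children_eq[of \<tau>] by (metis finite_Un)

text \<open>The \<open>card \<tau>\<close> nodes have twice as many child positions, and the
  \<open>card \<tau> - 1\<close> nodes other than the root occupy all but the slots.\<close>

lemma card_slots:
  assumes "\<tau> \<in> bin_trees"
  shows "card (slots \<tau>) = Suc (card \<tau>)"
proof -
  have "card (slots \<tau> \<union> (\<tau> - {[]})) = 2 * card \<tau>"
    unfolding children_eq[OF assms, symmetric]
    by (subst card_image) (auto simp: inj_on_def card_cartesian_product UNIV_letter)
  moreover have "card (slots \<tau> \<union> (\<tau> - {[]})) = card (slots \<tau>) + card (\<tau> - {[]})"
    using assms finite_slots[OF assms] by (intro card_Un_disjoint) (auto
        simp: bin_trees_finite slots_def)
  moreover have "card (\<tau> - {[]}) = card \<tau> - 1"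
    using assms by (simp add: bin_trees_Nil bin_trees_finite)
  ultimately show ?thesis
    using bin_trees_card_pos[OF assms] by simp
qed

lemma finite_leaves: "finite \<tau> \<Longrightarrow> finite (leaves \<tau>)"
  by (simp add: leaves_def)

lemma card_leaves_internal: "finite \<tau> \<Longrightarrow> card (leaves \<tau>) + card (internal \<tau>) = card \<tau>"
  unfolding leaves_def
  by (subst card_Un_disjoint[symmetric]) (auto simp: internal_def intro!: arg_cong[of _ _ card])

lemma leaf_children_slots: "(\<lambda>(i, j). i @ [j]) ` (leaves \<tau> \<times> UNIV) = {v \<in> slots \<tau>. butlast v \<in> leaves \<tau>}"
  by (force simp: slots_def leaves_def internal_def image_iff)

text \<open>Both child positions of a leaf are slots. Hence the natural subtraction
  \<open>Suc (card \<tau>) - 2 * card (leaves \<tau>)\<close>, the number of slots below internal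
  nodes, is never truncated.\<close>

lemma card_leaves_le:
  assumes "\<tau> \<in> bin_trees"
  shows "2 * card (leaves \<tau>) \<le> Suc (card \<tau>)"
proof -
  have "card ((\<lambda>(i, j). i @ [j]) ` (leaves \<tau> \<times> (UNIV :: letter set))) \<le> card (slots \<tau>)"
    unfolding leaf_children_slots using assms by (intro card_mono) (auto simp: finite_slots)
  moreover have "card ((\<lambda>(i, j). i @ [j]) ` (leaves \<tau> \<times> (UNIV :: letter set))) = 2 * card (leaves \<tau>)"
    by (subst card_image) (auto simp: inj_on_def card_cartesian_product UNIV_letter)
  ultimately show ?thesis
    using card_slots[OF assms] by simp
qed

text \<open>The effect of filling a slot depends only on whether its parent is a leaf, so
  \<open>h\<close> takes a Boolean. The same count serves the path weights, harmonicity and the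
  total transition probability.\<close>

lemma sum_slots:
  fixes a b :: real and h :: "bool \<Rightarrow> real"
  assumes "\<tau> \<in> bin_trees"
  shows "(\<Sum>v\<in>slots \<tau>. slot_weight a b \<tau> v * h (butlast v \<in> leaves \<tau>)) =
    card (leaves \<tau>) * (a + b) * h True + real (Suc (card \<tau>) - 2 * card (leaves \<tau>)) * h False"
proof -
  let ?A = "{v \<in> slots \<tau>. butlast v \<in> leaves \<tau>}" and ?B = "{v \<in> slots \<tau>. butlast v \<notin> leaves \<tau>}"
  let ?f = "\<lambda>v. slot_weight a b \<tau> v * h (butlast v \<in> leaves \<tau>)"
  note fin = finite_slots[OF assms]
  have inj: "inj_on (\<lambda>(i, j). i @ [j]) (leaves \<tau> \<times> (UNIV :: letter set))"
    by (auto simp: inj_on_def)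
  have A: "sum ?f ?A = card (leaves \<tau>) * (a + b) * h True"
    unfolding leaf_children_slots[symmetric] sum.reindex[OF inj] sum.cartesian_product'
    by (simp add: UNIV_letter slot_weight_def sum.reindex[OF inj] o_def case_prod_beta
        sum.cartesian_product[symmetric] algebra_simps)
  have cA: "card ?A = 2 * card (leaves \<tau>)"
    unfolding leaf_children_slots[symmetric] card_image[OF inj]
    by (simp add: card_cartesian_product UNIV_letter)
  have "slots \<tau> = ?A \<union> ?B" by auto
  then have "card ?A + card ?B = Suc (card \<tau>)"
    using fin card_slots[OF assms] by (subst card_Un_disjoint[symmetric]) auto
  then have cB: "card ?B = Suc (card \<tau>) - 2 * card (leaves \<tau>)"
    using cA by simp
  have B: "sum ?f ?B = card ?B * h False"
    by (simp add: slot_weight_def)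
  have "sum ?f (slots \<tau>) = sum ?f ?A + sum ?f ?B"
    using fin by (subst sum.union_disjoint[symmetric]) (auto intro!: sum.cong)
  then show ?thesis
    unfolding A B cB by simp
qed

lemma internal_insert_slot:
  assumes "\<tau> \<in> bin_trees" "v \<in> slots \<tau>"
  shows "internal (insert v \<tau>) = insert (butlast v) (internal \<tau>)"
proof -
  have 1: "v @ [j] \<notin> \<tau>" for j
    using assms prefix_closedD[of \<tau> v "[j]"] by (auto simp: bin_trees_iff slots_def)
  show ?thesis
    using assms(2) 1 unfolding internal_def slots_def
    by (auto simp: append_eq_append_conv2) 
qed

lemma card_internal_insert_slot:
  assumes "\<tau> \<in> bin_trees" "v \<in> slots \<tau>"
  shows "card (internal (insert v \<tau>)) = card (internal \<tau>) + (if butlast v \<in> leaves \<tau> then 1 else 0)"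
proof -
  have "finite (internal \<tau>)"
    using bin_trees_finite[OF assms(1)] by (simp add: internal_def)
  moreover have "butlast v \<in> \<tau>"
    using assms(2) by (auto simp: slots_def)
  ultimately show ?thesis
    unfolding internal_insert_slot[OF assms] by (auto simp: card_insert_if leaves_def)
qed

section \<open>Weighted path counts\<close>

text \<open>Paths are indexed by their number of edges, with free endpoint, which allows a recursion
  on the first edge.\<close>

definition paths_from :: "tree \<Rightarrow> nat \<Rightarrow> tree list set" where
  "paths_from \<tau> k = {p. p \<noteq> [] \<and> hd p = \<tau> \<and> successively edge p \<and> length p = Suc k}"

definition weight_from :: "real \<Rightarrow> real \<Rightarrow> tree \<Rightarrow> nat \<Rightarrow> real" where
  "weight_from x y \<tau> k = (\<Sum>p\<in>paths_from \<tau> k. path_weight x y p)"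

lemma finite_edges: "finite {\<sigma>. edge \<tau> \<sigma>}"
proof (cases "\<tau> \<in> bin_trees")
  case True
  then show ?thesis by (simp add: edges_eq_image finite_slots)
qed (simp add: edge_def)

lemma paths_from_0: "paths_from \<tau> 0 = {[\<tau>]}"
  by (auto simp: paths_from_def length_Suc_conv)

lemma paths_from_Suc: "paths_from \<tau> (Suc k) = (\<Union>\<rho>\<in>{\<rho>. edge \<tau> \<rho>}. (#) \<tau> ` paths_from \<rho> k)"
proof (intro equalityI subsetI)
  fix p assume "p \<in> paths_from \<tau> (Suc k)"
  then obtain q where "p = \<tau> # q" "successively edge p" "length q = Suc k"
    by (cases p) (auto simp: paths_from_def)
  then show "p \<in> (\<Union>\<rho>\<in>{\<rho>. edge \<tau> \<rho>}. (#) \<tau> ` paths_from \<rho> k)"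
    by (cases q) (auto simp: paths_from_def)
next
  fix p assume "p \<in> (\<Union>\<rho>\<in>{\<rho>. edge \<tau> \<rho>}. (#) \<tau> ` paths_from \<rho> k)"
  then show "p \<in> paths_from \<tau> (Suc k)"
    by (auto simp: paths_from_def successively_Cons)
qed

lemma finite_paths_from: "finite (paths_from \<tau> k)"
  by (induction k arbitrary: \<tau>) (simp_all add: paths_from_0 paths_from_Suc finite_edges)

lemma weight_from_0: "weight_from x y \<tau> 0 = 1"
  by (simp add: weight_from_def paths_from_0 path_weight_def)

lemma weight_from_Suc:
  "weight_from x y \<tau> (Suc k) = (\<Sum>\<rho> | edge \<tau> \<rho>. weight x y \<tau> \<rho> * weight_from x y \<rho> k)"
proof -
  have "weight_from x y \<tau> (Suc k) = (\<Sum>\<rho> | edge \<tau> \<rho>. \<Sum>p\<in>(#) \<tau> ` paths_from \<rho> k. path_weight x y p)"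
    unfolding weight_from_def paths_from_Suc
    by (rule sum.UNION_disjoint) (auto simp: finite_edges finite_paths_from, auto simp: paths_from_def)
  also have "\<dots> = (\<Sum>\<rho> | edge \<tau> \<rho>. weight x y \<tau> \<rho> * weight_from x y \<rho> k)"
  proof (rule sum.cong)
    fix \<rho> assume "\<rho> \<in> {\<rho>. edge \<tau> \<rho>}"
    have "path_weight x y (\<tau> # p) = weight x y \<tau> \<rho> * path_weight x y p" if "p \<in> paths_from \<rho> k" for p
      using that by (cases p) (auto simp: paths_from_def path_weight_def)
    then show "(\<Sum>p\<in>(#) \<tau> ` paths_from \<rho> k. path_weight x y p) = weight x y \<tau> \<rho> * weight_from x y \<rho> k"
      by (simp add: sum.reindex weight_from_def sum_distrib_left)
  qed simp
  finally show ?thesis .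
qed

lemma path_end:
  assumes "successively edge p" "p \<noteq> []" "hd p \<in> bin_trees"
  shows "last p \<in> bin_trees \<and> card (last p) + 1 = card (hd p) + length p"
  using assms
proof (induction p)
  case (Cons \<tau> p)
  show ?case
  proof (cases p)
    case (Cons \<rho> q)
    then have "edge \<tau> \<rho>" "successively edge p"
      using Cons.prems by auto
    then show ?thesis
      using Cons.IH Cons edge_bin_tree[of \<tau> \<rho>] edge_card[of \<tau> \<rho>] by auto
  qed (use Cons.prems in auto)
qed simp

lemma paths_weight_level_eq:
  assumes "\<tau> \<in> bin_trees" "card \<tau> \<le> Suc n"
  shows "paths_weight_level x y \<tau> n = weight_from x y \<tau> (Suc n - card \<tau>)"
proof -
  \<comment> \<open>Every edge adds one node, so ending in \<open>level n\<close> is the same as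
    having \<open>Suc n - card \<tau>\<close> edges.\<close>
  have eq: "(\<Union>\<sigma>\<in>level n. paths \<tau> \<sigma>) = paths_from \<tau> (Suc n - card \<tau>)"
  proof (intro equalityI subsetI)
    fix p assume "p \<in> (\<Union>\<sigma>\<in>level n. paths \<tau> \<sigma>)"
    then have "p \<noteq> []" "hd p = \<tau>" "successively edge p" "card (last p) = Suc n"
      by (auto simp: paths_def level_def)
    then show "p \<in> paths_from \<tau> (Suc n - card \<tau>)"
      using path_end[of p] assms by (cases p) (auto simp: paths_from_def)
  next
    fix p assume "p \<in> paths_from \<tau> (Suc n - card \<tau>)"
    then have p: "p \<noteq> []" "hd p = \<tau>" "successively edge p" "length p = Suc (Suc n - card \<tau>)"
      by (auto simp: paths_from_def)
    with path_end[of p] assms have "last p \<in> level n"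
      by (auto simp: level_def)
    then show "p \<in> (\<Union>\<sigma>\<in>level n. paths \<tau> \<sigma>)"
      using p by (auto simp: paths_def)
  qed
  have "finite (paths \<tau> \<sigma>)" if "\<sigma> \<in> level n" for \<sigma>
    using that finite_paths_from[of \<tau> "Suc n - card \<tau>"] unfolding eq[symmetric]
    by (rule finite_subset[OF UN_upper])
  then have "paths_weight_level x y \<tau> n = (\<Sum>p\<in>(\<Union>\<sigma>\<in>level n. paths \<tau> \<sigma>). path_weight x y p)"
    unfolding paths_weight_level_def paths_weight_def
    by (intro sum.UNION_disjoint[symmetric]) (auto simp: finite_level paths_def)
  then show ?thesis
    by (simp only: eq weight_from_def)
qed

section \<open>The generating functions\<close>

text \<open>The power series solution of G' = \<alpha> G^2 + (1 - \<alpha>), G(0) = 1: the constant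
  1 - \<alpha> enters only the coefficient of index 1.\<close>

fun slot_coeff :: "real \<Rightarrow> nat \<Rightarrow> real" where
  "slot_coeff \<alpha> 0 = 1"
| "slot_coeff \<alpha> (Suc m) =
     (\<alpha> * (\<Sum>i\<le>m. slot_coeff \<alpha> i * slot_coeff \<alpha> (m - i)) + (if m = 0 then 1 - \<alpha> else 0)) / real (Suc m)"

declare slot_coeff.simps(2) [simp del]

text \<open>The exponential generating functions of the total weight of the growth histories out of a
  single free slot below an internal node, and out of a single leaf.  Growths at different places
  shuffle, so these series multiply; filling a slot creates a leaf, and the first child of a leaf
  turns it into a leaf and a slot.\<close>

definition slot_egf :: "real \<Rightarrow> real fps" where
  "slot_egf \<alpha> = Abs_fps (slot_coeff \<alpha>)"

definition leaf_egf :: "real \<Rightarrow> real fps" where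
  "leaf_egf \<alpha> = fps_deriv (slot_egf \<alpha>)"

text \<open>The system G' = F, F' = 2 \<alpha> F G keeps F - \<alpha> G^2 constant, and F(0) = G(0)
  = 1 fixes the constant as 1 - \<alpha>. Here this first integral is built into
  \<open>slot_coeff\<close>, and the equation for F' is derived from it.\<close>

lemma leaf_egf_eq: "leaf_egf \<alpha> = fps_const \<alpha> * slot_egf \<alpha> ^ 2 + fps_const (1 - \<alpha>)"
proof (rule fps_ext)
  fix n
  have "fps_nth (slot_egf \<alpha> ^ 2) n = (\<Sum>i\<le>n. slot_coeff \<alpha> i * slot_coeff \<alpha> (n - i))"
    by (simp add: slot_egf_def power2_eq_square fps_mult_nth atLeast0AtMost)
  then show "fps_nth (leaf_egf \<alpha>) n = fps_nth (fps_const \<alpha> * slot_egf \<alpha> ^ 2 + fps_const (1 - \<alpha>)) n"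
    by (simp add: leaf_egf_def slot_egf_def slot_coeff.simps(2) del: of_nat_Suc)
qed

lemma deriv_leaf_egf: "fps_deriv (leaf_egf \<alpha>) = fps_const (2 * \<alpha>) * leaf_egf \<alpha> * slot_egf \<alpha>"
proof -
  have "fps_deriv (leaf_egf \<alpha>) = fps_deriv (fps_const \<alpha> * (slot_egf \<alpha> * slot_egf \<alpha>) + fps_const (1 - \<alpha>))"
    by (simp only: leaf_egf_eq power2_eq_square)
  also have "\<dots> = fps_const \<alpha> * (2 * leaf_egf \<alpha> * slot_egf \<alpha>)"
    by (simp add: leaf_egf_def)
  also have "\<dots> = fps_const (2 * \<alpha>) * leaf_egf \<alpha> * slot_egf \<alpha>"
    by (simp add: fps_const_mult[symmetric] fps_numeral_fps_const mult_ac del: fps_const_mult)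
  finally show ?thesis .
qed

text \<open>The two terms are the two kinds of growth: a first child of a leaf takes (l, a) to (l, a
  + 1), and any other new node takes it to (l + 1, a - 1). For \<open>a = 0\<close> the truncated
  exponent is harmless because the factor \<open>real a\<close> vanishes.\<close>

lemma deriv_egf_product:
  "fps_deriv (leaf_egf \<alpha> ^ l * slot_egf \<alpha> ^ a) =
     fps_const (real l * (2 * \<alpha>)) * (leaf_egf \<alpha> ^ l * slot_egf \<alpha> ^ Suc a)
     + fps_const (real a) * (leaf_egf \<alpha> ^ Suc l * slot_egf \<alpha> ^ (a - 1))"
proof -
  have 1: "fps_deriv (leaf_egf \<alpha> ^ l) = fps_const (real l * (2 * \<alpha>)) * (leaf_egf \<alpha> ^ l * slot_egf \<alpha>)"
    unfolding fps_deriv_power deriv_leaf_egf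
    by (cases l) (simp_all add: mult_ac fps_const_mult[symmetric] del: fps_const_mult of_nat_Suc)
  have 2: "fps_deriv (slot_egf \<alpha> ^ a) = fps_const (real a) * (leaf_egf \<alpha> * slot_egf \<alpha> ^ (a - 1))"
    unfolding fps_deriv_power leaf_egf_def by (simp add: mult_ac)
  show ?thesis
    unfolding fps_deriv_mult 1 2 by (simp add: algebra_simps)
qed

text \<open>Summing over the first edge of a path reproduces \<open>deriv_egf_product\<close>, the l
  leaves having total weight l (x + y); the factorial turns the derivative into an index
  shift.\<close>

lemma weight_from_eq:
  assumes "\<tau> \<in> bin_trees"
  shows "weight_from x y \<tau> k = fact k * fps_nth (leaf_egf ((x + y) / 2) ^ card (leaves \<tau>) *
    slot_egf ((x + y) / 2) ^ (Suc (card \<tau>) - 2 * card (leaves \<tau>))) k"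
  using assms
proof (induction k arbitrary: \<tau>)
  case 0
  have "fps_nth (leaf_egf \<alpha>) 0 = 1" "fps_nth (slot_egf \<alpha>) 0 = 1" for \<alpha>
    by (simp_all add: leaf_egf_def slot_egf_def slot_coeff.simps(2))
  then show ?case
    by (simp add: weight_from_0 fps_power_zeroth)
next
  case (Suc k)
  define l a where "l = card (leaves \<tau>)" and "a = Suc (card \<tau>) - 2 * l"
  define F G where "F = leaf_egf ((x + y) / 2)" and "G = slot_egf ((x + y) / 2)"
  define h where "h b =
      fact k * fps_nth (if b then F ^ l * G ^ Suc a else F ^ Suc l * G ^ (a - 1)) k" for b
  have "weight_from x y \<tau> (Suc k) = (\<Sum>v\<in>slots \<tau>. slot_weight x y \<tau> v * h (butlast v \<in> leaves \<tau>))"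
    unfolding weight_from_Suc sum_edges[OF Suc.prems]
  proof (rule sum.cong)
    fix v assume v: "v \<in> slots \<tau>"
    let ?\<sigma> = "insert v \<tau>"
    have "card (leaves ?\<sigma>) = l + (if butlast v \<in> leaves \<tau> then 0 else 1)"
      using card_leaves_internal[of \<tau>] card_leaves_internal[of ?\<sigma>] bin_trees_finite[OF Suc.prems]
        card_insert_slot[OF Suc.prems v] card_internal_insert_slot[OF Suc.prems v]
      by (simp add: l_def split: if_splits)
    moreover have "2 * l \<le> Suc (card \<tau>)"
      using card_leaves_le[OF Suc.prems] by (simp add: l_def)
    ultimately show "weight x y \<tau> ?\<sigma> * weight_from x y ?\<sigma> k =
        slot_weight x y \<tau> v * h (butlast v \<in> leaves \<tau>)"
      using Suc.IH[OF insert_slot_bin_tree[OF Suc.prems v]]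
      by (simp add: weight_insert[OF Suc.prems v] card_insert_slot[OF Suc.prems v] h_def F_def G_def
          a_def Suc_diff_le)
  qed simp
  also have "\<dots> = l * (x + y) * h True + a * h False"
    unfolding l_def a_def by (rule sum_slots[OF Suc.prems])
  also have "\<dots> = fact k * fps_nth (fps_deriv (F ^ l * G ^ a)) k"
  proof -
    have "fps_nth (fps_deriv (F ^ l * G ^ a)) k =
        real l * (x + y) * fps_nth (F ^ l * G ^ Suc a) k + real a * fps_nth (F ^ Suc l * G ^ (a - 1)) k"
      unfolding F_def G_def deriv_egf_product by (simp only: fps_add_nth fps_mult_left_const_nth)
    then show ?thesis
      by (simp add: h_def distrib_left mult_ac del: power_Suc fps_deriv_nth)
  qed
  also have "\<dots> = fact (Suc k) * fps_nth (F ^ l * G ^ a) (Suc k)"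
    unfolding fps_deriv_nth by (simp add: algebra_simps)
  finally show ?case
    by (simp add: l_def a_def F_def G_def)
qed

section \<open>Asymptotics of the coefficients\<close>

lemma slot_coeff_1: "slot_coeff \<alpha> (Suc 0) = 1"
  by (simp add: slot_coeff.simps(2))

lemma slot_coeff_pos:
  assumes "\<alpha> > 0"
  shows "slot_coeff \<alpha> m > 0"
proof (induction m rule: less_induct)
  case (less m)
  show ?case
  proof (cases m)
    case (Suc k)
    have "(\<Sum>i\<le>k. slot_coeff \<alpha> i * slot_coeff \<alpha> (k - i)) > 0"
      using less Suc by (intro sum_pos) auto
    then show ?thesis
      using assms Suc by (cases "k = 0") (auto simp: slot_coeff_1 slot_coeff.simps(2)[of \<alpha> k])
  qed simp
qed

text \<open>The first two ratios are 1 and \<alpha>, which dictates the constant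
  \<open>min 1 \<alpha>\<close>. Later ratios inherit the bound by applying it inside the
  convolution.\<close>

lemma slot_coeff_Suc_ge:
  assumes "\<alpha> > 0"
  shows "slot_coeff \<alpha> (Suc m) \<ge> min 1 \<alpha> * slot_coeff \<alpha> m"
proof (induction m rule: less_induct)
  case (less m)
  let ?g = "slot_coeff \<alpha>" and ?d = "min 1 \<alpha>"
  consider "m = 0" | "m = 1" | k where "m = Suc (Suc k)"
    by (metis One_nat_def not0_implies_Suc)
  then show ?case
  proof cases
    case 1
    then show ?thesis by (simp add: slot_coeff_1)
  next
    case 2
    then show ?thesis by (simp add: slot_coeff.simps(2)[of \<alpha> "Suc 0"] slot_coeff_1)
  next
    case 3
    \<comment> \<open>From index 2 on, the recursions for \<open>?g m\<close> and
      \<open>?g (Suc m)\<close> carry no term 1 - \<alpha>. The longer convolution has one extra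
      summand, \<open>?g m\<close>; it supplies the passage from \<open>real m\<close> to
      \<open>real (Suc m)\<close>.\<close>
    let ?S = "\<Sum>i\<le>Suc k. ?g i * ?g (Suc k - i)"
    have m: "real m * ?g m = \<alpha> * ?S"
      using 3 by (simp add: slot_coeff.simps(2)[of \<alpha> "Suc k"])
    have "?d * ?S = (\<Sum>i\<le>Suc k. ?g i * (?d * ?g (Suc k - i)))"
      by (simp only: sum_distrib_left mult_ac)
    also have "\<dots> \<le> (\<Sum>i\<le>Suc k. ?g i * ?g (Suc (Suc k - i)))"
      using 3 less slot_coeff_pos[OF assms] by (intro sum_mono mult_left_mono) (auto simp: less_imp_le)
    also have "\<dots> = (\<Sum>i\<le>Suc k. ?g i * ?g (m - i))"
      using 3 by (intro sum.cong) (auto simp: Suc_diff_le)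
    finally have S: "?d * ?S \<le> (\<Sum>i\<le>Suc k. ?g i * ?g (m - i))" .
    have "real (Suc m) * ?g (Suc m) = \<alpha> * ((\<Sum>i\<le>Suc k. ?g i * ?g (m - i)) + ?g m)"
      using 3 by (simp add: slot_coeff.simps(2)[of \<alpha> "Suc (Suc k)"])
    also have "\<dots> \<ge> \<alpha> * (?d * ?S + ?g m)"
      using S assms by (intro mult_left_mono) auto
    also have "\<alpha> * (?d * ?S + ?g m) = ?d * (real m * ?g m) + \<alpha> * ?g m"
      by (simp add: m algebra_simps)
    also have "\<dots> \<ge> ?d * (real m * ?g m) + ?d * ?g m"
      using slot_coeff_pos[OF assms, of m] by (intro add_left_mono mult_right_mono) auto
    also have "?d * (real m * ?g m) + ?d * ?g m = real (Suc m) * (?d * ?g m)"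
      by (simp add: algebra_simps)
    finally show ?thesis
      by (simp del: of_nat_Suc)
  qed
qed

text \<open>For a tree with 2 l + a = |\<tau>| + 1 and N = n + 1 the index is n + 1 - |\<tau>|, the
  number of edges up to level n. The denominator is the count for a single slot, (l, a) = (0, 1); it
  does not depend on the tree and cancels in the level ratios.\<close>

definition scaled_coeff :: "real \<Rightarrow> nat \<Rightarrow> nat \<Rightarrow> nat \<Rightarrow> real" where
  "scaled_coeff \<alpha> l a N = fact (N + 1 - (2 * l + a)) *
     fps_nth (leaf_egf \<alpha> ^ l * slot_egf \<alpha> ^ a) (N + 1 - (2 * l + a)) / (fact N * slot_coeff \<alpha> N)"

definition shift_ratio :: "real \<Rightarrow> nat \<Rightarrow> real" where
  "shift_ratio \<alpha> N = fact (N - 2) * slot_coeff \<alpha> (N - 2) / (fact N * slot_coeff \<alpha> N)"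

text \<open>Going down by two indices costs at most \<open>d^2\<close> in the coefficients, with
  \<open>d = min 1 \<alpha>\<close>, whereas the factorials gain at least a factor N.\<close>

lemma shift_ratio_tendsto:
  assumes "\<alpha> > 0"
  shows "shift_ratio \<alpha> \<longlonglongrightarrow> 0"
proof (rule tendsto_sandwich[of "\<lambda>_. 0"])
  let ?g = "slot_coeff \<alpha>"
  define d where "d = min 1 \<alpha>"
  have d: "d > 0" using assms by (simp add: d_def)
  note pos = slot_coeff_pos[OF assms]
  have "shift_ratio \<alpha> N \<le> inverse (d^2) * inverse (real N)" if "N \<ge> 2" for N
  proof -
    define k where "k = N - 2"
    have k: "N = Suc (Suc k)"
      using that by (simp add: k_def)
    have "d * (d * ?g k) \<le> d * ?g (Suc k)"
      using slot_coeff_Suc_ge[OF assms] d by (intro mult_left_mono) (simp_all add: d_def)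
    also have "\<dots> \<le> ?g N"
      unfolding k d_def by (rule slot_coeff_Suc_ge[OF assms])
    finally have "d^2 * ?g k \<le> ?g N"
      by (simp add: power2_eq_square mult.assoc)
    then have gk: "?g k \<le> inverse (d^2) * ?g N"
      using d mult_left_mono[of "d^2 * ?g k" "?g N" "inverse (d^2)"]
      by (simp add: mult.assoc[symmetric])
    have fk: "fact k \<le> inverse (real N) * fact N"
    proof -
      have "fact N = real N * (real (Suc k) * fact k)"
        by (simp add: k del: of_nat_Suc)
      moreover have "fact k \<le> real (Suc k) * (fact k :: real)"
        by simp
      ultimately show ?thesis
        using that by (simp add: mult.assoc[symmetric])
    qed
    have "fact k * ?g k \<le> (inverse (real N) * fact N) * (inverse (d^2) * ?g N)"
      using pos[of k] by (intro mult_mono fk gk) auto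
    then have "fact k * ?g k / (fact N * ?g N) \<le> inverse (d^2) * inverse (real N)"
      using pos[of N] by (subst pos_divide_le_eq) (auto simp: mult_ac)
    then show ?thesis
      by (simp add: shift_ratio_def k)
  qed
  then show "\<forall>\<^sub>F N in sequentially. shift_ratio \<alpha> N \<le> inverse (d^2) * inverse (real N)"
    by (auto simp: eventually_sequentially)
  show "(\<lambda>N. inverse (d^2) * inverse (real N)) \<longlonglongrightarrow> 0"
    by (intro tendsto_mult_right_zero lim_inverse_n)
  show "\<forall>\<^sub>F N in sequentially. 0 \<le> shift_ratio \<alpha> N"
    using pos by (auto simp: shift_ratio_def less_imp_le)
qed simp

text \<open>One factor F is replaced by \<alpha> G^2 + (1 - \<alpha>). The first part keeps 2 l + a
  and hence the index; the second lowers it by two, so the same coefficient is read with N - 2 in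
  place of N, and \<open>shift_ratio\<close> corrects the denominator.\<close>

lemma scaled_coeff_leaf_Suc:
  assumes "\<alpha> > 0" "N \<ge> 2"
  shows "scaled_coeff \<alpha> (Suc l) a N =
    \<alpha> * scaled_coeff \<alpha> l (a + 2) N + (1 - \<alpha>) * (scaled_coeff \<alpha> l a (N - 2) * shift_ratio \<alpha> N)"
proof -
  let ?M = "N + 1 - (2 * Suc l + a)" and ?F = "leaf_egf \<alpha>" and ?G = "slot_egf \<alpha>"
  have "?F ^ Suc l * ?G ^ a = fps_const \<alpha> * (?F ^ l * ?G ^ (a + 2)) +
      fps_const (1 - \<alpha>) * (?F ^ l * ?G ^ a)"
    by (simp add: leaf_egf_eq algebra_simps power2_eq_square)
  then have e: "fps_nth (?F ^ Suc l * ?G ^ a) ?M =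
      \<alpha> * fps_nth (?F ^ l * ?G ^ (a + 2)) ?M + (1 - \<alpha>) * fps_nth (?F ^ l * ?G ^ a) ?M"
    by (simp only: fps_add_nth fps_mult_left_const_nth)
  have M: "N + 1 - (2 * l + (a + 2)) = ?M" "N - 2 + 1 - (2 * l + a) = ?M"
    using assms(2) by auto
  let ?D = "fact N * slot_coeff \<alpha> N"
  have "scaled_coeff \<alpha> (Suc l) a N = fact ?M * fps_nth (?F ^ Suc l * ?G ^ a) ?M / ?D"
    by (simp only: scaled_coeff_def)
  moreover have "scaled_coeff \<alpha> l (a + 2) N = fact ?M * fps_nth (?F ^ l * ?G ^ (a + 2)) ?M / ?D"
    by (simp only: scaled_coeff_def M)
  moreover have "scaled_coeff \<alpha> l a (N - 2) * shift_ratio \<alpha> N =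
      fact ?M * fps_nth (?F ^ l * ?G ^ a) ?M / ?D"
    using slot_coeff_pos[OF assms(1), of "N - 2"]
    unfolding scaled_coeff_def M(2) shift_ratio_def by simp
  moreover have "f * (\<alpha> * p + b * q) / D = \<alpha> * (f * p / D) + b * (f * q / D)" for f p q b D :: real
    by (simp add: add_divide_distrib algebra_simps)
  ultimately show ?thesis
    by (simp only: e)
qed

text \<open>The formula for (G ^ (k + 1))', solved for G ^ (k + 2). Differentiation shifts the index
  by one, exactly as the step from exponent k + 2 to k + 1 does in
  \<open>scaled_coeff\<close>.\<close>

lemma scaled_coeff_slot_Suc:
  assumes "\<alpha> > 0" "N \<ge> k + 2"
  shows "scaled_coeff \<alpha> 0 (k + 2) N =
    (scaled_coeff \<alpha> 0 (Suc k) N / real (Suc k) - (1 - \<alpha>) * (scaled_coeff \<alpha> 0 k (N - 2) * shift_ratio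
        \<alpha> N)) / \<alpha>"
proof -
  let ?M = "N - Suc k" and ?G = "slot_egf \<alpha>" and ?g = "slot_coeff \<alpha>"
  have "fps_deriv (?G ^ Suc k) =
      fps_const (real (Suc k)) * (fps_const \<alpha> * ?G ^ (k + 2) + fps_const (1 - \<alpha>) * ?G ^ k)"
    using deriv_egf_product[of \<alpha> 0 "Suc k"]
    by (simp add: leaf_egf_eq algebra_simps power2_eq_square del: of_nat_Suc)
  then have "fps_nth (fps_deriv (?G ^ Suc k)) ?M =
      real (Suc k) * (\<alpha> * fps_nth (?G ^ (k + 2)) ?M + (1 - \<alpha>) * fps_nth (?G ^ k) ?M)"
    by (simp del: of_nat_Suc fps_deriv_nth power_Suc)
  then have "real (Suc ?M) * fps_nth (?G ^ Suc k) (Suc ?M) =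
      real (Suc k) * (\<alpha> * fps_nth (?G ^ (k + 2)) ?M + (1 - \<alpha>) * fps_nth (?G ^ k) ?M)"
    by (simp only: fps_deriv_nth Suc_eq_plus1)
  moreover have "fact (Suc ?M) * X = fact ?M * (real (Suc ?M) * X)" for X :: real
    by (simp add: mult_ac del: of_nat_Suc)
  moreover have "f * (u * (\<alpha> * p + b * q)) = u * (\<alpha> * (f * p) + b * (f * q))" for f u p q b :: real
    by (simp add: algebra_simps)
  ultimately have "fact (Suc ?M) * fps_nth (?G ^ Suc k) (Suc ?M) =
      real (Suc k) * (\<alpha> * (fact ?M * fps_nth (?G ^ (k + 2)) ?M) +
          (1 - \<alpha>) * (fact ?M * fps_nth (?G ^ k) ?M))"
    by presburger
  moreover have "P = (Q / real (Suc k) - (1 - \<alpha>) * R) / \<alpha>"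
    if "Q = real (Suc k) * (\<alpha> * P + (1 - \<alpha>) * R)" for P Q R
    using assms(1) that by simp
  ultimately have *: "fact ?M * fps_nth (?G ^ (k + 2)) ?M =
      (fact (Suc ?M) * fps_nth (?G ^ Suc k) (Suc ?M) / real (Suc k) - (1 - \<alpha>) * (fact ?M * fps_nth
          (?G ^ k) ?M)) / \<alpha>"
    by blast
  have M: "N + 1 - Suc k = Suc ?M" "N + 1 - (k + 2) = ?M" "N - 2 + 1 - k = ?M"
    using assms(2) by auto
  have "scaled_coeff \<alpha> 0 k (N - 2) * shift_ratio \<alpha> N = fact ?M * fps_nth (?G ^ k) ?M / (fact N * ?g N)"
    using slot_coeff_pos[OF assms(1), of "N - 2"]
    unfolding scaled_coeff_def shift_ratio_def mult_0_right add_0 M(3) by simp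
  moreover have "scaled_coeff \<alpha> 0 (Suc k) N =
      fact (Suc ?M) * fps_nth (?G ^ Suc k) (Suc ?M) / (fact N * ?g N)"
    by (simp only: scaled_coeff_def M(1) power_0 mult_1 mult_0_right add_0)
  moreover have "scaled_coeff \<alpha> 0 (k + 2) N = fact ?M * fps_nth (?G ^ (k + 2)) ?M / (fact N * ?g N)"
    by (simp only: scaled_coeff_def M(2) power_0 mult_1 mult_0_right add_0)
  moreover have "(f * p / u - b * (g * q)) / \<alpha> / D =
      (f * p / D / u - b * (g * q / D)) / \<alpha>" for f u p q b g D :: real
    by (simp add: diff_divide_distrib mult_ac)
  ultimately show ?thesis
    by (simp only: *)
qed

text \<open>For a = 0 the series is 1 and only coefficients of positive index are read; for a = 1
  the quotient is constantly 1. Raising the exponent from k + 1 to k + 2 divides the limit by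
  \<alpha> (k + 1), the other term being killed by \<open>shift_ratio\<close>.\<close>

lemma scaled_coeff_slot_tendsto:
  assumes "\<alpha> > 0"
  shows "scaled_coeff \<alpha> 0 a \<longlonglongrightarrow> (if a = 0 then 0 else 1 / (\<alpha> ^ (a - 1) * fact (a - 1)))"
proof (induction a rule: less_induct)
  case (less a)
  consider "a = 0" | "a = 1" | k where "a = k + 2"
    by (metis One_nat_def add_2_eq_Suc' not0_implies_Suc)
  then show ?case
  proof cases
    case 1
    then have "scaled_coeff \<alpha> 0 a = (\<lambda>N. 0)"
      by (auto simp: scaled_coeff_def)
    then show ?thesis using 1 by simp
  next
    case 2
    then have "scaled_coeff \<alpha> 0 a = (\<lambda>N. 1)"
      using slot_coeff_pos[OF assms]
          by (simp add: scaled_coeff_def slot_egf_def fun_eq_iff less_imp_neq[symmetric])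
    then show ?thesis using 2 by simp
  next
    case 3
    have sh: "(\<lambda>N. scaled_coeff \<alpha> 0 k (N - 2)) \<longlonglongrightarrow> (if k = 0 then 0 else 1 / (\<alpha> ^ (k - 1) * fact (k - 1)))"
      using less.IH[of k] 3 by - (rule LIMSEQ_offset[where k = 2], simp)
    have "(\<lambda>N. (scaled_coeff \<alpha> 0 (Suc k) N / real (Suc k) -
        (1 - \<alpha>) * (scaled_coeff \<alpha> 0 k (N - 2) * shift_ratio \<alpha> N)) / \<alpha>)
        \<longlonglongrightarrow> (1 / (\<alpha> ^ k * fact k) / real (Suc k) - (1 - \<alpha>) * ((if k =
            0 then 0 else 1 / (\<alpha> ^ (k - 1) * fact (k - 1))) * 0)) / \<alpha>"
      using less.IH[of "Suc k"] 3 assms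
      by (intro tendsto_diff tendsto_divide tendsto_mult tendsto_const sh shift_ratio_tendsto) simp_all
    moreover have "\<forall>\<^sub>F N in sequentially. (scaled_coeff \<alpha> 0 (Suc k) N / real (Suc k) -
        (1 - \<alpha>) * (scaled_coeff \<alpha> 0 k (N - 2) * shift_ratio \<alpha> N)) / \<alpha> = scaled_coeff \<alpha> 0 a N"
      using eventually_ge_at_top[of "k + 2"]
      by eventually_elim (simp only: 3 scaled_coeff_slot_Suc[OF assms])
    ultimately show ?thesis
      using 3 by (simp add: tendsto_cong mult_ac add_ac)
  qed
qed

text \<open>Each leaf is traded for two slots and a factor \<alpha>.\<close>

lemma scaled_coeff_tendsto:
  assumes "\<alpha> > 0"
  shows "scaled_coeff \<alpha> l a \<longlonglongrightarrow>
    \<alpha> ^ l * (if 2 * l + a = 0 then 0 else 1 / (\<alpha> ^ (2 * l + a - 1) * fact (2 * l + a - 1)))"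
proof (induction l arbitrary: a)
  case 0
  then show ?case using scaled_coeff_slot_tendsto[OF assms, of a] by (cases "a = 0") simp_all
next
  case (Suc l)
  let ?L = "\<alpha> ^ l * (if 2 * l + a = 0 then 0 else 1 / (\<alpha> ^ (2 * l + a - 1) * fact (2 * l + a - 1)))"
  have sh: "(\<lambda>N. scaled_coeff \<alpha> l a (N - 2)) \<longlonglongrightarrow> ?L"
    using Suc.IH[of a] by - (rule LIMSEQ_offset[where k = 2], simp)
  have "(\<lambda>N. \<alpha> * scaled_coeff \<alpha> l (a + 2) N + (1 - \<alpha>) * (scaled_coeff \<alpha> l a (N - 2) * shift_ratio \<alpha> N))
      \<longlonglongrightarrow> \<alpha> * (\<alpha> ^ l * (1 / (\<alpha> ^ (2 * l + (a + 2) - 1) * fact (2 * l + (a + 2) - 1)))) +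
          (1 - \<alpha>) * (?L * 0)"
    using Suc.IH[of "a + 2"] by (intro tendsto_intros sh shift_ratio_tendsto assms) auto
  moreover have "\<forall>\<^sub>F N in sequentially. \<alpha> * scaled_coeff \<alpha> l (a + 2) N +
      (1 - \<alpha>) * (scaled_coeff \<alpha> l a (N - 2) * shift_ratio \<alpha> N) = scaled_coeff \<alpha> (Suc l) a N"
    using eventually_ge_at_top[of 2]
    by eventually_elim (simp only: scaled_coeff_leaf_Suc[OF assms])
  ultimately show ?case
    by (simp add: tendsto_cong mult_ac)
qed

section \<open>The harmonic function\<close>

definition growth_harm :: "real \<Rightarrow> real \<Rightarrow> tree \<Rightarrow> real" where
  "growth_harm x y \<tau> = 1 / fact (card \<tau>) * (2 / (x + y)) ^ card (internal \<tau>)"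

lemma root_leaves: "leaves root_tree = {[]}" "internal root_tree = {}"
  by (auto simp: root_tree_def leaves_def internal_def)

lemma growth_harm_root: "growth_harm x y root_tree = 1"
  by (simp add: growth_harm_def root_leaves) (simp add: root_tree_def)

text \<open>The common factor \<open>fact (Suc n) * slot_coeff \<alpha> (Suc n)\<close> cancels.
  With 2 l + a = |\<tau>| + 1 the limit is \<alpha>^l / (\<alpha>^|\<tau>| |\<tau>|!), and |\<tau>|
  - l counts the internal nodes.\<close>

lemma level_ratio_tendsto:
  assumes "x > 0" "y > 0" "\<tau> \<in> bin_trees"
  shows "(\<lambda>n. level_ratio x y n \<tau>) \<longlonglongrightarrow> growth_harm x y \<tau>"
proof -
  define \<alpha> where "\<alpha> = (x + y) / 2"
  have \<alpha>: "\<alpha> > 0" using assms by (simp add: \<alpha>_def)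
  have eq: "paths_weight_level x y \<sigma> n =
      scaled_coeff \<alpha> (card (leaves \<sigma>)) (Suc (card \<sigma>) - 2 * card (leaves \<sigma>)) (Suc n) * (fact (Suc n)
          * slot_coeff \<alpha> (Suc n))"
    if "\<sigma> \<in> bin_trees" "card \<sigma> \<le> Suc n" for \<sigma> n
  proof -
    have "Suc n + 1 - (2 * card (leaves \<sigma>) + (Suc (card \<sigma>) - 2 * card (leaves \<sigma>))) = Suc n - card \<sigma>"
      using card_leaves_le[OF that(1)] by simp
    then show ?thesis
      using slot_coeff_pos[OF \<alpha>, of "Suc n"]
      by (simp add: paths_weight_level_eq[OF that] weight_from_eq[OF that(1)] scaled_coeff_def \<alpha>_def
          del: fact_Suc)
  qed
  have lim: "(\<lambda>n. scaled_coeff \<alpha> (card (leaves \<sigma>)) (Suc (card \<sigma>) - 2 * card (leaves \<sigma>)) (Suc n)) \<longlonglongrightarrow>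
      growth_harm x y \<sigma>"
    if "\<sigma> \<in> bin_trees" for \<sigma>
  proof -
    let ?l = "card (leaves \<sigma>)"
    have "2 * ?l + (Suc (card \<sigma>) - 2 * ?l) = Suc (card \<sigma>)"
      using card_leaves_le[OF that] by simp
    then have "scaled_coeff \<alpha> ?l (Suc (card \<sigma>) - 2 * ?l) \<longlonglongrightarrow> \<alpha> ^ ?l * (1 / (\<alpha> ^ card \<sigma> * fact (card \<sigma>)))"
      using scaled_coeff_tendsto[OF \<alpha>, of ?l "Suc (card \<sigma>) - 2 * ?l"] by simp
    moreover have "\<alpha> ^ ?l * (1 / (\<alpha> ^ card \<sigma> * fact (card \<sigma>))) = growth_harm x y \<sigma>"
    proof -
      have "\<alpha> ^ card \<sigma> = \<alpha> ^ ?l * \<alpha> ^ card (internal \<sigma>)"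
        using card_leaves_internal[OF bin_trees_finite[OF that]] by (metis power_add)
      moreover have "(2 / (x + y)) ^ card (internal \<sigma>) = 1 / \<alpha> ^ card (internal \<sigma>)"
        by (simp add: \<alpha>_def power_divide)
      ultimately show ?thesis
        using \<alpha> by (simp add: growth_harm_def)
    qed
    ultimately show ?thesis
      by (simp add: LIMSEQ_Suc)
  qed
  have "(\<lambda>n. scaled_coeff \<alpha> (card (leaves \<tau>)) (Suc (card \<tau>) - 2 * card (leaves \<tau>)) (Suc n) /
      scaled_coeff \<alpha> (card (leaves root_tree)) (Suc (card root_tree) - 2 * card (leaves root_tree))
          (Suc n))
      \<longlonglongrightarrow> growth_harm x y \<tau> / growth_harm x y root_tree"
    by (intro tendsto_divide lim assms root_tree_bin_tree) (simp add: growth_harm_root)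
  moreover have "\<forall>\<^sub>F n in sequentially.
      scaled_coeff \<alpha> (card (leaves \<tau>)) (Suc (card \<tau>) - 2 * card (leaves \<tau>)) (Suc n) /
      scaled_coeff \<alpha> (card (leaves root_tree)) (Suc (card root_tree) - 2 * card (leaves root_tree))
          (Suc n)
      = level_ratio x y n \<tau>"
    using eventually_ge_at_top[of "card \<tau>"]
  proof eventually_elim
    case (elim n)
    have "card root_tree \<le> Suc n" by (simp add: root_tree_def)
    then show ?case
      using elim slot_coeff_pos[OF \<alpha>, of "Suc n"]
      unfolding level_ratio_def by (simp add: eq assms(3) root_tree_bin_tree del: fact_Suc)
  qed
  ultimately show ?thesis
    by (simp add: tendsto_cong growth_harm_root)
qed

lemma growth_harm_pos: "x > 0 \<Longrightarrow> y > 0 \<Longrightarrow> growth_harm x y \<tau> > 0"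
  by (simp add: growth_harm_def)

text \<open>The whole sequence of level ratios converges, so all its subsequences have the same
  limit; the identity subsequence shows that it is attained.\<close>

lemma limit_point_iff:
  assumes "x > 0" "y > 0"
  shows "limit_point x y \<phi> \<longleftrightarrow> \<phi> = restrict (growth_harm x y) bin_trees"
proof
  assume "limit_point x y \<phi>"
  then obtain r where \<phi>: "\<phi> \<in> extensional bin_trees" and r: "strict_mono r"
    and lim: "\<And>\<tau>. \<tau> \<in> bin_trees \<Longrightarrow> (\<lambda>k. level_ratio x y (r k) \<tau>) \<longlonglongrightarrow> \<phi> \<tau>"
    by (auto simp: limit_point_def)
  have "\<phi> \<tau> = growth_harm x y \<tau>" if "\<tau> \<in> bin_trees" for \<tau>
    using LIMSEQ_unique[OF lim[OF that]] LIMSEQ_subseq_LIMSEQ[OF level_ratio_tendsto[OF assms that] r]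
    by (simp add: o_def)
  then show "\<phi> = restrict (growth_harm x y) bin_trees"
    using \<phi> by (auto simp: extensional_def fun_eq_iff)
next
  assume "\<phi> = restrict (growth_harm x y) bin_trees"
  then show "limit_point x y \<phi>"
    using level_ratio_tendsto[OF assms] strict_mono_id by (auto simp: limit_point_def
        intro!: exI[of _ "\<lambda>n. n"] simp: strict_mono_def)
qed

lemma growth_harm_insert:
  assumes "\<tau> \<in> bin_trees" "v \<in> slots \<tau>"
  shows "growth_harm x y (insert v \<tau>) = growth_harm x y \<tau> / (real (card \<tau>) +
      1) * (if butlast v \<in> leaves \<tau> then 2 / (x + y) else 1)"
  by (simp add: growth_harm_def card_insert_slot[OF assms] card_internal_insert_slot[OF assms]
      mult_ac add_ac)

text \<open>Checked on the formula rather than by passing to the limit. The children of a leaf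
  contribute (x + y) * 2 / (x + y) = 2, as much as two slots of weight 1, so the total is |\<tau>| +
  1, which cancels the new factor of the factorial.\<close>

lemma positive_harmonic_harm:
  assumes "x > 0" "y > 0"
  shows "positive_harmonic x y (restrict (growth_harm x y) bin_trees)"
proof -
  have harm: "growth_harm x y \<tau> =
      (\<Sum>\<sigma> | edge \<tau> \<sigma>. weight x y \<tau> \<sigma> * restrict (growth_harm x y) bin_trees \<sigma>)"
    if \<tau>: "\<tau> \<in> bin_trees" for \<tau>
  proof -
    let ?l = "card (leaves \<tau>)"
    define h where "h b = growth_harm x y \<tau> / (real (card \<tau>) + 1) * (if b then 2 / (x + y) else 1)" for b
    have "(\<Sum>\<sigma> | edge \<tau> \<sigma>. weight x y \<tau> \<sigma> * restrict (growth_harm x y) bin_trees \<sigma>) =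
        (\<Sum>v\<in>slots \<tau>. slot_weight x y \<tau> v * h (butlast v \<in> leaves \<tau>))"
      unfolding sum_edges[OF \<tau>]
      by (intro sum.cong refl) (simp add: weight_insert[OF \<tau>] insert_slot_bin_tree[OF \<tau>]
          growth_harm_insert[OF \<tau>] h_def)
    also have "\<dots> = ?l * (x + y) * h True + real (Suc (card \<tau>) - 2 * ?l) * h False"
      by (rule sum_slots[OF \<tau>])
    also have "?l * (x + y) * h True = ?l * (2 * h False)"
      using assms by (simp add: h_def)
    also have "?l * (2 * h False) + real (Suc (card \<tau>) - 2 * ?l) * h False =
        (2 * ?l + real (Suc (card \<tau>) - 2 * ?l)) * (growth_harm x y \<tau> / (real (card \<tau>) + 1))"
      by (simp add: h_def algebra_simps)
    also have "2 * ?l + real (Suc (card \<tau>) - 2 * ?l) = real (card \<tau>) + 1"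
      using card_leaves_le[OF \<tau>] by (simp add: of_nat_diff)
    also have "\<dots> * (growth_harm x y \<tau> / (real (card \<tau>) + 1)) = growth_harm x y \<tau>"
      by simp
    finally show ?thesis by simp
  qed
  show ?thesis
    unfolding positive_harmonic_def
  proof (intro conjI ballI)
    fix \<tau> assume "\<tau> \<in> bin_trees"
    then show "restrict (growth_harm x y) bin_trees \<tau> =
        (\<Sum>\<sigma> | edge \<tau> \<sigma>. weight x y \<tau> \<sigma> * restrict (growth_harm x y) bin_trees \<sigma>)"
      using harm by (simp only: restrict_apply')
  qed (simp_all add: root_tree_bin_tree growth_harm_root growth_harm_pos assms)
qed

definition step_prob :: "real \<Rightarrow> real \<Rightarrow> tree \<Rightarrow> word \<Rightarrow> real" where
  "step_prob x y \<tau> v = slot_weight (2 * x / (x + y)) (2 * y / (x + y)) \<tau> v / (real (card \<tau>) + 1)"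

lemma trans_prob_insert:
  assumes "x > 0" "y > 0" "\<tau> \<in> bin_trees" "v \<in> slots \<tau>"
  shows "trans_prob x y (restrict (growth_harm x y) bin_trees) \<tau> (insert v \<tau>) = step_prob x y \<tau> v"
  using growth_harm_pos[OF assms(1,2), of \<tau>] insert_slot_bin_tree[OF assms(3,4)] assms
  by (auto simp: trans_prob_def weight_insert growth_harm_insert step_prob_def slot_weight_def
      split: letter.split)

lemma step_prob_pos: "x > 0 \<Longrightarrow> y > 0 \<Longrightarrow> step_prob x y \<tau> v > 0"
  by (auto simp: step_prob_def slot_weight_def split: letter.split)

lemma trans_prob_nonzero_iff:
  assumes "x > 0" "y > 0" "\<tau> \<in> bin_trees"
  shows "trans_prob x y (restrict (growth_harm x y) bin_trees) \<tau> \<sigma> \<noteq> 0 \<longleftrightarrow> edge \<tau> \<sigma>"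
proof
  assume "edge \<tau> \<sigma>"
  then show "trans_prob x y (restrict (growth_harm x y) bin_trees) \<tau> \<sigma> \<noteq> 0"
    using trans_prob_insert[OF assms] step_prob_pos[OF assms(1,2)]
    by (metis edge_iff_slot less_irrefl)
qed (auto simp: trans_prob_def weight_def split: if_splits)

section \<open>The splitting law of a random tree\<close>

definition split_prob :: "real \<Rightarrow> real \<Rightarrow> nat \<Rightarrow> nat \<Rightarrow> real" where
  "split_prob x y a b = 2 / (x + y) * (x * real a + y * real b) / (real (a + b) * (real (a + b) + 1))"

text \<open>The product must avoid the leaves: division by zero gives
  \<open>split_prob x y 0 0\<close> the value 0.\<close>

definition tree_prob :: "real \<Rightarrow> real \<Rightarrow> tree \<Rightarrow> real" where
  "tree_prob x y \<tau> =
     (\<Prod>i\<in>internal \<tau>. split_prob x y (card (subtree \<tau> (i @ [L1]))) (card (subtree \<tau> (i @ [L2]))))"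

lemma join_trees_simps [simp]:
  "[] \<in> join_trees \<tau>1 \<tau>2" "L1 # w \<in> join_trees \<tau>1 \<tau>2 \<longleftrightarrow> w \<in> \<tau>1" "L2 # w \<in> join_trees \<tau>1 \<tau>2 \<longleftrightarrow> w \<in> \<tau>2"
  by (auto simp: join_trees_def)

lemma letter_cases_ex: "(\<exists>j :: letter. P j) \<longleftrightarrow> P L1 \<or> P L2"
  by (metis letter.exhaust)

lemma internal_join:
  assumes "prefix_closed \<tau>1" "prefix_closed \<tau>2"
  shows "internal (join_trees \<tau>1 \<tau>2) =
    (if \<tau>1 = {} \<and> \<tau>2 = {} then {} else insert [] ((#) L1 ` internal \<tau>1 \<union> (#) L2 ` internal \<tau>2))"
proof -
  have "w \<in> internal (join_trees \<tau>1 \<tau>2) \<longleftrightarrow> w \<in> (if \<tau>1 = {} \<and> \<tau>2 =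
      {} then {} else insert [] ((#) L1 ` internal \<tau>1 \<union> (#) L2 ` internal \<tau>2))" for w
  proof (cases w)
    case Nil
    then show ?thesis
      using prefix_closed_Nil[OF assms(1)] prefix_closed_Nil[OF assms(2)]
      by (auto simp: internal_def letter_cases_ex)
  next
    case (Cons a u)
    then show ?thesis
      by (cases a) (auto simp: internal_def)
  qed
  then show ?thesis by blast
qed

lemma leaves_join:
  assumes "prefix_closed \<tau>1" "prefix_closed \<tau>2"
  shows "leaves (join_trees \<tau>1 \<tau>2) =
    (if \<tau>1 = {} \<and> \<tau>2 = {} then {[]} else (#) L1 ` leaves \<tau>1 \<union> (#) L2 ` leaves \<tau>2)"
  unfolding leaves_def internal_join[OF assms] by (auto simp: join_trees_def)

lemma tree_prob_empty [simp]: "tree_prob x y {} = 1"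
  by (simp add: tree_prob_def internal_def)

lemma tree_prob_join_empty [simp]: "tree_prob x y (join_trees {} {}) = 1"
  by (simp add: tree_prob_def internal_def join_trees_def)

lemma finite_internal: "finite \<tau> \<Longrightarrow> finite (internal \<tau>)"
  by (simp add: internal_def)

lemma tree_prob_join:
  assumes "prefix_closed \<tau>1" "prefix_closed \<tau>2" "\<tau>1 \<noteq> {} \<or> \<tau>2 \<noteq> {}"
  shows "tree_prob x y (join_trees \<tau>1 \<tau>2) =
    split_prob x y (card \<tau>1) (card \<tau>2) * tree_prob x y \<tau>1 * tree_prob x y \<tau>2"
proof -
  note fin = finite_internal[OF prefix_closed_finite[OF assms(1)]] finite_internal[OF
      prefix_closed_finite[OF assms(2)]]
  let ?\<sigma> = "join_trees \<tau>1 \<tau>2"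
  let ?f = "\<lambda>\<tau> i. split_prob x y (card (subtree \<tau> (i @ [L1]))) (card (subtree \<tau> (i @ [L2])))"
  have "tree_prob x y ?\<sigma> =
      ?f ?\<sigma> [] * (prod (?f ?\<sigma>) ((#) L1 ` internal \<tau>1) * prod (?f ?\<sigma>) ((#) L2 ` internal \<tau>2))"
  proof -
    have "internal ?\<sigma> = insert [] ((#) L1 ` internal \<tau>1 \<union> (#) L2 ` internal \<tau>2)"
      using internal_join[OF assms(1,2)] assms(3) by auto
    then have "tree_prob x y ?\<sigma> = ?f ?\<sigma> [] * prod (?f ?\<sigma>) ((#) L1 ` internal \<tau>1 \<union> (#) L2 ` internal \<tau>2)"
      unfolding tree_prob_def by (simp only:, subst prod.insert) (use fin in auto)
    also have "prod (?f ?\<sigma>) ((#) L1 ` internal \<tau>1 \<union> (#) L2 ` internal \<tau>2) =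
        prod (?f ?\<sigma>) ((#) L1 ` internal \<tau>1) * prod (?f ?\<sigma>) ((#) L2 ` internal \<tau>2)"
      using fin by (intro prod.union_disjoint) auto
    finally show ?thesis .
  qed
  also have "?f ?\<sigma> [] = split_prob x y (card \<tau>1) (card \<tau>2)"
    by simp
  also have "prod (?f ?\<sigma>) ((#) L1 ` internal \<tau>1) = tree_prob x y \<tau>1"
    by (simp add: prod.reindex tree_prob_def subtree_Cons[of ?\<sigma> _ "_ @ _"])
  also have "prod (?f ?\<sigma>) ((#) L2 ` internal \<tau>2) = tree_prob x y \<tau>2"
    by (simp add: prod.reindex tree_prob_def subtree_Cons[of ?\<sigma> _ "_ @ _"])
  finally show ?thesis by simp
qed

lemma split_prob_nonneg: "x > 0 \<Longrightarrow> y > 0 \<Longrightarrow> split_prob x y a b \<ge> 0"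
  by (simp add: split_prob_def)

lemma tree_prob_nonneg: "x > 0 \<Longrightarrow> y > 0 \<Longrightarrow> tree_prob x y \<tau> \<ge> 0"
  by (auto simp: tree_prob_def intro!: prod_nonneg split_prob_nonneg)

text \<open>The forward equation of an urn: when the subtrees have sizes a - 1 and b, the next node
  goes left with weight a out of a + b + 1. For a + b = 1 it would involve the degenerate value at
  (0, 0). A truncated a - 1 or b - 1 is multiplied by zero.\<close>

lemma split_prob_recursion:
  assumes "x + y > 0" "a + b \<ge> 2"
  shows "split_prob x y (a - 1) b * real a + split_prob x y a (b - 1) * real b =
    (real (a + b) + 1) * split_prob x y a b"
proof -
  define p q N where "p = real a" and "q = real b" and "N = p + q"
  have N: "N \<ge> 2" using assms(2) by (simp add: N_def p_def q_def)
  have 1: "split_prob x y (a - 1) b * real a = 2 / (x + y) * (x * (p - 1) + y * q) * p / ((N - 1) * N)"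
    by (cases "a = 0") (auto simp: split_prob_def p_def q_def N_def of_nat_diff algebra_simps)
  have 2: "split_prob x y a (b - 1) * real b = 2 / (x + y) * (x * p + y * (q - 1)) * q / ((N - 1) * N)"
    by (cases "b = 0") (auto simp: split_prob_def p_def q_def N_def of_nat_diff algebra_simps)
  have "(x * (p - 1) + y * q) * p + (x * p + y * (q - 1)) * q = (x * p + y * q) * (N - 1)"
    by (simp add: N_def algebra_simps)
  moreover have "k * A * p / D + k * B * q / D = k * (A * p + B * q) / D" for k A B D :: real
    by (simp add: add_divide_distrib distrib_left mult.assoc)
  ultimately have "split_prob x y (a - 1) b * real a + split_prob x y a (b - 1) * real b =
      2 / (x + y) * ((x * p + y * q) * (N - 1)) / ((N - 1) * N)"
    unfolding 1 2 by (simp only:)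
  also have "\<dots> = 2 / (x + y) * (x * p + y * q) / N"
    using N by simp
  also have "\<dots> = (N + 1) * (2 / (x + y) * (x * p + y * q) / (N * (N + 1)))"
    using N by simp
  finally show ?thesis
    by (simp add: split_prob_def N_def p_def q_def)
qed

lemma prefix_closed_remove_leaf:
  assumes "prefix_closed \<tau>" "v \<in> leaves \<tau>"
  shows "prefix_closed (\<tau> - {v})"
  using assms prefix_closedD[OF assms(1)]
  by (intro prefix_closedI) (auto simp: prefix_closed_finite leaves_def internal_def)

lemma prefix_closed_cases:
  assumes "prefix_closed \<sigma>"
  obtains "\<sigma> = {}" | \<tau>1 \<tau>2 where "\<sigma> = join_trees \<tau>1 \<tau>2" "prefix_closed \<tau>1" "prefix_closed \<tau>2"
  using assms join_subtrees[of \<sigma>] prefix_closed_Nil[of \<sigma>] prefix_closed_subtree[of \<sigma>] by metis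

text \<open>For \<open>v = []\<close> and an empty subtree the new node hangs below the root of the
  join, which is internal, and both sides are 1.\<close>

lemma slot_weight_join:
  assumes "prefix_closed \<tau>1" "prefix_closed \<tau>2" "\<tau>1 \<noteq> {} \<or> \<tau>2 \<noteq> {}"
  shows "v \<noteq> [] \<or> \<tau>1 = {} \<Longrightarrow> slot_weight a b (join_trees \<tau>1 \<tau>2) (L1 # v) = slot_weight a b \<tau>1 v"
    and "v \<noteq> [] \<or> \<tau>2 = {} \<Longrightarrow> slot_weight a b (join_trees \<tau>1 \<tau>2) (L2 # v) = slot_weight a b \<tau>2 v"
proof -
  have "leaves (join_trees \<tau>1 \<tau>2) = (#) L1 ` leaves \<tau>1 \<union> (#) L2 ` leaves \<tau>2"
    using leaves_join[OF assms(1,2)] assms(3) by auto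
  moreover have "leaves {} = {}"
    by (simp add: leaves_def)
  ultimately show "v \<noteq> [] \<or> \<tau>1 = {} \<Longrightarrow> slot_weight a b (join_trees \<tau>1 \<tau>2) (L1 # v) = slot_weight a b \<tau>1 v"
    and "v \<noteq> [] \<or> \<tau>2 = {} \<Longrightarrow> slot_weight a b (join_trees \<tau>1 \<tau>2) (L2 # v) = slot_weight a b \<tau>2 v"
    by (cases "v = []"; auto simp: slot_weight_def)+
qed

text \<open>One step of the growth chain maps the splitting law of size \<open>m\<close> to that of size
  \<open>m + 1\<close>.  The empty tree is included so that the induction on subtrees needs no case distinction.\<close>

lemma sum_remove_leaf:
  assumes "x > 0" "y > 0" "prefix_closed \<sigma>"
  shows "(\<Sum>v\<in>leaves \<sigma>. tree_prob x y (\<sigma> - {v}) *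
      slot_weight (2 * x / (x + y)) (2 * y / (x + y)) (\<sigma> - {v}) v) = real (card \<sigma>) * tree_prob x y \<sigma>"
  using assms(3)
proof (induction "card \<sigma>" arbitrary: \<sigma> rule: less_induct)
  case less
  let ?sw = "slot_weight (2 * x / (x + y)) (2 * y / (x + y))"
  let ?R = "\<lambda>\<sigma>. \<Sum>v\<in>leaves \<sigma>. tree_prob x y (\<sigma> - {v}) * ?sw (\<sigma> - {v}) v"
  from less.prems show ?case
  proof (cases rule: prefix_closed_cases)
    case 1
    then show ?thesis by (simp add: leaves_def)
  next
    case (2 \<tau>1 \<tau>2)
    let ?a = "card \<tau>1" and ?b = "card \<tau>2"
    have fin: "finite \<tau>1" "finite \<tau>2"
      using 2 by (simp_all add: prefix_closed_finite)
    have card: "card \<sigma> = Suc (?a + ?b)"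
      using 2 fin by (simp add: card_join)
    have IH: "?R \<tau>1 = ?a * tree_prob x y \<tau>1" "?R \<tau>2 = ?b * tree_prob x y \<tau>2"
      by (rule less.hyps; use card 2 in simp)+
    have rem: "join_trees \<tau>1 \<tau>2 - {L1 # v} = join_trees (\<tau>1 - {v}) \<tau>2"
        "join_trees \<tau>1 \<tau>2 - {L2 # v} = join_trees \<tau>1 (\<tau>2 - {v})" for v
      by (auto simp: join_trees_def)
    show ?thesis
    proof (cases "?a + ?b \<ge> 2")
      case True
      have ne: "\<tau>1 \<noteq> {} \<or> \<tau>2 \<noteq> {}" using True by auto
      have ne1: "\<tau>1 - {v} \<noteq> {} \<or> \<tau>2 \<noteq> {}" and ne2: "\<tau>1 \<noteq> {} \<or> \<tau>2 - {v} \<noteq> {}" for v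
        using True by (auto simp: subset_singleton_iff)
      \<comment> \<open>The root is a removable leaf only in the one-node tree. This provides the
        side condition of \<open>slot_weight_join\<close> when \<open>v = []\<close>.\<close>
      have nil: "\<tau> - {[]} = {}" if "[] \<in> leaves \<tau>" "prefix_closed \<tau>" for \<tau>
      proof -
        have "[j] @ w \<notin> \<tau>" for j w
          using that prefix_closedD[OF that(2), of "[j]" w] by (auto simp: leaves_def internal_def)
        then show ?thesis
          by (metis Diff_eq_empty_iff append_Cons append_Nil neq_Nil_conv singleton_iff subsetI)
      qed
      have t1: "tree_prob x y (join_trees (\<tau>1 - {v}) \<tau>2) * ?sw (join_trees (\<tau>1 - {v}) \<tau>2) (L1 # v) =
          split_prob x y (?a - 1) ?b * tree_prob x y \<tau>2 * (tree_prob x y (\<tau>1 - {v}) * ?sw (\<tau>1 - {v}) v)"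
        if "v \<in> leaves \<tau>1" for v
      proof -
        have "card (\<tau>1 - {v}) = ?a - 1"
          using that fin by (simp add: leaves_def)
        then show ?thesis
          using prefix_closed_remove_leaf[OF 2(2) that] 2(3) ne1[of v] nil[OF _ 2(2)] that
          by (subst tree_prob_join, simp_all, subst slot_weight_join(1)) auto
      qed
      have t2: "tree_prob x y (join_trees \<tau>1 (\<tau>2 - {v})) * ?sw (join_trees \<tau>1 (\<tau>2 - {v})) (L2 # v) =
          split_prob x y ?a (?b - 1) * tree_prob x y \<tau>1 * (tree_prob x y (\<tau>2 - {v}) * ?sw (\<tau>2 - {v}) v)"
        if "v \<in> leaves \<tau>2" for v
      proof -
        have "card (\<tau>2 - {v}) = ?b - 1"
          using that fin by (simp add: leaves_def)
        then show ?thesis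
          using prefix_closed_remove_leaf[OF 2(3) that] 2(2) ne2[of v] nil[OF _ 2(3)] that
          by (subst tree_prob_join, simp_all, subst slot_weight_join(2)) auto
      qed
      have "?R \<sigma> = (\<Sum>v\<in>leaves \<tau>1. tree_prob x y (join_trees (\<tau>1 - {v}) \<tau>2) * ?sw (join_trees (\<tau>1 -
          {v}) \<tau>2) (L1 # v)) +
          (\<Sum>v\<in>leaves \<tau>2. tree_prob x y (join_trees \<tau>1 (\<tau>2 - {v})) * ?sw (join_trees \<tau>1 (\<tau>2 - {v}))
              (L2 # v))"
        unfolding 2(1) leaves_join[OF 2(2,3)] using ne fin
        by (simp, subst sum.union_disjoint) (auto simp: finite_leaves sum.reindex rem)
      also have "\<dots> = split_prob x y (?a - 1) ?b * tree_prob x y \<tau>2 * ?R \<tau>1 +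
          split_prob x y ?a (?b - 1) * tree_prob x y \<tau>1 * ?R \<tau>2"
        by (simp add: t1 t2 sum_distrib_left)
      also have "\<dots> = (split_prob x y (?a - 1) ?b * ?a +
          split_prob x y ?a (?b - 1) * ?b) * (tree_prob x y \<tau>1 * tree_prob x y \<tau>2)"
        unfolding IH by (simp add: algebra_simps)
      also have "\<dots> = (real (?a + ?b) + 1) * (split_prob x y ?a ?b * tree_prob x y \<tau>1 * tree_prob x y \<tau>2)"
        using assms True by (subst split_prob_recursion) (auto simp: mult_ac)
      finally show ?thesis
        by (simp only: 2(1) tree_prob_join[OF 2(2,3) ne] card[unfolded 2(1)] of_nat_Suc add.commute)
    next
      case False
      have single: "\<tau> = {[]}" if "card \<tau> = 1" "prefix_closed \<tau>" for \<tau>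
        using that prefix_closed_Nil[of \<tau>] by (metis card_1_singletonE insert_not_empty singletonD)
      consider "?a = 0 \<and> ?b = 0" | "?a = 1 \<and> ?b = 0" | "?a = 0 \<and> ?b = 1"
        using False by linarith
      then show ?thesis
      proof cases
        case 1
        then have "\<sigma> = {[]}" using 2 fin by (simp add: join_trees_def)
        then show ?thesis
          by (simp add: leaves_def internal_def tree_prob_def slot_weight_def)
      next
        case c: 2
        then have "\<tau>1 = {[]}" "\<tau>2 = {}" using 2 fin single by auto
        then have \<sigma>: "\<sigma> = {[], [L1]}" using 2(1) by (auto simp: join_trees_def)
        have "leaves \<sigma> = {[L1]}" "internal \<sigma> = {[]}" "leaves {[]} = {[]}" "internal {[]} = {}"
            "\<sigma> - {[L1]} = {[]}"
          unfolding \<sigma> leaves_def internal_def by auto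
        moreover have "subtree \<sigma> [L1] = {[]}" "subtree \<sigma> [L2] = {}" "card \<sigma> = 2"
          unfolding \<sigma> subtree_def by auto
        ultimately show ?thesis
          using assms by (simp add: tree_prob_def split_prob_def slot_weight_def field_simps)
      next
        case c: 3
        then have "\<tau>1 = {}" "\<tau>2 = {[]}" using 2 fin single by auto
        then have \<sigma>: "\<sigma> = {[], [L2]}" using 2(1) by (auto simp: join_trees_def)
        have "leaves \<sigma> = {[L2]}" "internal \<sigma> = {[]}" "leaves {[]} = {[]}" "internal {[]} = {}"
            "\<sigma> - {[L2]} = {[]}"
          unfolding \<sigma> leaves_def internal_def by auto
        moreover have "subtree \<sigma> [L2] = {[]}" "subtree \<sigma> [L1] = {}" "card \<sigma> = 2"
          unfolding \<sigma> subtree_def by auto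
        ultimately show ?thesis
          using assms by (simp add: tree_prob_def split_prob_def slot_weight_def field_simps)
      qed
    qed
  qed
qed

section \<open>Asymptotic independence of the splits\<close>

text \<open>The denominator counts proper descendants, so that left and right shares of a node with
  children add up to exactly 1. Empty and one-node subtrees give 0, hence the ratio always lies in
  [0, 1].\<close>

definition split_ratio :: "word \<Rightarrow> tree \<Rightarrow> real" where
  "split_ratio w \<tau> = real (card (subtree \<tau> (w @ [L1]))) / (real (card (subtree \<tau> w)) - 1)"

definition words_below :: "nat \<Rightarrow> word set" where
  "words_below d = {w. length w < d}"

lemma words_below_0 [simp]: "words_below 0 = {}"
  by (simp add: words_below_def)

lemma words_below_Suc: "words_below (Suc d) =
    insert [] ((#) L1 ` words_below d \<union> (#) L2 ` words_below d)"
proof -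
  have "w \<in> words_below (Suc d) \<longleftrightarrow> w \<in> insert [] ((#) L1 ` words_below d \<union> (#) L2 ` words_below d)" for w
  proof (cases w)
    case (Cons a u)
    then show ?thesis by (cases a) (auto simp: words_below_def)
  qed (simp add: words_below_def)
  then show ?thesis by blast
qed

lemma finite_words_below: "finite (words_below d)"
  by (induction d) (simp_all add: words_below_Suc)

lemma prod_words_below_Suc:
  fixes f :: "word \<Rightarrow> real"
  shows "(\<Prod>w\<in>words_below (Suc d). f w) =
    f [] * ((\<Prod>w\<in>words_below d. f (L1 # w)) * (\<Prod>w\<in>words_below d. f (L2 # w)))"
proof -
  have "(\<Prod>w\<in>words_below (Suc d). f w) = f [] * prod f ((#) L1 ` words_below d \<union> (#) L2 ` words_below d)"
    unfolding words_below_Suc by (subst prod.insert) (auto simp: finite_words_below)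
  also have "prod f ((#) L1 ` words_below d \<union> (#) L2 ` words_below d) =
      prod f ((#) L1 ` words_below d) * prod f ((#) L2 ` words_below d)"
    by (intro prod.union_disjoint) (auto simp: finite_words_below)
  finally show ?thesis
    by (simp add: prod.reindex)
qed

text \<open>The joint distribution function of the split ratios under the splitting law on trees
  with m nodes. All words shorter than d are taken at once, because this index set decomposes at the
  root; other finite sets are recovered by thresholds 1.\<close>

definition ratio_cdf :: "real \<Rightarrow> real \<Rightarrow> nat \<Rightarrow> (word \<Rightarrow> real) \<Rightarrow> nat \<Rightarrow> real" where
  "ratio_cdf x y d c m = (\<Sum>\<tau>\<in>sized_trees m.
     tree_prob x y \<tau> * (\<Prod>w\<in>words_below d. if split_ratio w \<tau> \<le> c w then 1 else 0))"

lemma sized_trees_0: "sized_trees 0 = {{}}"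
  by (auto simp: sized_trees_def prefix_closed_def)

lemma sum_sized_trees_Suc:
  "(\<Sum>\<tau>\<in>sized_trees (Suc N). f \<tau>) =
    (\<Sum>a\<le>N. \<Sum>\<tau>1\<in>sized_trees a. \<Sum>\<tau>2\<in>sized_trees (N - a). f (join_trees \<tau>1 \<tau>2))"
proof -
  let ?S = "SIGMA a:{..N}. sized_trees a \<times> sized_trees (N - a)"
  have "bij_betw (\<lambda>(a, \<tau>1, \<tau>2). join_trees \<tau>1 \<tau>2) ?S (sized_trees (Suc N))"
  proof (rule bij_betw_byWitness[where f' =
      "\<lambda>\<tau>. (card (subtree \<tau> [L1]), subtree \<tau> [L1], subtree \<tau> [L2])"])
    show "\<forall>\<tau>\<in>sized_trees (Suc N). (case (card (subtree \<tau> [L1]), subtree \<tau> [L1], subtree \<tau> [L2]) of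
        (a, \<tau>1, \<tau>2) \<Rightarrow> join_trees \<tau>1 \<tau>2) = \<tau>"
      using prefix_closed_Nil by (force simp: sized_trees_def intro!: join_subtrees)
    show "(\<lambda>(a, \<tau>1, \<tau>2). join_trees \<tau>1 \<tau>2) ` ?S \<subseteq> sized_trees (Suc N)"
      by (auto simp: sized_trees_def prefix_closed_join card_join prefix_closed_finite)
    show "(\<lambda>\<tau>. (card (subtree \<tau> [L1]), subtree \<tau> [L1], subtree \<tau> [L2])) ` sized_trees (Suc N) \<subseteq> ?S"
    proof (rule image_subsetI)
      fix \<tau> assume \<tau>: "\<tau> \<in> sized_trees (Suc N)"
      then have "\<tau> \<noteq> {}" by (auto simp: sized_trees_def)
      then have "Suc N = Suc (card (subtree \<tau> [L1]) + card (subtree \<tau> [L2]))"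
        using \<tau> card_eq_subtrees[of \<tau>] by (simp add: sized_trees_def)
      then show "(card (subtree \<tau> [L1]), subtree \<tau> [L1], subtree \<tau> [L2]) \<in> ?S"
        using \<tau> by (auto simp: sized_trees_def prefix_closed_subtree)
    qed
  qed (auto simp: sized_trees_def)
  from sum.reindex_bij_betw[OF this, of f]
  have "(\<Sum>\<tau>\<in>sized_trees (Suc N). f \<tau>) = (\<Sum>(a, p)\<in>?S. case p of (\<tau>1, \<tau>2) \<Rightarrow> f (join_trees \<tau>1 \<tau>2))"
    by (simp add: case_prod_beta)
  also have "\<dots> =
      (\<Sum>a\<le>N. \<Sum>p\<in>sized_trees a \<times> sized_trees (N - a). case p of (\<tau>1, \<tau>2) \<Rightarrow> f (join_trees \<tau>1 \<tau>2))"
    by (rule sum.Sigma[symmetric]) (simp_all add: finite_sized_trees)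
  finally show ?thesis
    by (simp only: sum.cartesian_product)
qed

lemma sum_split_prob_atMost:
  assumes "N \<ge> 1" "K \<le> N"
  shows "(\<Sum>a\<le>K. split_prob x y a (N - a)) =
    (x * (real K * (real K + 1)) + y * (2 * real N * (real K + 1) - real K * (real K + 1))) /
      ((x + y) * (real N * (real N + 1)))"
proof -
  let ?D = "(x + y) * (real N * (real N + 1))"
  have sp: "split_prob x y a (N - a) = (2 * x * real a + 2 * y * (real N - real a)) / ?D" if "a \<le>
      N" for a
  proof -
    have "2 / (x + y) * (x * real a + y * real (N - a)) / (real N * (real N + 1)) =
        (2 * (x * real a + y * real (N - a))) / ?D"
      by (simp only: times_divide_eq_left divide_divide_eq_left)
    then show ?thesis
      using that by (simp only: split_prob_def of_nat_diff le_add_diff_inverse distrib_left mult.assoc)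
  qed
  have "(\<Sum>a\<le>K. split_prob x y a (N - a)) = (\<Sum>a\<le>K. 2 * x * real a + 2 * y * (real N - real a)) / ?D"
    using sp assms(2) by (simp add: sum_divide_distrib)
  also have "(\<Sum>a\<le>K. 2 * x * real a + 2 * y * (real N - real a)) =
      x * (real K * (real K + 1)) + y * (2 * real N * (real K + 1) - real K * (real K + 1))"
    by (induction K) (simp_all add: algebra_simps)
  finally show ?thesis .
qed

lemma sum_split_prob:
  assumes "x + y > 0" "N \<ge> 1"
  shows "(\<Sum>a\<le>N. split_prob x y a (N - a)) = 1"
proof -
  define M where "M = real N * (real N + 1)"
  have "M > 0" using assms(2) by (simp add: M_def)
  moreover have "x * M + y * (2 * real N * (real N + 1) - M) = (x + y) * M"
    by (simp add: M_def algebra_simps)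
  ultimately show ?thesis
    using assms unfolding sum_split_prob_atMost[OF assms(2) order.refl] M_def[symmetric] by simp
qed

text \<open>The splitting law is at most about twice the uniform law, so errors weighted by it are
  controlled by Cesaro means.\<close>

lemma split_prob_le:
  assumes "x > 0" "y > 0" "N \<ge> 1" "a \<le> N"
  shows "split_prob x y a (N - a) \<le> 2 / (real N + 1)"
proof -
  have "x * real a + y * real (N - a) \<le> (x + y) * real N"
    using assms unfolding distrib_right by (intro add_mono mult_left_mono) auto
  then have "2 / (x + y) * (x * real a + y * real (N - a)) \<le> 2 / (x + y) * ((x + y) * real N)"
    using assms by (intro mult_left_mono) auto
  then have "2 / (x + y) * (x * real a + y * real (N - a)) \<le> 2 * real N"
    using assms by simp
  then have "2 / (x + y) * (x * real a + y * real (N - a)) / (real N * (real N + 1)) \<le>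
      2 * real N / (real N * (real N + 1))"
    by (intro divide_right_mono) auto
  then show ?thesis
    using assms by (simp add: split_prob_def)
qed

lemma sum_tree_prob:
  assumes "x > 0" "y > 0"
  shows "(\<Sum>\<tau>\<in>sized_trees m. tree_prob x y \<tau>) = 1"
proof (induction m rule: less_induct)
  case (less m)
  consider "m = 0" | "m = 1" | N where "m = Suc N" "N \<ge> 1"
    by (cases m; cases "m - 1") auto
  then show ?case
  proof cases
    case 1
    then show ?thesis by (simp add: sized_trees_0)
  next
    case 2
    then show ?thesis by (simp add: sum_sized_trees_Suc sized_trees_0)
  next
    case 3
    have "(\<Sum>\<tau>1\<in>sized_trees a. \<Sum>\<tau>2\<in>sized_trees (N - a). tree_prob x y (join_trees \<tau>1 \<tau>2)) =
        split_prob x y a (N - a)"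
      if "a \<le> N" for a
    proof -
      have "(\<Sum>\<tau>1\<in>sized_trees a. \<Sum>\<tau>2\<in>sized_trees (N - a). tree_prob x y (join_trees \<tau>1 \<tau>2)) =
          (\<Sum>\<tau>1\<in>sized_trees a. \<Sum>\<tau>2\<in>sized_trees (N - a). split_prob x y a (N - a) * tree_prob x y \<tau>1 *
              tree_prob x y \<tau>2)"
        using that 3 by (intro sum.cong refl, subst tree_prob_join) (auto simp: sized_trees_def)
      then show ?thesis
        using that 3 less.IH[of a] less.IH[of "N - a"]
        by (simp add: sum_distrib_left[symmetric] sum_distrib_right[symmetric])
    qed
    then show ?thesis
      using 3 assms sum_split_prob[of x y N] by (simp add: sum_sized_trees_Suc)
  qed
qed

lemma ratio_cdf_0: "x > 0 \<Longrightarrow> y > 0 \<Longrightarrow> ratio_cdf x y 0 c m = 1"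
  by (simp add: ratio_cdf_def sum_tree_prob)

lemma ratio_cdf_bounds:
  assumes "x > 0" "y > 0"
  shows "ratio_cdf x y d c m \<in> {0..1}"
proof -
  have "ratio_cdf x y d c m \<le> (\<Sum>\<tau>\<in>sized_trees m. tree_prob x y \<tau>)"
    unfolding ratio_cdf_def
    using tree_prob_nonneg[OF assms] by (intro sum_mono mult_left_le prod_le_1) auto
  moreover have "ratio_cdf x y d c m \<ge> 0"
    unfolding ratio_cdf_def
    using tree_prob_nonneg[OF assms] by (intro sum_nonneg mult_nonneg_nonneg prod_nonneg) auto
  ultimately show ?thesis
    using sum_tree_prob[OF assms] by simp
qed

lemma subtree_join_Cons [simp]:
  "subtree (join_trees \<tau>1 \<tau>2) (L1 # w) = subtree \<tau>1 w" "subtree (join_trees \<tau>1 \<tau>2) (L2 # w) =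
      subtree \<tau>2 w"
  by (simp_all add: subtree_def)

lemma split_ratio_join:
  assumes "finite \<tau>1" "finite \<tau>2"
  shows "split_ratio [] (join_trees \<tau>1 \<tau>2) = real (card \<tau>1) / real (card \<tau>1 + card \<tau>2)"
    "split_ratio (L1 # w) (join_trees \<tau>1 \<tau>2) = split_ratio w \<tau>1"
    "split_ratio (L2 # w) (join_trees \<tau>1 \<tau>2) = split_ratio w \<tau>2"
  using assms
  by (simp_all add: split_ratio_def card_join)

text \<open>Conditioning on the size of the left subtree: \<open>tree_prob_join\<close> makes the
  two subtrees independent with the same kind of law, and the indicator product splits in the same
  way.\<close>

lemma ratio_cdf_Suc:
  assumes "N \<ge> 1"
  shows "ratio_cdf x y (Suc d) c (Suc N) = (\<Sum>a\<le>N. split_prob x y a (N - a) *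
    (if real a / real N \<le> c [] then 1 else 0) *
    (ratio_cdf x y d (\<lambda>w. c (L1 # w)) a * ratio_cdf x y d (\<lambda>w. c (L2 # w)) (N - a)))"
  unfolding ratio_cdf_def[of x y "Suc d"] sum_sized_trees_Suc
proof (intro sum.cong refl)
  fix a assume a: "a \<in> {..N}"
  let ?I = "\<lambda>c \<tau>. \<Prod>w\<in>words_below d. if split_ratio w \<tau> \<le> c w then 1 else 0 :: real"
  have "(\<Sum>\<tau>1\<in>sized_trees a. \<Sum>\<tau>2\<in>sized_trees (N - a). tree_prob x y (join_trees \<tau>1 \<tau>2) *
        (\<Prod>w\<in>words_below (Suc d). if split_ratio w (join_trees \<tau>1 \<tau>2) \<le> c w then 1 else 0)) =
      (\<Sum>\<tau>1\<in>sized_trees a. \<Sum>\<tau>2\<in>sized_trees (N - a).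
        (split_prob x y a (N - a) * (if real a / real N \<le> c [] then 1 else 0)) *
        ((tree_prob x y \<tau>1 * ?I (\<lambda>w. c (L1 # w)) \<tau>1) * (tree_prob x y \<tau>2 * ?I (\<lambda>w. c (L2 # w)) \<tau>2)))"
  proof (intro sum.cong refl)
    fix \<tau>1 \<tau>2 assume *: "\<tau>1 \<in> sized_trees a" "\<tau>2 \<in> sized_trees (N - a)"
    then have fin: "finite \<tau>1" "finite \<tau>2" and card: "card \<tau>1 = a" "card \<tau>2 = N - a"
      and pc: "prefix_closed \<tau>1" "prefix_closed \<tau>2"
      by (auto simp: sized_trees_def prefix_closed_finite)
    moreover have "\<tau>1 \<noteq> {} \<or> \<tau>2 \<noteq> {}"
      using card assms a by auto
    ultimately show "tree_prob x y (join_trees \<tau>1 \<tau>2) *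
        (\<Prod>w\<in>words_below (Suc d). if split_ratio w (join_trees \<tau>1 \<tau>2) \<le> c w then 1 else 0) =
        (split_prob x y a (N - a) * (if real a / real N \<le> c [] then 1 else 0)) *
        ((tree_prob x y \<tau>1 * ?I (\<lambda>w. c (L1 # w)) \<tau>1) * (tree_prob x y \<tau>2 * ?I (\<lambda>w. c (L2 # w)) \<tau>2))"
      using a unfolding prod_words_below_Suc split_ratio_join[OF fin]
      by (simp add: tree_prob_join mult_ac)
  qed
  also have "\<dots> = (split_prob x y a (N - a) * (if real a / real N \<le> c [] then 1 else 0)) *
      (ratio_cdf x y d (\<lambda>w. c (L1 # w)) a * ratio_cdf x y d (\<lambda>w. c (L2 # w)) (N - a))"
    by (simp only: ratio_cdf_def sum_distrib_left[symmetric] sum_distrib_right[symmetric])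
  finally show "(\<Sum>\<tau>1\<in>sized_trees a. \<Sum>\<tau>2\<in>sized_trees (N - a). tree_prob x y (join_trees \<tau>1 \<tau>2) *
      (\<Prod>w\<in>words_below (Suc d). if split_ratio w (join_trees \<tau>1 \<tau>2) \<le> c w then 1 else 0)) = \<dots>" .
qed

text \<open>The integral of \<open>h_density\<close> from 0 to c, with c clamped to [0, 1].\<close>

definition limit_cdf :: "real \<Rightarrow> real \<Rightarrow> real \<Rightarrow> real" where
  "limit_cdf x y c = (let t = max 0 (min 1 c) in (x * t^2 + y * (2 * t - t^2)) / (x + y))"

lemma cesaro_zero:
  fixes u :: "nat \<Rightarrow> real"
  assumes lim: "u \<longlonglongrightarrow> 0" and bd: "\<And>n. \<bar>u n\<bar> \<le> 1"
  shows "(\<lambda>N. (\<Sum>a\<le>N. \<bar>u a\<bar>) / (real N + 1)) \<longlonglongrightarrow> 0"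
proof (rule LIMSEQ_I)
  fix e :: real assume e: "e > 0"
  then obtain M where M: "\<And>a. a \<ge> M \<Longrightarrow> \<bar>u a\<bar> < e / 2"
    using LIMSEQ_D[OF lim, of "e / 2"] by auto
  obtain N0 :: nat where N0: "real N0 > 2 * real M / e"
    using reals_Archimedean2 by blast
  have "norm ((\<Sum>a\<le>N. \<bar>u a\<bar>) / (real N + 1) - 0) < e" if "N \<ge> N0" for N
  proof -
    have "(\<Sum>a\<le>N. \<bar>u a\<bar>) \<le> (\<Sum>a\<le>N. (if a < M then 1 else 0) + e / 2)"
      using bd M e by (intro sum_mono) (auto simp: not_less intro: less_imp_le add_increasing2)
    also have "\<dots> = real (card ({..N} \<inter> {a. a < M})) + (real N + 1) * (e / 2)"
      by (simp add: sum.distrib sum.If_cases)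
    also have "\<dots> \<le> real M + (real N + 1) * (e / 2)"
      using card_mono[of "{..<M}" "{..N} \<inter> {a. a < M}"] by auto
    also have "real M < (real N + 1) * (e / 2)"
    proof -
      have "2 * real M / e < real N + 1"
        using N0 that by linarith
      then show ?thesis
        using e by (simp add: field_simps)
    qed
    finally have "(\<Sum>a\<le>N. \<bar>u a\<bar>) < (real N + 1) * e"
      by (simp add: field_simps)
    then have "(\<Sum>a\<le>N. \<bar>u a\<bar>) / (real N + 1) < e"
      by (subst pos_divide_less_eq) (auto simp: mult_ac)
    moreover have "(\<Sum>a\<le>N. \<bar>u a\<bar>) / (real N + 1) \<ge> 0"
      by (intro divide_nonneg_nonneg sum_nonneg) auto
    ultimately show ?thesis by simp
  qed
  then show "\<exists>N0. \<forall>N\<ge>N0. norm ((\<Sum>a\<le>N. \<bar>u a\<bar>) / (real N + 1) - 0) < e"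
    by blast
qed

lemma floor_fraction_tendsto:
  assumes "t \<ge> 0"
  shows "(\<lambda>N. real (nat \<lfloor>t * real N\<rfloor>) / real N) \<longlonglongrightarrow> t"
proof (rule tendsto_sandwich[of "\<lambda>N. t - inverse (real N)" _ _ "\<lambda>_. t"])
  have fl: "real (nat \<lfloor>t * real N\<rfloor>) \<le> t * real N" "t * real N - 1 \<le> real (nat \<lfloor>t * real N\<rfloor>)" for N
    using assms by (auto simp: of_nat_nat)
  show "\<forall>\<^sub>F N in sequentially. t - inverse (real N) \<le> real (nat \<lfloor>t * real N\<rfloor>) / real N"
    using eventually_gt_at_top[of 0]
  proof eventually_elim
    case (elim N)
    have "t - inverse (real N) = (t * real N - 1) / real N"
      using elim by (simp add: field_simps)
    also have "\<dots> \<le> real (nat \<lfloor>t * real N\<rfloor>) / real N"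
      by (intro divide_right_mono fl) auto
    finally show ?case .
  qed
  show "\<forall>\<^sub>F N in sequentially. real (nat \<lfloor>t * real N\<rfloor>) / real N \<le> t"
    using eventually_gt_at_top[of 0]
    by eventually_elim (use fl(1) in \<open>simp add: pos_divide_le_eq\<close>)
  show "(\<lambda>N. t - inverse (real N)) \<longlonglongrightarrow> t"
    using tendsto_diff[OF tendsto_const lim_inverse_n, of t] by simp
qed simp

text \<open>The condition a / N \<le> c cuts the sum at the floor of t N, with t the clamped
  threshold. The partial sum has a closed form, and dividing numerator and denominator by N^2 leaves
  a limit in k / N.\<close>

lemma split_cdf_tendsto:
  assumes "x > 0" "y > 0"
  shows "(\<lambda>N. \<Sum>a\<le>N. split_prob x y a (N - a) * (if real a / real N \<le> c then 1 else 0)) \<longlonglongrightarrow> limit_cdf x y c"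
proof (cases "c < 0")
  case True
  have "\<not> real a / real N \<le> c" for a N
    using True by (smt (verit) divide_nonneg_nonneg of_nat_0_le_iff)
  then show ?thesis
    using True by (simp add: limit_cdf_def)
next
  case False
  define t where "t = min 1 c"
  have t: "0 \<le> t" "t \<le> 1" "max 0 (min 1 c) = t"
    using False by (auto simp: t_def)
  define K where "K N = nat \<lfloor>t * real N\<rfloor>" for N
  define k where "k N = real (K N) / real N" for N
  have k: "k \<longlonglongrightarrow> t"
    unfolding k_def K_def by (rule floor_fraction_tendsto[OF t(1)])
  let ?F = "\<lambda>N. (x * (k N * (k N + inverse (real N))) + y * (2 * (k N +
      inverse (real N)) - k N * (k N + inverse (real N)))) / ((x + y) * (1 + inverse (real N)))"
  have "?F \<longlonglongrightarrow> (x * (t * (t + 0)) + y * (2 * (t + 0) - t * (t + 0))) / ((x + y) * (1 + 0))"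
    using assms by (intro tendsto_intros k lim_inverse_n) auto
  moreover have "(x * (t * (t + 0)) + y * (2 * (t + 0) - t * (t + 0))) / ((x + y) * (1 + 0)) =
      limit_cdf x y c"
    unfolding limit_cdf_def t(3) Let_def by (simp add: power2_eq_square)
  moreover have "\<forall>\<^sub>F N in sequentially. ?F N =
      (\<Sum>a\<le>N. split_prob x y a (N - a) * (if real a / real N \<le> c then 1 else 0))"
    using eventually_ge_at_top[of 1]
  proof eventually_elim
    case (elim N)
    have "t * real N \<le> real N"
      using t by (simp add: mult_left_le_one_le)
    then have KN: "K N \<le> N"
      unfolding K_def by linarith
    have iff: "real a / real N \<le> c \<longleftrightarrow> a \<le> K N" if "a \<le> N" for a
    proof -
      have "real a / real N \<le> c \<longleftrightarrow> real a / real N \<le> t"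
        using that elim by (auto simp: t_def)
      also have "\<dots> \<longleftrightarrow> real a \<le> t * real N"
        using elim by (simp add: pos_divide_le_eq)
      also have "\<dots> \<longleftrightarrow> a \<le> K N"
        using t by (simp add: K_def le_nat_iff le_floor_iff)
      finally show ?thesis .
    qed
    have "(\<Sum>a\<le>N. split_prob x y a (N - a) * (if real a / real N \<le> c then 1 else 0)) =
        (\<Sum>a\<le>N. if a \<le> K N then split_prob x y a (N - a) else 0)"
      using iff by (intro sum.cong) auto
    also have "\<dots> = (\<Sum>a\<le>K N. split_prob x y a (N - a))"
      using KN by (subst sum.inter_filter[symmetric]) (auto intro!: sum.cong)
    also have "\<dots> = (x * (real (K N) * (real (K N) + 1)) + y * (2 * real N * (real (K N) +
        1) - real (K N) * (real (K N) + 1))) / ((x + y) * (real N * (real N + 1)))"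
      using elim KN by (rule sum_split_prob_atMost)
    also have "\<dots> = ?F N"
    proof -
      define n z where "n = real N" and "z = k N"
      have n: "n > 0" and K: "real (K N) = z * n"
        using elim by (auto simp: n_def z_def k_def)
      have "x * (z * n * (z * n + 1)) + y * (2 * n * (z * n + 1) - z * n * (z * n + 1)) =
          (x * (z * (z + inverse n)) + y * (2 * (z + inverse n) - z * (z + inverse n))) * (n * n)"
        using n by (simp add: algebra_simps)
      moreover have "(x + y) * (n * (n + 1)) = ((x + y) * (1 + inverse n)) * (n * n)"
        using n by (simp add: algebra_simps)
      moreover have "A * (n * n) / (B * (n * n)) = A / B" for A B
        using n by simp
      ultimately show ?thesis
        unfolding K n_def[symmetric] z_def[symmetric] by (simp only:)
    qed
    finally show ?case ..
  qed
  ultimately show ?thesis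
    by (simp add: tendsto_cong)
qed

text \<open>The factors \<open>u a\<close> and \<open>v (N - a)\<close> are far from their limits
  only for a near 0 or near N. By \<open>split_prob_le\<close> the error is at most twice the sum of
  the two Cesaro means of the deviations.\<close>

lemma split_sum_tendsto:
  assumes xy: "x > 0" "y > 0"
    and u: "\<And>n. u n \<in> {0..1}" "u \<longlonglongrightarrow> \<beta>1" and v: "\<And>n. v n \<in> {0..1}" "v \<longlonglongrightarrow> \<beta>2"
  shows "(\<lambda>N. \<Sum>a\<le>N. split_prob x y a (N - a) * (if real a / real N \<le>
      c then 1 else 0) * (u a * v (N - a)))
    \<longlonglongrightarrow> limit_cdf x y c * (\<beta>1 * \<beta>2)"
proof -
  let ?p = "\<lambda>N a. split_prob x y a (N - a) * (if real a / real N \<le> c then 1 else 0)"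
  have \<beta>: "\<beta>1 \<in> {0..1}" "\<beta>2 \<in> {0..1}"
    using u v by (auto intro: LIMSEQ_le_const LIMSEQ_le_const2)
  have bd: "\<bar>u n - \<beta>1\<bar> \<le> 1" "\<bar>v n - \<beta>2\<bar> \<le> 1" for n
    using u(1)[of n] v(1)[of n] \<beta> by (auto simp: abs_le_iff)
  have ces: "(\<lambda>N. (\<Sum>a\<le>N. \<bar>u a - \<beta>1\<bar>) / (real N + 1)) \<longlonglongrightarrow> 0" "(\<lambda>N. (\<Sum>a\<le>N. \<bar>v a - \<beta>2\<bar>) / (real N + 1)) \<longlonglongrightarrow> 0"
    using u(2) v(2) bd by (auto intro!: cesaro_zero simp: LIM_zero)
  have "(\<lambda>N. (\<Sum>a\<le>N. ?p N a * (u a * v (N - a))) - (\<Sum>a\<le>N. ?p N a) * (\<beta>1 * \<beta>2)) \<longlonglongrightarrow> 0"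
  proof (rule Lim_null_comparison)
    show "(\<lambda>N. 2 * ((\<Sum>a\<le>N. \<bar>u a - \<beta>1\<bar>) / (real N + 1)) + 2 * ((\<Sum>a\<le>N. \<bar>v a - \<beta>2\<bar>) / (real N + 1))) \<longlonglongrightarrow> 0"
      using tendsto_add[OF tendsto_mult_left[OF ces(1), of 2] tendsto_mult_left[OF ces(2), of 2]] by simp
    show "\<forall>\<^sub>F N in sequentially. norm ((\<Sum>a\<le>N. ?p N a * (u a * v (N - a))) - (\<Sum>a\<le>N. ?p N a) * (\<beta>1 * \<beta>2))
        \<le> 2 * ((\<Sum>a\<le>N. \<bar>u a - \<beta>1\<bar>) / (real N + 1)) + 2 * ((\<Sum>a\<le>N. \<bar>v a - \<beta>2\<bar>) / (real N + 1))"
      using eventually_ge_at_top[of 1]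
    proof eventually_elim
      case (elim N)
      have "norm ((\<Sum>a\<le>N. ?p N a * (u a * v (N - a))) - (\<Sum>a\<le>N. ?p N a) * (\<beta>1 * \<beta>2)) =
          \<bar>\<Sum>a\<le>N. ?p N a * (u a * v (N - a) - \<beta>1 * \<beta>2)\<bar>"
        by (simp only: real_norm_def right_diff_distrib sum_subtractf sum_distrib_right)
      also have "\<dots> \<le> (\<Sum>a\<le>N. \<bar>?p N a * (u a * v (N - a) - \<beta>1 * \<beta>2)\<bar>)"
        by (rule sum_abs)
      also have "\<dots> \<le> (\<Sum>a\<le>N. 2 / (real N + 1) * (\<bar>u a - \<beta>1\<bar> + \<bar>v (N - a) - \<beta>2\<bar>))"
      proof (intro sum_mono)
        fix a assume "a \<in> {..N}"
        then have "\<bar>?p N a\<bar> \<le> 2 / (real N + 1)"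
          using split_prob_le[OF xy elim, of a] split_prob_nonneg[OF xy, of a "N - a"] by auto
        moreover have "\<bar>u a * v (N - a) - \<beta>1 * \<beta>2\<bar> \<le> \<bar>u a - \<beta>1\<bar> + \<bar>v (N - a) - \<beta>2\<bar>"
        proof -
          have "u a * v (N - a) - \<beta>1 * \<beta>2 = (u a - \<beta>1) * v (N - a) + \<beta>1 * (v (N - a) - \<beta>2)"
            by (simp add: algebra_simps)
          also have "\<bar>\<dots>\<bar> \<le> \<bar>u a - \<beta>1\<bar> * \<bar>v (N - a)\<bar> + \<bar>\<beta>1\<bar> * \<bar>v (N - a) - \<beta>2\<bar>"
            by (metis abs_mult abs_triangle_ineq)
          also have "\<dots> \<le> \<bar>u a - \<beta>1\<bar> * 1 + 1 * \<bar>v (N - a) - \<beta>2\<bar>"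
            using v(1)[of "N - a"] \<beta> by (intro add_mono mult_left_mono mult_right_mono) auto
          finally show ?thesis by simp
        qed
        ultimately show "\<bar>?p N a * (u a * v (N - a) - \<beta>1 * \<beta>2)\<bar> \<le> 2 / (real N + 1) * (\<bar>u a - \<beta>1\<bar> +
            \<bar>v (N - a) - \<beta>2\<bar>)"
          unfolding abs_mult[of "?p N a"] by (intro mult_mono) auto
      qed
      also have "\<dots> = 2 / (real N + 1) * ((\<Sum>a\<le>N. \<bar>u a - \<beta>1\<bar>) + (\<Sum>a\<le>N. \<bar>v (N - a) - \<beta>2\<bar>))"
        by (simp only: sum_distrib_left[symmetric] sum.distrib)
      also have "(\<Sum>a\<le>N. \<bar>v (N - a) - \<beta>2\<bar>) = (\<Sum>a\<le>N. \<bar>v a - \<beta>2\<bar>)"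
        using sum.nat_diff_reindex[of "\<lambda>a. \<bar>v a - \<beta>2\<bar>" "Suc N"] by (simp add: lessThan_Suc_atMost)
      finally show ?case
        by (simp add: distrib_left)
    qed
  qed
  moreover have "(\<lambda>N. (\<Sum>a\<le>N. ?p N a) * (\<beta>1 * \<beta>2)) \<longlonglongrightarrow> limit_cdf x y c * (\<beta>1 * \<beta>2)"
    by (intro tendsto_mult split_cdf_tendsto xy tendsto_const)
  ultimately show ?thesis
    using tendsto_add by fastforce
qed

text \<open>In the limit the root split carries no information on the deeper ones, because both
  subtrees become large; induction on the depth, for all thresholds, gives a product.\<close>

lemma ratio_cdf_tendsto:
  assumes "x > 0" "y > 0"
  shows "(\<lambda>m. ratio_cdf x y d c m) \<longlonglongrightarrow> (\<Prod>w\<in>words_below d. limit_cdf x y (c w))"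
proof (induction d arbitrary: c)
  case 0
  then show ?case by (simp add: ratio_cdf_0[OF assms])
next
  case (Suc d)
  have "(\<lambda>N. \<Sum>a\<le>N. split_prob x y a (N - a) * (if real a / real N \<le> c [] then 1 else 0) *
      (ratio_cdf x y d (\<lambda>w. c (L1 # w)) a * ratio_cdf x y d (\<lambda>w. c (L2 # w)) (N - a)))
      \<longlonglongrightarrow> (\<Prod>w\<in>words_below (Suc d). limit_cdf x y (c w))"
    unfolding prod_words_below_Suc by (intro split_sum_tendsto assms ratio_cdf_bounds Suc.IH)
  moreover have "\<forall>\<^sub>F N in sequentially. (\<Sum>a\<le>N. split_prob x y a (N - a) * (if real a / real N \<le>
      c [] then 1 else 0) *
      (ratio_cdf x y d (\<lambda>w. c (L1 # w)) a * ratio_cdf x y d (\<lambda>w. c (L2 # w)) (N - a))) =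
          ratio_cdf x y (Suc d) c (Suc N)"
    using eventually_ge_at_top[of 1] by eventually_elim (simp only: ratio_cdf_Suc)
  ultimately have "(\<lambda>N. ratio_cdf x y (Suc d) c (Suc N)) \<longlonglongrightarrow> (\<Prod>w\<in>words_below (Suc d). limit_cdf x y (c w))"
    by (simp add: tendsto_cong)
  then show ?case
    by (rule LIMSEQ_imp_Suc)
qed

section \<open>Growth chains\<close>

lemma countable_bin_trees: "countable bin_trees"
  by (rule countable_subset[OF _ countable_Collect_finite]) (auto simp: bin_trees_finite)

text \<open>At each time the chain has almost surely finitely many possible histories, so all
  expectations below are finite sums and conditional expectations are avoided.\<close>

lemma (in prob_space) expectation_finite_range:
  fixes f :: "'c \<Rightarrow> real"
  assumes F: "finite F" and AE: "AE \<omega> in M. X \<omega> \<in> F"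
    and ev: "\<And>a. a \<in> F \<Longrightarrow> {\<omega> \<in> space M. X \<omega> = a} \<in> events"
    and meas: "(\<lambda>\<omega>. f (X \<omega>)) \<in> borel_measurable M"
  shows "integrable M (\<lambda>\<omega>. f (X \<omega>))"
    and "expectation (\<lambda>\<omega>. f (X \<omega>)) = (\<Sum>a\<in>F. f a * prob {\<omega> \<in> space M. X \<omega> = a})"
proof -
  let ?g = "\<lambda>\<omega>. \<Sum>a\<in>F. f a * indicator {\<omega> \<in> space M. X \<omega> = a} \<omega>"
  have eq: "AE \<omega> in M. f (X \<omega>) = ?g \<omega>"
    using AE AE_space
  proof eventually_elim
    case (elim \<omega>)
    then have "?g \<omega> = (\<Sum>a\<in>F. if a = X \<omega> then f a else 0)"
      by (intro sum.cong) (auto split: split_indicator)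
    then show ?case
      using F elim by simp
  qed
  have int: "integrable M (\<lambda>\<omega>. f a * indicator {\<omega> \<in> space M. X \<omega> = a} \<omega>)" if "a \<in> F" for a
    using ev[OF that] by (intro integrable_mult_right) (auto simp: emeasure_eq_measure)
  have g: "?g \<in> borel_measurable M"
    using ev by (intro borel_measurable_sum borel_measurable_times) auto
  show "integrable M (\<lambda>\<omega>. f (X \<omega>))"
    unfolding integrable_cong_AE[OF meas g eq] using int by (rule Bochner_Integration.integrable_sum)
  have "expectation (\<lambda>\<omega>. f (X \<omega>)) = expectation ?g"
    by (rule integral_cong_AE[OF meas g eq])
  also have "\<dots> = (\<Sum>a\<in>F. expectation (\<lambda>\<omega>. f a * indicator {\<omega> \<in> space M. X \<omega> = a} \<omega>))"
    using int by (rule Bochner_Integration.integral_sum)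
  also have "\<dots> = (\<Sum>a\<in>F. f a * prob {\<omega> \<in> space M. X \<omega> = a})"
    using ev by (intro sum.cong refl) (simp add: Int_absorb2)
  finally show "expectation (\<lambda>\<omega>. f (X \<omega>)) = \<dots>" .
qed

text \<open>The normalised first-child weights add up to 2, so every leaf weighs as much as two
  slots of weight 1.\<close>

lemma sum_step_prob:
  assumes "x > 0" "y > 0" "\<tau> \<in> bin_trees"
  shows "(\<Sum>v\<in>slots \<tau>. slot_weight (2 * x / (x + y)) (2 * y / (x + y)) \<tau> v) = real (card \<tau>) + 1"
    and "(\<Sum>v\<in>slots \<tau>. step_prob x y \<tau> v) = 1"
proof -
  have "2 * x / (x + y) + 2 * y / (x + y) = 2"
    using assms by (simp add: add_divide_distrib[symmetric]) (simp add: divide_eq_eq algebra_simps)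
  then show 1: "(\<Sum>v\<in>slots \<tau>. slot_weight (2 * x / (x + y)) (2 * y / (x + y)) \<tau> v) = real (card \<tau>) + 1"
    using sum_slots[OF assms(3), of "2 * x / (x + y)" "2 * y / (x + y)"
        "\<lambda>_. 1"] card_leaves_le[OF assms(3)]
    by (simp add: of_nat_diff)
  show "(\<Sum>v\<in>slots \<tau>. step_prob x y \<tau> v) = 1"
    unfolding step_prob_def sum_divide_distrib[symmetric] 1 by (simp add: add_eq_0_iff_both_eq_0)
qed

text \<open>\<open>T_step\<close> is the Markov property with the conditional probability multiplied
  out, which keeps histories of probability zero from being an exception.\<close>

locale growth_chain = prob_space M for M :: "'a measure" +
  fixes x y :: real and T :: "nat \<Rightarrow> 'a \<Rightarrow> tree"
  assumes x_pos: "x > 0" and y_pos: "y > 0"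
    and T_measurable [measurable]: "\<And>n. T n \<in> M \<rightarrow>\<^sub>M count_space bin_trees"
    and T_0: "AE \<omega> in M. T 0 \<omega> = root_tree"
    and T_step: "\<And>n s t. t \<in> bin_trees \<Longrightarrow>
      prob {\<omega> \<in> space M. (\<forall>k\<le>n. T k \<omega> = s k) \<and> T (Suc n) \<omega> = t} =
      prob {\<omega> \<in> space M. \<forall>k\<le>n. T k \<omega> =
          s k} * trans_prob x y (restrict (growth_harm x y) bin_trees) (s n) t"
begin

text \<open>The full past is recorded, not just the present tree: the second-moment estimate
  compares the next tree with one at an earlier time.\<close>

definition hist :: "nat \<Rightarrow> 'a \<Rightarrow> nat \<Rightarrow> tree" where
  "hist n \<omega> = restrict (\<lambda>k. T k \<omega>) {..n}"

definition hists :: "nat \<Rightarrow> (nat \<Rightarrow> tree) set" where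
  "hists n = PiE {..n} level"

lemma T_bin_tree: "\<omega> \<in> space M \<Longrightarrow> T n \<omega> \<in> bin_trees"
  using measurable_space[OF T_measurable] by simp

lemma sets_T [measurable]: "{\<omega> \<in> space M. P (T n \<omega>)} \<in> events"
proof -
  have "{\<omega> \<in> space M. P (T n \<omega>)} = T n -` {\<tau> \<in> bin_trees. P \<tau>} \<inter> space M"
    using T_bin_tree by auto
  then show ?thesis
    using measurable_sets[OF T_measurable, of "{\<tau> \<in> bin_trees. P \<tau>}"] by simp
qed

lemma finite_hists: "finite (hists n)"
  unfolding hists_def by (intro finite_PiE finite_level) auto

lemma hist_measurable: "hist n \<in> M \<rightarrow>\<^sub>M count_space (PiE {..n} (\<lambda>_. bin_trees))"
proof (subst measurable_count_space_eq_countable)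
  show "countable (PiE {..n} (\<lambda>_. bin_trees))"
    by (intro countable_PiE countable_bin_trees) auto
  show "hist n \<in> space M \<rightarrow> PiE {..n} (\<lambda>_. bin_trees) \<and>
      (\<forall>a\<in>PiE {..n} (\<lambda>_. bin_trees). hist n -` {a} \<inter> space M \<in> events)"
  proof (intro conjI ballI)
    fix a assume "a \<in> PiE {..n} (\<lambda>_. bin_trees)"
    then have "hist n -` {a} \<inter> space M = {\<omega> \<in> space M. \<forall>k\<in>{..n}. T k \<omega> = a k}"
      by (auto simp: hist_def fun_eq_iff PiE_iff extensional_def)
    moreover have "\<dots> \<in> events"
      by (intro sets.sets_Collect_finite_All' sets_T) auto
    ultimately show "hist n -` {a} \<inter> space M \<in> events" by simp
  qed (auto simp: hist_def T_bin_tree)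
qed

lemma measurable_of_hist:
  fixes f :: "(nat \<Rightarrow> tree) \<Rightarrow> real"
  shows "(\<lambda>\<omega>. f (hist n \<omega>)) \<in> borel_measurable M"
  by (rule measurable_compose[OF hist_measurable]) simp

lemma hist_eq_iff: "h \<in> hists n \<Longrightarrow> hist n \<omega> = h \<longleftrightarrow> (\<forall>k\<le>n. T k \<omega> = h k)"
  by (auto simp: hist_def hists_def fun_eq_iff PiE_iff extensional_def)

lemma sets_hist: "{\<omega> \<in> space M. hist n \<omega> = h \<and> T m \<omega> = t} \<in> events" "{\<omega> \<in> space M. hist n \<omega> =
    h} \<in> events"
proof -
  have "(\<lambda>\<omega>. if hist n \<omega> = h then 1 else 0 :: real) -` {1} \<inter> space M \<in> events"
    using measurable_of_hist[of "\<lambda>h'. if h' = h then 1 else 0"] by (rule measurable_sets) simp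
  moreover have "(\<lambda>\<omega>. if hist n \<omega> = h then 1 else 0 :: real) -` {1} \<inter> space M =
      {\<omega> \<in> space M. hist n \<omega> = h}"
    by (auto split: if_splits)
  ultimately show *: "{\<omega> \<in> space M. hist n \<omega> = h} \<in> events"
    by simp
  show "{\<omega> \<in> space M. hist n \<omega> = h \<and> T m \<omega> = t} \<in> events"
    using sets.sets_Collect_conj[OF sets_T[of "\<lambda>\<tau>. \<tau> = t" m] *] by simp
qed

lemma prob_hist_step:
  assumes "h \<in> hists n" "t \<in> bin_trees"
  shows "prob {\<omega> \<in> space M. hist n \<omega> = h \<and> T (Suc n) \<omega> = t} =
    prob {\<omega> \<in> space M. hist n \<omega> = h} * trans_prob x y (restrict (growth_harm x y) bin_trees) (h n) t"
  using T_step[OF assms(2), of n h] by (simp add: hist_eq_iff[OF assms(1)])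

lemma level_bin_trees: "\<tau> \<in> level n \<Longrightarrow> \<tau> \<in> bin_trees"
  by (simp add: level_def)

lemma hists_last: "h \<in> hists n \<Longrightarrow> h n \<in> level n"
  by (auto simp: hists_def PiE_iff)

lemma sum_trans_prob:
  fixes f :: "tree \<Rightarrow> real"
  assumes "\<tau> \<in> level n"
  shows "(\<Sum>t\<in>level (Suc n). trans_prob x y (restrict (growth_harm x y) bin_trees) \<tau> t * f t) =
    (\<Sum>v\<in>slots \<tau>. step_prob x y \<tau> v * f (insert v \<tau>))"
proof -
  have \<tau>: "\<tau> \<in> bin_trees" using assms by (rule level_bin_trees)
  have "{\<sigma>. edge \<tau> \<sigma>} \<subseteq> level (Suc n)"
    using edge_bin_tree edge_card assms by (auto simp: level_def)
  then have "(\<Sum>t\<in>level (Suc n). trans_prob x y (restrict (growth_harm x y) bin_trees) \<tau> t * f t) =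
      (\<Sum>t | edge \<tau> t. trans_prob x y (restrict (growth_harm x y) bin_trees) \<tau> t * f t)"
    using trans_prob_nonzero_iff[OF x_pos y_pos \<tau>] by (intro sum.mono_neutral_right finite_level) auto
  then show ?thesis
    by (simp add: sum_edges[OF \<tau>] trans_prob_insert[OF x_pos y_pos \<tau>])
qed

text \<open>The transition probabilities along the edges out of \<open>h n\<close> already sum to 1,
  so the disjoint events for all histories and edges have total probability 1. The assumption is
  supplied, time by time, in \<open>AE_hists\<close>.\<close>

lemma AE_edge_of_hists:
  assumes "AE \<omega> in M. hist n \<omega> \<in> hists n"
  shows "AE \<omega> in M. edge (T n \<omega>) (T (Suc n) \<omega>)"
proof -
  let ?A = "SIGMA h:hists n. {t. edge (h n) t}"
  let ?E = "\<lambda>(h, t). {\<omega> \<in> space M. hist n \<omega> = h \<and> T (Suc n) \<omega> = t}"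
  have "(1 :: real) = expectation (\<lambda>\<omega>. (\<lambda>_. 1) (hist n \<omega>))"
    by (simp add: prob_space)
  also have "\<dots> = (\<Sum>h\<in>hists n. prob {\<omega> \<in> space M. hist n \<omega> = h})"
    by (subst expectation_finite_range(2)[OF finite_hists assms sets_hist(2)]) auto
  also have "\<dots> = (\<Sum>h\<in>hists n. \<Sum>t | edge (h n) t. prob {\<omega> \<in> space M. hist n \<omega> = h \<and> T (Suc n) \<omega> = t})"
  proof (intro sum.cong refl)
    fix h assume h: "h \<in> hists n"
    have hn: "h n \<in> bin_trees"
      using hists_last[OF h] by (rule level_bin_trees)
    have "(\<Sum>t | edge (h n) t. prob {\<omega> \<in> space M. hist n \<omega> = h \<and> T (Suc n) \<omega> = t}) =
        (\<Sum>v\<in>slots (h n). prob {\<omega> \<in> space M. hist n \<omega> = h} * step_prob x y (h n) v)"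
      unfolding sum_edges[OF hn]
      by (intro sum.cong refl) (simp add: prob_hist_step[OF h] insert_slot_bin_tree[OF hn]
          trans_prob_insert[OF x_pos y_pos hn])
    also have "\<dots> = prob {\<omega> \<in> space M. hist n \<omega> = h}"
      using sum_step_prob(2)[OF x_pos y_pos hn] by (simp add: sum_distrib_left[symmetric])
    finally show "prob {\<omega> \<in> space M. hist n \<omega> = h} =
        (\<Sum>t | edge (h n) t. prob {\<omega> \<in> space M. hist n \<omega> = h \<and> T (Suc n) \<omega> = t})" ..
  qed
  also have "\<dots> = (\<Sum>p\<in>?A. prob (?E p))"
    by (subst sum.Sigma) (auto simp: finite_hists finite_edges split_beta)
  also have "\<dots> = prob (\<Union>p\<in>?A. ?E p)"
    by (intro finite_measure_finite_Union[symmetric] finite_SigmaI finite_hists finite_edges)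
      (auto simp: sets_hist disjoint_family_on_def)
  finally have "prob (\<Union>p\<in>?A. ?E p) = 1" ..
  moreover have "(\<Union>p\<in>?A. ?E p) \<in> events"
    by (intro sets.finite_UN finite_SigmaI finite_hists finite_edges) (auto simp: sets_hist)
  ultimately have "AE \<omega> in M. \<omega> \<in> (\<Union>p\<in>?A. ?E p)"
    by (simp only: AE_in_set_eq_1)
  then show ?thesis
    by eventually_elim (auto simp: hist_def)
qed

lemma AE_hists: "AE \<omega> in M. hist n \<omega> \<in> hists n"
proof (induction n)
  case 0
  have "root_tree \<in> level 0"
    using root_tree_bin_tree by (simp add: level_def) (simp add: root_tree_def)
  then show ?case
    using T_0 by (auto simp: hist_def hists_def)
next
  case (Suc n)
  from Suc AE_edge_of_hists[OF Suc] show ?case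
  proof eventually_elim
    case (elim \<omega>)
    then have "T k \<omega> \<in> level k" if "k \<le> n" for k
      using that by (auto simp: hist_def hists_def PiE_iff)
    moreover from this have "T (Suc n) \<omega> \<in> level (Suc n)"
      using elim edge_bin_tree edge_card by (auto simp: level_def)
    ultimately show ?case
      by (auto simp: hist_def hists_def PiE_iff le_Suc_eq extensional_def)
  qed
qed

lemma AE_path: "AE \<omega> in M. \<forall>n. T n \<omega> \<in> level n \<and> edge (T n \<omega>) (T (Suc n) \<omega>)"
  unfolding AE_all_countable
proof
  fix n
  from AE_hists[of n] AE_edge_of_hists[OF AE_hists[of n]]
  show "AE \<omega> in M. T n \<omega> \<in> level n \<and> edge (T n \<omega>) (T (Suc n) \<omega>)"
    by eventually_elim (auto simp: hist_def hists_def PiE_iff)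
qed

lemma integrable_hist:
  fixes f :: "(nat \<Rightarrow> tree) \<Rightarrow> real"
  shows "integrable M (\<lambda>\<omega>. f (hist n \<omega>))"
  by (rule expectation_finite_range(1)[OF finite_hists AE_hists sets_hist(2) measurable_of_hist])

text \<open>The Markov property in integrated form: the next tree may be averaged out given the
  past.\<close>

lemma expectation_step:
  fixes g :: "(nat \<Rightarrow> tree) \<Rightarrow> tree \<Rightarrow> real"
  shows "expectation (\<lambda>\<omega>. g (hist n \<omega>) (T (Suc n) \<omega>)) =
    expectation (\<lambda>\<omega>. \<Sum>v\<in>slots (T n \<omega>). step_prob x y (T n \<omega>) v * g (hist n \<omega>) (insert v (T n \<omega>)))"
proof -
  let ?P = "trans_prob x y (restrict (growth_harm x y) bin_trees)"
  let ?X = "\<lambda>\<omega>. (hist n \<omega>, T (Suc n) \<omega>)"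
  have AE: "AE \<omega> in M. ?X \<omega> \<in> hists n \<times> level (Suc n)"
    using AE_hists[of n] AE_path by eventually_elim auto
  have "(\<lambda>\<omega>. (\<lambda>(h, t). g h t) (?X \<omega>)) = (\<lambda>\<omega>. (\<lambda>h. g (restrict h {..n}) (h (Suc n))) (hist (Suc n) \<omega>))"
    by (auto simp: hist_def fun_eq_iff intro!: arg_cong2[where f = g])
  then have meas: "(\<lambda>\<omega>. (\<lambda>(h, t). g h t) (?X \<omega>)) \<in> borel_measurable M"
    using measurable_of_hist by simp
  have "expectation (\<lambda>\<omega>. (\<lambda>(h, t). g h t) (?X \<omega>)) =
      (\<Sum>p\<in>hists n \<times> level (Suc n). (\<lambda>(h, t). g h t) p * prob {\<omega> \<in> space M. ?X \<omega> = p})"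
    by (intro expectation_finite_range(2) AE meas finite_cartesian_product finite_hists finite_level)
      (auto simp: sets_hist)
  also have "\<dots> = (\<Sum>h\<in>hists n. \<Sum>t\<in>level (Suc n). g h t * prob {\<omega> \<in> space M. hist n \<omega> = h \<and>
      T (Suc n) \<omega> = t})"
    by (simp add: sum.cartesian_product split_beta prod_eq_iff)
  also have "\<dots> = (\<Sum>h\<in>hists n. prob {\<omega> \<in> space M. hist n \<omega> = h} * (\<Sum>t\<in>level (Suc n). ?P (h n) t * g h t))"
    unfolding sum_distrib_left
    by (intro sum.cong refl) (simp add: prob_hist_step level_bin_trees mult_ac)
  also have "\<dots> =
      (\<Sum>h\<in>hists n. (\<Sum>v\<in>slots (h n). step_prob x y (h n) v * g h (insert v (h n))) * prob {\<omega> \<in> space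
          M. hist n \<omega> = h})"
    by (intro sum.cong refl) (simp add: sum_trans_prob[OF hists_last])
  also have "\<dots> =
      expectation (\<lambda>\<omega>. (\<lambda>h. \<Sum>v\<in>slots (h n). step_prob x y (h n) v * g h (insert v (h n))) (hist n \<omega>))"
    by (rule expectation_finite_range(2)[OF finite_hists AE_hists sets_hist(2) measurable_of_hist,
        symmetric])
  finally show ?thesis
    by (simp add: hist_def)
qed

lemma expectation_T_sum:
  fixes f :: "tree \<Rightarrow> real"
  shows "integrable M (\<lambda>\<omega>. f (T n \<omega>))"
    and "expectation (\<lambda>\<omega>. f (T n \<omega>)) = (\<Sum>\<tau>\<in>level n. f \<tau> * prob {\<omega> \<in> space M. T n \<omega> = \<tau>})"
proof -
  have AE: "AE \<omega> in M. T n \<omega> \<in> level n"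
    using AE_path by eventually_elim auto
  have meas: "(\<lambda>\<omega>. f (T n \<omega>)) \<in> borel_measurable M"
    by (rule measurable_compose[OF T_measurable]) simp
  show "integrable M (\<lambda>\<omega>. f (T n \<omega>))"
    and "expectation (\<lambda>\<omega>. f (T n \<omega>)) = (\<Sum>\<tau>\<in>level n. f \<tau> * prob {\<omega> \<in> space M. T n \<omega> = \<tau>})"
    by (rule expectation_finite_range[OF finite_level AE sets_T meas])+
qed

text \<open>The node added last is a leaf, and conversely any leaf may have been the last one. Since
  the tree has at least two nodes, such a leaf is never the root.\<close>

lemma predecessors_eq:
  assumes "\<sigma> \<in> level (Suc n)"
  shows "(SIGMA \<tau>:level n. {v \<in> slots \<tau>. insert v \<tau> = \<sigma>}) = (\<lambda>v. (\<sigma> - {v}, v)) ` leaves \<sigma>"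
proof (intro equalityI subsetI)
  fix p assume "p \<in> (SIGMA \<tau>:level n. {v \<in> slots \<tau>. insert v \<tau> = \<sigma>})"
  then obtain \<tau> v where p: "p = (\<tau>, v)" and \<tau>: "\<tau> \<in> bin_trees" and v: "v \<in> slots \<tau>" and \<sigma>: "\<sigma> =
      insert v \<tau>"
    by (auto simp: level_def)
  have "v \<notin> \<tau>" using v by (simp add: slots_def)
  moreover have "v @ [j] \<notin> \<tau>" for j
    using \<tau> prefix_closedD[of \<tau> v "[j]"] \<open>v \<notin> \<tau>\<close> by (auto simp: bin_trees_iff)
  ultimately show "p \<in> (\<lambda>v. (\<sigma> - {v}, v)) ` leaves \<sigma>"
    unfolding p \<sigma> by (intro image_eqI[of _ _ v]) (auto simp: leaves_def internal_def)
next
  fix p assume "p \<in> (\<lambda>v. (\<sigma> - {v}, v)) ` leaves \<sigma>"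
  then obtain v where p: "p = (\<sigma> - {v}, v)" and v: "v \<in> leaves \<sigma>" by auto
  have pc: "prefix_closed \<sigma>" and card: "card \<sigma> = Suc (Suc n)"
    using assms by (auto simp: level_def bin_trees_iff)
  have pc': "prefix_closed (\<sigma> - {v})"
    by (rule prefix_closed_remove_leaf[OF pc v])
  have v\<sigma>: "v \<in> \<sigma>" using v by (simp add: leaves_def)
  have card': "card (\<sigma> - {v}) = Suc n"
    using v\<sigma> card prefix_closed_finite[OF pc] by simp
  then have ne: "\<sigma> - {v} \<noteq> {}" by (metis card.empty nat.distinct(1))
  have "v \<noteq> []"
    using prefix_closed_Nil[OF pc' ne] by auto
  then have "v = butlast v @ [last v]" by simp
  moreover from this have "butlast v \<in> \<sigma> - {v}"
    using prefix_closedD[OF pc, of "butlast v" "[last v]"] v\<sigma>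
        by (metis Diff_iff append_self_conv list.distinct(1) singletonD)
  ultimately have "v \<in> slots (\<sigma> - {v})"
    unfolding slots_def by blast
  then show "p \<in> (SIGMA \<tau>:level n. {v \<in> slots \<tau>. insert v \<tau> = \<sigma>})"
    using pc' ne card' v\<sigma> unfolding p by (auto simp: level_def bin_trees_iff insert_absorb)
qed

text \<open>The forward equation sums over the leaf added last, and \<open>sum_remove_leaf\<close>
  says that \<open>tree_prob\<close> solves it.\<close>

lemma T_law:
  assumes "\<sigma> \<in> level n"
  shows "prob {\<omega> \<in> space M. T n \<omega> = \<sigma>} = tree_prob x y \<sigma>"
  using assms
proof (induction n arbitrary: \<sigma>)
  case 0
  then have \<sigma>: "\<sigma> = root_tree"
    using prefix_closed_Nil[of \<sigma>] by (auto
        simp: level_def bin_trees_iff root_tree_def card_1_singleton_iff)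
  have "AE \<omega> in M. \<omega> \<in> {\<omega> \<in> space M. T 0 \<omega> = \<sigma>}"
    using T_0 AE_space by eventually_elim (simp add: \<sigma>)
  then have "prob {\<omega> \<in> space M. T 0 \<omega> = \<sigma>} = 1"
    by (subst AE_in_set_eq_1[symmetric]) (auto simp: sets_T)
  then show ?case
    by (simp add: \<sigma> tree_prob_def root_leaves)
next
  case (Suc n)
  let ?I = "\<lambda>\<tau>. if \<tau> = \<sigma> then 1 else 0 :: real"
  let ?sw = "slot_weight (2 * x / (x + y)) (2 * y / (x + y))"
  have \<sigma>: "prefix_closed \<sigma>" "card \<sigma> = Suc (Suc n)"
    using Suc.prems by (auto simp: level_def bin_trees_iff)
  have "prob {\<omega> \<in> space M. T (Suc n) \<omega> = \<sigma>} = expectation (\<lambda>\<omega>. ?I (T (Suc n) \<omega>))"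
    unfolding expectation_T_sum(2)[of ?I]
    using Suc.prems by (simp add: if_distrib[of "\<lambda>a. a * _"] finite_level cong: if_cong)
  also have "\<dots> = expectation (\<lambda>\<omega>. (\<lambda>\<tau>. \<Sum>v\<in>slots \<tau>. step_prob x y \<tau> v * ?I (insert v \<tau>)) (T n \<omega>))"
    by (rule expectation_step[of "\<lambda>_. ?I"])
  also have "\<dots> =
      (\<Sum>\<tau>\<in>level n. (\<Sum>v\<in>slots \<tau>. step_prob x y \<tau> v * ?I (insert v \<tau>)) * prob {\<omega> \<in> space M. T n \<omega> = \<tau>})"
    by (rule expectation_T_sum(2))
  also have "\<dots> = (\<Sum>\<tau>\<in>level n. \<Sum>v\<in>{v \<in> slots \<tau>. insert v \<tau> = \<sigma>}. step_prob x y \<tau> v * tree_prob x y \<tau>)"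
  proof (intro sum.cong refl)
    fix \<tau> assume \<tau>: "\<tau> \<in> level n"
    have "(\<Sum>v\<in>slots \<tau>. step_prob x y \<tau> v * ?I (insert v \<tau>)) = (\<Sum>v\<in>{v \<in> slots \<tau>. insert v \<tau> =
        \<sigma>}. step_prob x y \<tau> v)"
      using finite_slots[OF level_bin_trees[OF \<tau>]] by (subst sum.inter_filter) (auto intro!: sum.cong)
    then show "(\<Sum>v\<in>slots \<tau>. step_prob x y \<tau> v * ?I (insert v \<tau>)) * prob {\<omega> \<in> space M. T n \<omega> = \<tau>} =
        (\<Sum>v\<in>{v \<in> slots \<tau>. insert v \<tau> = \<sigma>}. step_prob x y \<tau> v * tree_prob x y \<tau>)"
      by (simp add: Suc.IH[OF \<tau>] sum_distrib_right)
  qed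
  also have "\<dots> = (\<Sum>(\<tau>, v)\<in>(SIGMA \<tau>:level n. {v \<in> slots \<tau>. insert v \<tau> =
      \<sigma>}). step_prob x y \<tau> v * tree_prob x y \<tau>)"
    by (intro sum.Sigma finite_level ballI) (simp add: finite_slots level_bin_trees)
  also have "\<dots> = (\<Sum>v\<in>leaves \<sigma>. step_prob x y (\<sigma> - {v}) v * tree_prob x y (\<sigma> - {v}))"
    unfolding predecessors_eq[OF Suc.prems] by (subst sum.reindex) (auto simp: inj_on_def)
  also have "\<dots> = (\<Sum>v\<in>leaves \<sigma>. tree_prob x y (\<sigma> - {v}) * ?sw (\<sigma> - {v}) v) / real (card \<sigma>)"
    unfolding sum_divide_distrib
  proof (intro sum.cong refl)
    fix v assume "v \<in> leaves \<sigma>"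
    then have "real (card (\<sigma> - {v})) + 1 = real (card \<sigma>)"
      using \<sigma> prefix_closed_finite[OF \<sigma>(1)] by (simp add: leaves_def)
    then show "step_prob x y (\<sigma> - {v}) v * tree_prob x y (\<sigma> - {v}) =
        tree_prob x y (\<sigma> - {v}) * ?sw (\<sigma> - {v}) v / real (card \<sigma>)"
      by (simp only: step_prob_def times_divide_eq_right mult.commute)
  qed
  also have "\<dots> = tree_prob x y \<sigma>"
    unfolding sum_remove_leaf[OF x_pos y_pos \<sigma>(1)] using \<sigma>(2) by simp
  finally show ?case .
qed

lemma prob_split_ratio_words:
  "prob {\<omega> \<in> space M. \<forall>w\<in>words_below d. split_ratio w (T n \<omega>) \<le> c w} = ratio_cdf x y d c (Suc n)"
proof -
  let ?f = "\<lambda>\<tau>. \<Prod>w\<in>words_below d. if split_ratio w \<tau> \<le> c w then 1 else 0 :: real"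
  have "?f \<tau> = (if \<forall>w\<in>words_below d. split_ratio w \<tau> \<le> c w then 1 else 0)" for \<tau>
    by (cases "\<forall>w\<in>words_below d. split_ratio w \<tau> \<le> c w") (auto simp: prod_zero_iff finite_words_below)
  then have "expectation (\<lambda>\<omega>. ?f (T n \<omega>)) =
      expectation (\<lambda>\<omega>. indicator {\<omega> \<in> space M. \<forall>w\<in>words_below d. split_ratio w (T n \<omega>) \<le> c w} \<omega>)"
    by (intro Bochner_Integration.integral_cong refl) (simp split: split_indicator)
  also have "\<dots> = prob {\<omega> \<in> space M. \<forall>w\<in>words_below d. split_ratio w (T n \<omega>) \<le> c w}"
    using sets_T[of "\<lambda>\<tau>. \<forall>w\<in>words_below d. split_ratio w \<tau> \<le> c w" n] by (simp add: Int_absorb2)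
  finally have "prob {\<omega> \<in> space M. \<forall>w\<in>words_below d. split_ratio w (T n \<omega>) \<le> c w} =
      expectation (\<lambda>\<omega>. ?f (T n \<omega>))" ..
  also have "\<dots> = (\<Sum>\<tau>\<in>level n. ?f \<tau> * prob {\<omega> \<in> space M. T n \<omega> = \<tau>})"
    by (rule expectation_T_sum(2))
  also have "\<dots> = ratio_cdf x y d c (Suc n)"
    unfolding ratio_cdf_def level_eq_sized_trees[symmetric]
    by (intro sum.cong refl) (simp add: T_law mult.commute)
  finally show ?thesis .
qed

end

section \<open>Almost sure convergence of the subtree proportions\<close>

text \<open>For \<open>i\<close> in the tree this is exactly the probability that the next node
  falls below \<open>i\<close>: both counts are increased by one because a tree with k nodes has
  slots of total normalised weight k + 1.\<close>

definition node_mass :: "word \<Rightarrow> tree \<Rightarrow> real" where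
  "node_mass i \<tau> = (real (card (subtree \<tau> i)) + 1) / (real (card \<tau>) + 1)"

lemma card_subtree_insert:
  assumes "\<tau> \<in> bin_trees" "v \<in> slots \<tau>"
  shows "card (subtree (insert v \<tau>) i) = card (subtree \<tau> i) + (if prefix i v then 1 else 0)"
proof -
  have "subtree (insert v \<tau>) i =
      (if prefix i v then insert (drop (length i) v) (subtree \<tau> i) else subtree \<tau> i)"
    by (auto simp: subtree_def prefix_def)
  moreover have "drop (length i) v \<notin> subtree \<tau> i" if "prefix i v"
  proof -
    have "i @ drop (length i) v = v"
      using that by (auto simp: prefix_def)
    then show ?thesis
      using assms(2) by (simp add: subtree_def slots_def)
  qed
  moreover have "finite (subtree \<tau> i)"
    using assms(1) by (simp add: bin_trees_iff prefix_closed_finite prefix_closed_subtree)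
  ultimately show ?thesis by simp
qed

lemma node_mass_bounds:
  assumes "\<tau> \<in> bin_trees"
  shows "node_mass i \<tau> \<in> {0..1}"
  using card_subtree_le[of \<tau> i] assms by (simp add: node_mass_def bin_trees_iff)

lemma node_mass_diff:
  fixes \<tau> :: tree and i :: word
  assumes "\<tau> \<in> bin_trees" "v \<in> slots \<tau>"
  defines "k \<equiv> real (card \<tau>)" and "m \<equiv> real (card (subtree \<tau> i))"
  shows "node_mass i (insert v \<tau>) - node_mass i \<tau> =
    ((if prefix i v then k + 1 else 0) - (m + 1)) / ((k + 1) * (k + 2))"
proof -
  have k: "k \<ge> 0" by (simp add: k_def)
  have eq: "node_mass i (insert v \<tau>) = (m + (if prefix i v then 1 else 0) + 1) / (k + 2)"
    by (simp add: node_mass_def card_subtree_insert[OF assms(1,2)] card_insert_slot[OF assms(1,2)]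
        k_def m_def add_ac)
  show ?thesis
    using k unfolding eq unfolding node_mass_def k_def[symmetric] m_def[symmetric]
    by (simp add: divide_simps split del: if_split) (simp add: algebra_simps)
qed

lemma node_mass_diff_le:
  assumes "\<tau> \<in> bin_trees" "v \<in> slots \<tau>"
  shows "\<bar>node_mass i (insert v \<tau>) - node_mass i \<tau>\<bar> \<le> 1 / real (card \<tau>)"
proof -
  define k m where "k = real (card \<tau>)" and "m = real (card (subtree \<tau> i))"
  have k: "k \<ge> 1" and m: "0 \<le> m" "m \<le> k"
    using bin_trees_card_pos[OF assms(1)] card_subtree_le[of \<tau> i] assms(1) by (auto
        simp: k_def m_def bin_trees_iff)
  have "\<bar>(if prefix i v then k + 1 else 0) - (m + 1)\<bar> \<le> k + 1"
    using m by auto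
  then have "\<bar>node_mass i (insert v \<tau>) - node_mass i \<tau>\<bar> \<le> (k + 1) / ((k + 1) * (k + 2))"
    unfolding node_mass_diff[OF assms] k_def[symmetric] m_def[symmetric] abs_divide
    using k by (intro divide_mono) (auto simp: abs_mult)
  also have "\<dots> = 1 / (k + 2)"
    using k by simp
  also have "\<dots> \<le> 1 / k"
    using k by (intro divide_left_mono) auto
  finally show ?thesis by (simp add: k_def)
qed

lemma slot_weight_subtree:
  assumes "v \<noteq> []"
  shows "slot_weight a b \<tau> (i @ v) = slot_weight a b (subtree \<tau> i) v"
proof -
  have "butlast (i @ v) = i @ butlast v" "last (i @ v) = last v"
    using assms by (simp_all add: butlast_append)
  moreover have "i @ u \<in> leaves \<tau> \<longleftrightarrow> u \<in> leaves (subtree \<tau> i)" for u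
    by (auto simp: leaves_def internal_def subtree_def)
  ultimately show ?thesis by (simp add: slot_weight_def)
qed

text \<open>The slots below a node compete for the next vertex with a weight that depends only on the size of
  the subtree; this is what makes the mass of a node an approximate martingale.\<close>

lemma sum_slot_weight_below:
  fixes \<tau> :: tree and i :: word
  assumes "x > 0" "y > 0" "\<tau> \<in> bin_trees"
  defines "S \<equiv> \<Sum>v\<in>{v \<in> slots \<tau>. prefix i v}. slot_weight (2 * x / (x + y)) (2 * y / (x + y)) \<tau> v"
  shows "\<bar>S - (real (card (subtree \<tau> i)) + 1)\<bar> \<le> 1"
proof (cases "i \<in> \<tau>")
  case True
  have pc: "prefix_closed (subtree \<tau> i)"
    using assms(3) by (simp add: bin_trees_iff prefix_closed_subtree)
  moreover have "[] \<in> subtree \<tau> i"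
    using True by (simp add: subtree_def)
  ultimately have bt: "subtree \<tau> i \<in> bin_trees"
    by (auto simp: bin_trees_iff)
  have "{v \<in> slots \<tau>. prefix i v} = (@) i ` slots (subtree \<tau> i)"
  proof (intro equalityI subsetI)
    fix v assume "v \<in> {v \<in> slots \<tau>. prefix i v}"
    then obtain w u j where v: "v = i @ w" "v = u @ [j]" "u \<in> \<tau>" "v \<notin> \<tau>"
      unfolding slots_def prefix_def by blast
    then have "w \<noteq> []" using True by auto
    then have "u = i @ butlast w" "w = butlast w @ [j]"
      using v(1,2) by (metis butlast_append butlast_snoc, metis append_butlast_last_id last_appendR
          last_snoc)
    then have "w \<notin> subtree \<tau> i" "butlast w \<in> subtree \<tau> i"
      using v by (simp_all add: subtree_def)
    then have "w \<in> slots (subtree \<tau> i)"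
      using \<open>w = butlast w @ [j]\<close> unfolding slots_def by blast
    then show "v \<in> (@) i ` slots (subtree \<tau> i)"
      using v(1) by blast
  next
    fix v assume "v \<in> (@) i ` slots (subtree \<tau> i)"
    then show "v \<in> {v \<in> slots \<tau>. prefix i v}"
      by (auto simp: slots_def subtree_def)
  qed
  then have "S = (\<Sum>v\<in>slots (subtree \<tau> i). slot_weight (2 * x / (x + y)) (2 * y / (x + y)) \<tau> (i @ v))"
    unfolding S_def by (simp add: sum.reindex inj_on_def)
  also have "\<dots> = (\<Sum>v\<in>slots (subtree \<tau> i). slot_weight (2 * x / (x + y)) (2 * y / (x +
      y)) (subtree \<tau> i) v)"
    by (intro sum.cong refl slot_weight_subtree) (auto simp: slots_def)
  also have "\<dots> = real (card (subtree \<tau> i)) + 1"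
    by (rule sum_step_prob(1)[OF assms(1,2) bt])
  finally show ?thesis by simp
next
  case False
  have pc: "prefix_closed \<tau>"
    using assms(3) by (simp add: bin_trees_iff)
  have "subtree \<tau> i = {}"
    using False prefix_closedD[OF pc, of i] by (auto simp: subtree_def)
  \<comment> \<open>An absent word is the only possible slot at or below itself. Its weight may be
    anything between 0 and 2 instead of 1, and this is the only source of drift.\<close>
  moreover have sub: "{v \<in> slots \<tau>. prefix i v} \<subseteq> {i}"
  proof
    fix v assume "v \<in> {v \<in> slots \<tau>. prefix i v}"
    then obtain u j where v: "v = u @ [j]" "u \<in> \<tau>" "prefix i v"
      by (auto simp: slots_def)
    then have "i = v \<or> prefix i u"
      by (simp add: prefix_snoc)
    then show "v \<in> {i}"
      using False v(2) pc by (auto simp: prefix_closed_def)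
  qed
  have sw: "0 \<le> slot_weight (2 * x / (x + y)) (2 * y / (x + y)) \<tau> i" "slot_weight (2 * x / (x +
      y)) (2 * y / (x + y)) \<tau> i \<le> 2"
    using assms(1,2) by (auto simp: slot_weight_def divide_le_eq split: letter.split)
  have "S \<in> {0..2}"
  proof (cases "{v \<in> slots \<tau>. prefix i v} = {}")
    case False
    then have "{v \<in> slots \<tau>. prefix i v} = {i}"
      using sub by blast
    then show ?thesis
      unfolding S_def using sw by (simp only: sum.insert sum.empty) simp
  next
    case True
    show ?thesis unfolding S_def True by simp
  qed
  ultimately show ?thesis by auto
qed

text \<open>With k and m the sizes of tree and subtree, the mean increment is (S - (m + 1)) / ((k +
  1) (k + 2)), where S is the weight of the slots below \<open>i\<close>.\<close>

lemma node_mass_drift: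
  assumes "x > 0" "y > 0" "\<tau> \<in> bin_trees"
  shows "\<bar>\<Sum>v\<in>slots \<tau>. step_prob x y \<tau> v * (node_mass i (insert v \<tau>) - node_mass i \<tau>)\<bar> \<le>
      1 / (real (card \<tau>))^2"
proof -
  define k m where "k = real (card \<tau>)" and "m = real (card (subtree \<tau> i))"
  let ?S = "\<Sum>v\<in>{v \<in> slots \<tau>. prefix i v}. slot_weight (2 * x / (x + y)) (2 * y / (x + y)) \<tau> v"
  have k: "k \<ge> 1"
    using bin_trees_card_pos[OF assms(3)] by (simp add: k_def)
  have "(\<Sum>v\<in>slots \<tau>. step_prob x y \<tau> v * (node_mass i (insert v \<tau>) - node_mass i \<tau>)) =
      (\<Sum>v\<in>slots \<tau>. ((if prefix i v then slot_weight (2 * x / (x + y)) (2 * y / (x + y)) \<tau> v else 0)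
        - step_prob x y \<tau> v * (m + 1)) / ((k + 1) * (k + 2)))"
    using k by (intro sum.cong refl)
      (simp add: node_mass_diff[OF assms(3)] k_def[symmetric] m_def[symmetric] step_prob_def
          right_diff_distrib)
  also have "\<dots> = ((\<Sum>v\<in>slots \<tau>. if prefix i v then slot_weight (2 * x / (x + y)) (2 * y / (x +
      y)) \<tau> v else 0)
      - (\<Sum>v\<in>slots \<tau>. step_prob x y \<tau> v) * (m + 1)) / ((k + 1) * (k + 2))"
    by (simp only: sum_divide_distrib[symmetric] sum_subtractf sum_distrib_right)
  also have "(\<Sum>v\<in>slots \<tau>. if prefix i v then slot_weight (2 * x / (x + y)) (2 * y / (x +
      y)) \<tau> v else 0) = ?S"
    using finite_slots[OF assms(3)] by (simp add: sum.inter_filter)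
  also have "(\<Sum>v\<in>slots \<tau>. step_prob x y \<tau> v) = 1"
    by (rule sum_step_prob(2)[OF assms])
  finally have "\<bar>\<Sum>v\<in>slots \<tau>. step_prob x y \<tau> v * (node_mass i (insert v \<tau>) - node_mass i \<tau>)\<bar> =
      \<bar>?S - (m + 1)\<bar> / ((k + 1) * (k + 2))"
    using k by (simp add: abs_mult)
  also have "\<dots> \<le> 1 / (k * k)"
    using k sum_slot_weight_below[OF assms, of i] unfolding m_def[symmetric]
    by (intro frac_le mult_mono) auto
  finally show ?thesis
    by (simp add: k_def power2_eq_square)
qed

text \<open>Expanding the square around the present mass, the cross term is at most 2 / k^2 by the
  drift bound and the quadratic term at most 1 / k^2; hence the 3. In the application
  \<open>c\<close> is the mass at an earlier time.\<close>

lemma node_mass_second_moment: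
  assumes "x > 0" "y > 0" "\<tau> \<in> bin_trees" "c \<in> {0..1}"
  shows "(\<Sum>v\<in>slots \<tau>. step_prob x y \<tau> v * (node_mass i (insert v \<tau>) - c)^2) \<le>
    (node_mass i \<tau> - c)^2 + 3 / (real (card \<tau>))^2"
proof -
  let ?d = "\<lambda>v. node_mass i (insert v \<tau>) - node_mass i \<tau>" and ?e = "node_mass i \<tau> - c" and ?p =
      "step_prob x y \<tau>"
  let ?K = "1 / (real (card \<tau>))^2"
  note p1 = sum_step_prob(2)[OF assms(1-3)]
  have e: "\<bar>?e\<bar> \<le> 1"
    using node_mass_bounds[OF assms(3), of i] assms(4) by auto
  have "(\<Sum>v\<in>slots \<tau>. ?p v * (node_mass i (insert v \<tau>) - c)^2) =
      (\<Sum>v\<in>slots \<tau>. ?p v * ?e^2 + 2 * ?e * (?p v * ?d v) + ?p v * (?d v)^2)"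
    by (intro sum.cong refl) (simp add: power2_eq_square algebra_simps)
  also have "\<dots> = ?e^2 + 2 * ?e * (\<Sum>v\<in>slots \<tau>. ?p v * ?d v) + (\<Sum>v\<in>slots \<tau>. ?p v * (?d v)^2)"
    by (simp only: sum.distrib sum_distrib_left[symmetric] sum_distrib_right[symmetric] p1 mult_1)
  also have "2 * ?e * (\<Sum>v\<in>slots \<tau>. ?p v * ?d v) \<le> 2 * ?K"
  proof -
    have "?e * (\<Sum>v\<in>slots \<tau>. ?p v * ?d v) \<le> \<bar>?e\<bar> * \<bar>\<Sum>v\<in>slots \<tau>. ?p v * ?d v\<bar>"
      unfolding abs_mult[symmetric] by (rule abs_ge_self)
    also have "\<dots> \<le> 1 * ?K"
      using e by (intro mult_mono node_mass_drift assms) auto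
    finally show ?thesis
      unfolding mult.assoc by (intro mult_left_mono) simp_all
  qed
  also have "(\<Sum>v\<in>slots \<tau>. ?p v * (?d v)^2) \<le> (\<Sum>v\<in>slots \<tau>. ?p v * ?K)"
  proof (intro sum_mono mult_left_mono)
    fix v assume "v \<in> slots \<tau>"
    then have "\<bar>?d v\<bar>^2 \<le> (1 / real (card \<tau>))^2"
      by (intro power_mono node_mass_diff_le[OF assms(3)]) auto
    then show "(?d v)^2 \<le> ?K"
      by (simp add: power_divide)
  qed (simp add: step_prob_pos[OF assms(1,2)] less_imp_le)
  also have "(\<Sum>v\<in>slots \<tau>. ?p v * ?K) = ?K"
    by (simp only: sum_distrib_right[symmetric] p1 mult_1)
  finally show ?thesis by simp
qed

section \<open>Convergence along the cubes and filling of the gaps\<close>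

lemma cube_interval: "\<exists>j. j^3 \<le> n \<and> n < (Suc j)^3" for n :: nat
proof (induction n)
  case (Suc n)
  then obtain j where j: "j^3 \<le> n" "n < (Suc j)^3" by auto
  show ?case
  proof (cases "Suc n < (Suc j)^3")
    case False
    then have "Suc n = (Suc j)^3" using j by simp
    moreover have "(Suc j)^3 < (Suc (Suc j))^3"
      by (intro power_strict_mono) auto
    ultimately show ?thesis
      by (intro exI[of _ "Suc j"]) simp
  qed (use j in \<open>auto intro!: exI[of _ j]\<close>)
qed (auto intro!: exI[of _ 0])

lemma cube_gap: "j \<ge> 1 \<Longrightarrow> (Suc j)^3 \<le> j^3 + 7 * j^2" for j :: nat
proof -
  assume j: "j \<ge> 1"
  have "(Suc j)^3 = j^3 + 3 * j^2 + 3 * j + 1"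
    by (simp add: power3_eq_cube power2_eq_square algebra_simps)
  moreover have "j \<le> j^2" "1 \<le> j^2"
    using j by (simp_all add: power2_eq_square)
  ultimately show ?thesis by linarith
qed

text \<open>Between j^3 and (j + 1)^3 there are at most 7 j^2 steps of size at most 1 / j^3, a total
  of 7 / j.\<close>

lemma convergent_of_cubes:
  fixes a :: "nat \<Rightarrow> real"
  assumes step: "\<And>n. \<bar>a (Suc n) - a n\<bar> \<le> 1 / real (Suc n)"
    and lim: "(\<lambda>j. a (j^3)) \<longlonglongrightarrow> L"
  shows "a \<longlonglongrightarrow> L"
proof (rule LIMSEQ_I)
  fix e :: real assume e: "e > 0"
  obtain J where J: "\<And>j. j \<ge> J \<Longrightarrow> \<bar>a (j^3) - L\<bar> < e / 2"
    using LIMSEQ_D[OF lim, of "e / 2"] e by auto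
  obtain J' :: nat where J': "real J' > 14 / e"
    using reals_Archimedean2 by blast
  have gap: "\<bar>a (n + m) - a n\<bar> \<le> real m / real (Suc n)" for n m
  proof (induction m)
    case (Suc m)
    have "\<bar>a (n + Suc m) - a n\<bar> \<le> \<bar>a (Suc (n + m)) - a (n + m)\<bar> + \<bar>a (n + m) - a n\<bar>"
      by simp
    also have "\<dots> \<le> 1 / real (Suc (n + m)) + real m / real (Suc n)"
      by (intro add_mono step Suc.IH)
    also have "1 / real (Suc (n + m)) \<le> 1 / real (Suc n)"
      by (intro divide_left_mono) auto
    finally show ?case
      by (simp add: add_divide_distrib)
  qed simp
  have "norm (a n - L) < e" if n: "n \<ge> (J + J' + 1)^3" for n
  proof -
    obtain j where j: "j^3 \<le> n" "n < (Suc j)^3"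
      using cube_interval by blast
    have "(J + J' + 1)^3 < (Suc j)^3"
      using n j(2) by linarith
    then have "J + J' + 1 < Suc j"
      by (rule power_less_imp_less_base) simp
    then have jj: "j \<ge> J" "j \<ge> J'" "j \<ge> 1" by auto
    have "\<bar>a n - a (j^3)\<bar> \<le> real (n - j^3) / real (Suc (j^3))"
      using gap[of "j^3" "n - j^3"] j(1) by simp
    also have "\<dots> \<le> real (7 * j^2) / real (j^3)"
    proof -
      have "n - j^3 \<le> 7 * j^2"
        using cube_gap[OF jj(3)] j by linarith
      then show ?thesis
        using jj(3) by (intro frac_le of_nat_mono) (auto simp del: of_nat_power of_nat_mult)
    qed
    also have "\<dots> = 7 / real j"
      using jj(3) by (simp add: power3_eq_cube power2_eq_square)
    also have "\<dots> < e / 2"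
    proof -
      have "14 / e < real j"
        using J' jj(2) by linarith
      then show ?thesis
        using e jj(3) by (simp add: field_simps)
    qed
    finally have "\<bar>a n - a (j^3)\<bar> < e / 2" .
    with J[OF jj(1)] show ?thesis
      unfolding real_norm_def by arith
  qed
  then show "\<exists>N. \<forall>n\<ge>N. norm (a n - L) < e" by blast
qed

text \<open>Monotone convergence: the sum of the absolute values has finite expectation and is
  therefore almost surely finite.\<close>

lemma (in prob_space) AE_summable:
  fixes f :: "nat \<Rightarrow> 'a \<Rightarrow> real"
  assumes int: "\<And>j. integrable M (f j)" and bd: "\<And>j. expectation (\<lambda>\<omega>. \<bar>f j \<omega>\<bar>) \<le>
      b j" and sb: "summable b"
  shows "AE \<omega> in M. summable (\<lambda>j. f j \<omega>)"
proof -
  have b: "b j \<ge> 0" for j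
    using bd[of j] by (meson Bochner_Integration.integral_nonneg abs_ge_zero order_trans)
  have meas: "(\<lambda>\<omega>. ennreal \<bar>f j \<omega>\<bar>) \<in> borel_measurable M" for j
    using borel_measurable_integrable[OF int[of j]] by measurable
  have "(\<integral>\<^sup>+\<omega>. (\<Sum>j. ennreal \<bar>f j \<omega>\<bar>) \<partial>M) = (\<Sum>j. \<integral>\<^sup>+\<omega>. ennreal \<bar>f j \<omega>\<bar> \<partial>M)"
    by (rule nn_integral_suminf[OF meas])
  also have "\<dots> \<le> (\<Sum>j. ennreal (b j))"
  proof (intro suminf_le)
    fix j
    have "(\<integral>\<^sup>+\<omega>. ennreal \<bar>f j \<omega>\<bar> \<partial>M) = ennreal (expectation (\<lambda>\<omega>. \<bar>f j \<omega>\<bar>))"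
      using int[of j] by (intro nn_integral_eq_integral) auto
    then show "(\<integral>\<^sup>+\<omega>. ennreal \<bar>f j \<omega>\<bar> \<partial>M) \<le> ennreal (b j)"
      using bd[of j] by (simp add: ennreal_leI)
  qed auto
  also have "\<dots> < \<infinity>"
    using ennreal_suminf_neq_top[OF sb b] by (simp add: less_top)
  finally have "AE \<omega> in M. (\<Sum>j. ennreal \<bar>f j \<omega>\<bar>) \<noteq> \<infinity>"
    using meas by (intro nn_integral_PInf_AE borel_measurable_suminf) auto
  then show ?thesis
  proof eventually_elim
    case (elim \<omega>)
    then have "summable (\<lambda>j. \<bar>f j \<omega>\<bar>)"
      by (intro summable_suminf_not_top) auto
    then show ?case by (rule summable_rabs_cancel)
  qed
qed

context growth_chain
begin

text \<open>Each further step adds at most 3 / (size of the tree)^2, with the mass at time n as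
  fixed centre. The sizes are at least n + 1.\<close>

lemma node_mass_increment_moment:
  "expectation (\<lambda>\<omega>. (node_mass i (T (n + m) \<omega>) - node_mass i (T n \<omega>))^2) \<le>
      real m * (3 / (real (Suc n))^2)"
proof (induction m)
  case (Suc m)
  let ?N = "n + m" and ?c = "3 / (real (Suc n))^2"
  let ?g = "\<lambda>h t. (node_mass i t - node_mass i (h n))^2"
  let ?R = "\<lambda>h. \<Sum>v\<in>slots (h ?N). step_prob x y (h ?N) v * ?g h (insert v (h ?N))"
  have "expectation (\<lambda>\<omega>. (node_mass i (T (n + Suc m) \<omega>) - node_mass i (T n \<omega>))^2) =
      expectation (\<lambda>\<omega>. ?g (hist ?N \<omega>) (T (Suc ?N) \<omega>))"
    by (simp add: hist_def)
  also have "\<dots> =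
      expectation (\<lambda>\<omega>. \<Sum>v\<in>slots (T ?N \<omega>). step_prob x y (T ?N \<omega>) v * ?g (hist ?N \<omega>) (insert v (T ?N \<omega>)))"
    by (rule expectation_step[of ?g])
  also have "\<dots> = expectation (\<lambda>\<omega>. ?R (hist ?N \<omega>))"
    by (simp add: hist_def)
  also have "\<dots> \<le> expectation (\<lambda>\<omega>. ?g (hist ?N \<omega>) (hist ?N \<omega> ?N) + ?c)"
  proof (intro integral_mono_AE Bochner_Integration.integrable_add integrable_const)
    show "integrable M (\<lambda>\<omega>. ?R (hist ?N \<omega>))"
      by (rule integrable_hist[of ?R])
    show "integrable M (\<lambda>\<omega>. ?g (hist ?N \<omega>) (hist ?N \<omega> ?N))"
      by (rule integrable_hist[of "\<lambda>h. ?g h (h ?N)"])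
    from AE_path show "AE \<omega> in M. ?R (hist ?N \<omega>) \<le> ?g (hist ?N \<omega>) (hist ?N \<omega> ?N) + ?c"
    proof eventually_elim
      case (elim \<omega>)
      then have *: "T ?N \<omega> \<in> bin_trees" "T n \<omega> \<in> bin_trees" "card (T ?N \<omega>) = Suc ?N"
        by (auto simp: level_def)
      have "?R (hist ?N \<omega>) \<le> ?g (hist ?N \<omega>) (hist ?N \<omega> ?N) + 3 / (real (card (T ?N \<omega>)))^2"
        using node_mass_second_moment[OF x_pos y_pos *(1) node_mass_bounds[OF *(2)], of i i]
        by (simp add: hist_def)
      also have "3 / (real (card (T ?N \<omega>)))^2 \<le> ?c"
        unfolding *(3) by (intro divide_left_mono power_mono) (auto simp del: of_nat_Suc)
      finally show ?case by simp
    qed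
  qed
  also have "\<dots> = expectation (\<lambda>\<omega>. (node_mass i (T ?N \<omega>) - node_mass i (T n \<omega>))^2) + ?c"
    using integrable_hist[of "\<lambda>h. ?g h (h ?N)" ?N] by (simp add: hist_def prob_space)
  also have "\<dots> \<le> real m * ?c + ?c"
    using Suc.IH by simp
  finally show ?case by (simp add: distrib_right add_divide_distrib)
qed simp

lemma AE_node_mass_convergent: "AE \<omega> in M. convergent (\<lambda>n. node_mass i (T n \<omega>))"
proof -
  let ?Y = "\<lambda>n \<omega>. node_mass i (T n \<omega>)"
  let ?d = "\<lambda>j \<omega>. ?Y ((j + 2)^3) \<omega> - ?Y ((j + 1)^3) \<omega>"
  have int: "integrable M (?Y n)" for n
    by (rule expectation_T_sum(1))
  have "AE \<omega> in M. summable (\<lambda>j. ?d j \<omega>)"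
  proof (rule AE_summable)
    show "integrable M (?d j)" for j
      by (intro Bochner_Integration.integrable_diff int)
    \<comment> \<open>At most 7 k^2 steps with 3 / k^6 each give a second moment of 21 / k^4;
      weighting it by k^2 and adding 1 / k^2 gives 22 / k^2.\<close>
    show "expectation (\<lambda>\<omega>. \<bar>?d j \<omega>\<bar>) \<le> 22 * inverse (real (j + 1) ^ 2)" for j
    proof -
      define k where "k = j + 1"
      have k: "k \<ge> 1" by (simp add: k_def)
      have le: "k^3 \<le> (Suc k)^3" by (rule power_mono) auto
      have int2: "integrable M (\<lambda>\<omega>. (?d j \<omega>)^2)"
      proof -
        have "(\<lambda>\<omega>. (?d j \<omega>)^2) =
            (\<lambda>\<omega>. (\<lambda>h. (node_mass i (h ((Suc k)^3)) - node_mass i (h (k^3)))^2) (hist ((Suc k)^3) \<omega>))"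
          using le by (simp add: hist_def k_def)
        then show ?thesis
          using integrable_hist[of "\<lambda>h. (node_mass i (h ((Suc k)^3)) - node_mass i (h (k^3)))^2"
              "(Suc k)^3"] by simp
      qed
      have "expectation (\<lambda>\<omega>. (?d j \<omega>)^2) \<le> real ((Suc k)^3 - k^3) * (3 / (real (Suc (k^3)))^2)"
        using node_mass_increment_moment[of i "k^3" "(Suc k)^3 - k^3"] le by (simp add: k_def)
      also have "\<dots> \<le> real (7 * k^2) * (3 / (real (k^3))^2)"
      proof (rule mult_mono)
        show "real ((Suc k)^3 - k^3) \<le> real (7 * k^2)"
          using cube_gap[OF k] by (intro of_nat_mono) linarith
        have "(real (k^3))^2 \<le> (real (Suc (k^3)))^2"
          by (intro power_mono) auto
        then show "3 / (real (Suc (k^3)))^2 \<le> 3 / (real (k^3))^2"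
          using k by (intro frac_le) simp_all
      qed auto
      also have "\<dots> = 21 * inverse (real k^2) * inverse (real k^2)"
      proof -
        have "(real (k^3))^2 = real k^2 * (real k^2 * real k^2)"
          by (simp add: power2_eq_square power3_eq_cube)
        moreover have "7 * a * (3 / (a * (a * a))) = 21 * inverse a * inverse a" if "a \<noteq> 0" for a :: real
          using that by (simp add: field_simps)
        moreover have "real (7 * k^2) = 7 * real k^2" "real k^2 \<noteq> 0"
          using k by simp_all
        ultimately show ?thesis by metis
      qed
      finally have D: "expectation (\<lambda>\<omega>. (?d j \<omega>)^2) \<le> 21 * inverse (real k^2) * inverse (real k^2)" .
      \<comment> \<open>The arithmetic-geometric inequality with weight k^2 bounds the first moment
        by the second and makes both terms of order 1 / k^2.\<close>
      have "\<bar>z\<bar> \<le> inverse (real k^2) + real k^2 * z^2" for z :: real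
      proof -
        have "0 \<le> (inverse (real k) - real k * \<bar>z\<bar>)^2" by simp
        also have "\<dots> = inverse (real k^2) + real k^2 * z^2 - 2 * \<bar>z\<bar>"
          using k by (simp add: power2_diff power_mult_distrib power_inverse)
        finally show ?thesis by simp
      qed
      then have "expectation (\<lambda>\<omega>. \<bar>?d j \<omega>\<bar>) \<le> expectation (\<lambda>\<omega>. inverse (real k^2) +
          real k^2 * (?d j \<omega>)^2)"
        using int2 int by (intro integral_mono) auto
      also have "\<dots> = inverse (real k^2) + real k^2 * expectation (\<lambda>\<omega>. (?d j \<omega>)^2)"
        using int2 by (simp add: prob_space)
      also have "\<dots> \<le> inverse (real k^2) + real k^2 * (21 * inverse (real k^2) * inverse (real k^2))"
        by (intro add_left_mono mult_left_mono D) auto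
      also have "\<dots> = 22 * inverse (real k^2)"
        using k by simp
      finally show ?thesis by (simp add: k_def)
    qed
    have "summable (\<lambda>j. inverse (real (Suc j) ^ 2))"
      using inverse_power_summable[of 2, where 'a = real] by (subst summable_Suc_iff) simp_all
    then show "summable (\<lambda>j. 22 * inverse (real (j + 1) ^ 2))"
      by - (rule summable_mult, simp)
  qed
  from this AE_path show ?thesis
  proof eventually_elim
    case (elim \<omega>)
    have sum: "(\<Sum>j<m. ?d j \<omega>) = ?Y ((m + 1)^3) \<omega> - ?Y 1 \<omega>" for m
      by (induction m) simp_all
    have "(\<lambda>m. ?Y ((m + 1)^3) \<omega> - ?Y 1 \<omega>) \<longlonglongrightarrow> (\<Sum>j. ?d j \<omega>)"
      using summable_LIMSEQ[OF elim(1)] unfolding sum .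
    from tendsto_add[OF this tendsto_const[of "?Y 1 \<omega>"]]
    have "(\<lambda>m. ?Y ((m + 1)^3) \<omega>) \<longlonglongrightarrow> (\<Sum>j. ?d j \<omega>) + ?Y 1 \<omega>"
      by simp
    then have "(\<lambda>m. ?Y (m^3) \<omega>) \<longlonglongrightarrow> (\<Sum>j. ?d j \<omega>) + ?Y 1 \<omega>"
      using LIMSEQ_imp_Suc[of "\<lambda>m. ?Y (m^3) \<omega>"] by simp
    moreover have "\<bar>?Y (Suc n) \<omega> - ?Y n \<omega>\<bar> \<le> 1 / real (Suc n)" for n
    proof -
      have "T n \<omega> \<in> bin_trees" "card (T n \<omega>) = Suc n" "edge (T n \<omega>) (T (Suc n) \<omega>)"
        using elim(2) by (auto simp: level_def)
      then show ?thesis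
        using node_mass_diff_le[of "T n \<omega>" _ i] by (auto simp: edge_iff_slot)
    qed
    ultimately have "(\<lambda>n. ?Y n \<omega>) \<longlonglongrightarrow> (\<Sum>j. ?d j \<omega>) + ?Y 1 \<omega>"
      by - (rule convergent_of_cubes[where a = "\<lambda>n. ?Y n \<omega>"])
    then show ?case
      by (rule convergentI)
  qed
qed

end

section \<open>The limiting splits\<close>

lemma node_mass_level: "\<tau> \<in> level n \<Longrightarrow> node_mass i \<tau> = (real (card (subtree \<tau> i)) + 1) / (real n + 2)"
  by (simp add: node_mass_def level_def)

lemma split_ratio_bounds:
  assumes "\<tau> \<in> bin_trees"
  shows "split_ratio w \<tau> \<in> {0..1}"
proof (cases "subtree \<tau> w = {}")
  case True
  then have "subtree \<tau> (w @ [L1]) = {}"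
    by (simp add: subtree_append)
  then show ?thesis by (simp add: split_ratio_def)
next
  case False
  have "prefix_closed (subtree \<tau> w)"
    using assms by (simp add: bin_trees_iff prefix_closed_subtree)
  from card_eq_subtrees[OF this False]
  have "real (card (subtree \<tau> w)) - 1 = real (card (subtree \<tau> (w @ [L1]))) +
      real (card (subtree \<tau> (w @ [L2])))"
    by (simp add: subtree_append)
  then show ?thesis
    by (simp add: split_ratio_def divide_le_eq_1) linarith
qed

text \<open>A statement about a single path. The shares of the subtrees differ from the masses by 1
  / (n + 2), and so does the share of proper descendants from that of the subtree; positivity of the
  limit allows division.\<close>

lemma path_proportions:
  assumes lev: "\<And>n. t n \<in> level n" and lim: "\<And>i. (\<lambda>n. node_mass i (t n)) \<longlonglongrightarrow> z i" and pos: "z i > 0"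
  shows "(\<lambda>n. real (card (subtree (t n) (i @ [j]))) / real (card (subtree (t n) i))) \<longlonglongrightarrow> z (i @ [j]) / z i"
    and "(\<lambda>n. split_ratio i (t n)) \<longlonglongrightarrow> z (i @ [L1]) / z i"
    and "z i = z (i @ [L1]) + z (i @ [L2])"
proof -
  let ?c = "\<lambda>i n. real (card (subtree (t n) i))"
  have inv: "(\<lambda>n. 1 / (real n + 2)) \<longlonglongrightarrow> 0"
    using LIMSEQ_Suc[OF LIMSEQ_inverse_real_of_nat] by (simp add: inverse_eq_divide add.commute)
  have share: "(\<lambda>n. ?c i n / (real n + 2)) \<longlonglongrightarrow> z i" for i
  proof -
    have "(\<lambda>n. node_mass i (t n) - 1 / (real n + 2)) \<longlonglongrightarrow> z i - 0"
      by (intro tendsto_diff lim inv)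
    then show ?thesis
      by (simp add: node_mass_level[OF lev] diff_divide_distrib[symmetric])
  qed
  have share1: "(\<lambda>n. (?c i n - 1) / (real n + 2)) \<longlonglongrightarrow> z i"
    using tendsto_diff[OF share inv] by (simp add: diff_divide_distrib[symmetric])
  have n2: "real n + 2 \<noteq> 0" for n
    by linarith
  show "(\<lambda>n. ?c (i @ [j]) n / ?c i n) \<longlonglongrightarrow> z (i @ [j]) / z i"
    using tendsto_divide[OF share[of "i @ [j]"] share[of i]] pos n2 by simp
  show "(\<lambda>n. split_ratio i (t n)) \<longlonglongrightarrow> z (i @ [L1]) / z i"
    using tendsto_divide[OF share[of "i @ [L1]"] share1] pos n2 by (simp add: split_ratio_def)
  have "(\<lambda>n. ?c (i @ [L1]) n / (real n + 2) + ?c (i @ [L2]) n / (real n + 2)) \<longlonglongrightarrow> z (i @ [L1]) +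
      z (i @ [L2])"
    by (intro tendsto_add share)
  moreover have "\<forall>\<^sub>F n in sequentially. ?c (i @ [L1]) n / (real n + 2) +
      ?c (i @ [L2]) n / (real n + 2) = (?c i n - 1) / (real n + 2)"
    using order_tendstoD(1)[OF share[of i] pos]
  proof eventually_elim
    case (elim n)
    then have "subtree (t n) i \<noteq> {}" by auto
    moreover have "prefix_closed (subtree (t n) i)"
      using lev[of n] by (simp add: level_def bin_trees_iff prefix_closed_subtree)
    ultimately have "?c i n = 1 + ?c (i @ [L1]) n + ?c (i @ [L2]) n"
      using card_eq_subtrees[of "subtree (t n) i"] by (simp add: subtree_append)
    then show ?case
      by (simp add: add_divide_distrib[symmetric])
  qed
  ultimately have "(\<lambda>n. (?c i n - 1) / (real n + 2)) \<longlonglongrightarrow> z (i @ [L1]) + z (i @ [L2])"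
    by (simp add: tendsto_cong)
  with share1 show "z i = z (i @ [L1]) + z (i @ [L2])"
    by (rule LIMSEQ_unique)
qed

section \<open>From the laws at fixed times to the law of the almost sure limit\<close>

lemma limit_cdf_1: "x + y > 0 \<Longrightarrow> limit_cdf x y 1 = 1"
  by (simp add: limit_cdf_def)

lemma limit_cdf_0: "limit_cdf x y 0 = 0"
  by (simp add: limit_cdf_def)

lemma limit_cdf_tendsto: "f \<longlonglongrightarrow> c \<Longrightarrow> (\<lambda>n. limit_cdf x y (f n)) \<longlonglongrightarrow> limit_cdf x y c"
  unfolding limit_cdf_def Let_def divide_inverse by (intro tendsto_intros)

text \<open>Up to a null set \<open>A\<close> lies in the lower limit of the events
  \<open>B n\<close>. The sets \<open>C N\<close> of points that stay in all \<open>B n\<close> from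
  time \<open>N\<close> on increase to it, and continuity from below applies.\<close>

lemma (in prob_space) prob_le_limit:
  assumes A: "A \<in> events" and B: "\<And>n :: nat. B n \<in> events"
    and ev: "AE \<omega> in M. \<omega> \<in> A \<longrightarrow> (\<forall>\<^sub>F n in sequentially. \<omega> \<in> B n)"
    and lim: "(\<lambda>n. prob (B n)) \<longlonglongrightarrow> p"
  shows "prob A \<le> p"
proof -
  define C where "C N = A \<inter> (\<Inter>n\<in>{N..}. B n)" for N
  have C: "C N \<in> events" for N
    unfolding C_def using A B by (intro sets.Int sets.countable_INT') auto
  have "prob A = prob (\<Union>N. C N)"
  proof (rule finite_measure_eq_AE)
    from ev AE_space show "AE \<omega> in M. \<omega> \<in> A \<longleftrightarrow> \<omega> \<in> (\<Union>N. C N)"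
      by eventually_elim (auto simp: C_def eventually_sequentially)
  qed (use A C in auto)
  moreover have "(\<lambda>N. prob (C N)) \<longlonglongrightarrow> prob (\<Union>N. C N)"
    using C by (intro finite_Lim_measure_incseq) (auto simp: C_def incseq_def)
  moreover have "prob (C N) \<le> prob (B N)" for N
    using B by (intro finite_measure_mono) (auto simp: C_def)
  ultimately show ?thesis
    using lim by (auto intro: LIMSEQ_le)
qed

lemma (in prob_space) limit_le_prob:
  assumes A: "A \<in> events" and B: "\<And>n :: nat. B n \<in> events"
    and ev: "AE \<omega> in M. \<omega> \<notin> A \<longrightarrow> (\<forall>\<^sub>F n in sequentially. \<omega> \<notin> B n)"
    and lim: "(\<lambda>n. prob (B n)) \<longlonglongrightarrow> p"
  shows "p \<le> prob A"
proof -
  have "prob (space M - A) \<le> 1 - p"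
  proof (rule prob_le_limit)
    show "AE \<omega> in M. \<omega> \<in> space M - A \<longrightarrow> (\<forall>\<^sub>F n in sequentially. \<omega> \<in> space M - B n)"
      using ev by eventually_elim auto
    show "(\<lambda>n. prob (space M - B n)) \<longlonglongrightarrow> 1 - p"
      unfolding prob_compl[OF B] by (intro tendsto_intros lim)
  qed (use A B in auto)
  then show ?thesis
    using prob_compl[OF A] by simp
qed

context growth_chain
begin

definition mass_limit :: "word \<Rightarrow> 'a \<Rightarrow> real" where
  "mass_limit i \<omega> = lim (\<lambda>n. node_mass i (T n \<omega>))"

lemma borel_measurable_T:
  fixes f :: "tree \<Rightarrow> real"
  shows "(\<lambda>\<omega>. f (T n \<omega>)) \<in> borel_measurable M"
  by (rule measurable_compose[OF T_measurable]) simp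

lemma mass_limit_measurable [measurable]: "mass_limit i \<in> borel_measurable M"
  unfolding mass_limit_def by (rule borel_measurable_lim_metric) (rule borel_measurable_T)

lemma AE_mass_limit: "AE \<omega> in M. \<forall>i. (\<lambda>n. node_mass i (T n \<omega>)) \<longlonglongrightarrow> mass_limit i \<omega>"
  unfolding AE_all_countable mass_limit_def
  using AE_node_mass_convergent by (simp add: convergent_LIMSEQ_iff)

lemma prob_split_ratio_tendsto:
  assumes I: "finite I"
  shows "(\<lambda>n. prob {\<omega> \<in> space M. \<forall>w\<in>I. split_ratio w (T n \<omega>) \<le> c w}) \<longlonglongrightarrow> (\<Prod>w\<in>I. limit_cdf x y (c w))"
proof -
  obtain d where d: "I \<subseteq> words_below d"
  proof
    show "I \<subseteq> words_below (Suc (Max (length ` I)))"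
    proof
      fix w assume "w \<in> I"
      then have "length w \<le> Max (length ` I)"
        using I by (intro Max_ge) auto
      then show "w \<in> words_below (Suc (Max (length ` I)))"
        by (simp add: words_below_def)
    qed
  qed
  \<comment> \<open>Threshold 1 imposes no condition on a split ratio and contributes the factor
    \<open>limit_cdf x y 1 = 1\<close>.\<close>
  define c' where "c' w = (if w \<in> I then c w else 1)" for w
  have "(\<lambda>n. ratio_cdf x y d c' (Suc n)) \<longlonglongrightarrow> (\<Prod>w\<in>words_below d. limit_cdf x y (c' w))"
    by (rule LIMSEQ_Suc[OF ratio_cdf_tendsto[OF x_pos y_pos]])
  moreover have "(\<Prod>w\<in>words_below d. limit_cdf x y (c' w)) = (\<Prod>w\<in>I. limit_cdf x y (c' w))"
    using d x_pos y_pos by (intro prod.mono_neutral_right finite_words_below) (auto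
        simp: c'_def limit_cdf_1)
  moreover have "(\<Prod>w\<in>I. limit_cdf x y (c' w)) = (\<Prod>w\<in>I. limit_cdf x y (c w))"
    by (intro prod.cong) (auto simp: c'_def)
  moreover have "ratio_cdf x y d c' (Suc n) = prob {\<omega> \<in> space M. \<forall>w\<in>I. split_ratio w (T n \<omega>) \<le>
      c w}" for n
  proof -
    have "(\<forall>w\<in>words_below d. split_ratio w (T n \<omega>) \<le> c' w) \<longleftrightarrow> (\<forall>w\<in>I. split_ratio w (T n \<omega>) \<le> c w)"
      if "\<omega> \<in> space M" for \<omega>
      using d split_ratio_bounds[OF T_bin_tree[OF that, of n]] by (auto simp: c'_def split: if_splits)
    then show ?thesis
      unfolding prob_split_ratio_words[symmetric] by (metis (no_types, lifting) Collect_cong)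
  qed
  ultimately show ?thesis by simp
qed

text \<open>Moving the thresholds by 1 / (m + 1) up or down turns the closed condition on the limit
  into one that holds or fails for all large n; continuity of \<open>limit_cdf\<close> closes the
  gap. The limit \<open>R\<close> is left abstract because the lemma is first used for one word, to
  prove that the masses are positive, and then for all split limits.\<close>

lemma prob_limit_ratio:
  assumes I: "finite I" and meas: "\<And>w. w \<in> I \<Longrightarrow> R w \<in> borel_measurable M"
    and lim: "AE \<omega> in M. \<forall>w\<in>I. (\<lambda>n. split_ratio w (T n \<omega>)) \<longlonglongrightarrow> R w \<omega>"
  shows "prob {\<omega> \<in> space M. \<forall>w\<in>I. R w \<omega> \<le> c w} = (\<Prod>w\<in>I. limit_cdf x y (c w))"
proof -
  let ?A = "{\<omega> \<in> space M. \<forall>w\<in>I. R w \<omega> \<le> c w}"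
  let ?B = "\<lambda>c n. {\<omega> \<in> space M. \<forall>w\<in>I. split_ratio w (T n \<omega>) \<le> c w}"
  have A: "?A \<in> events"
    using I meas by (intro sets.sets_Collect_finite_All) (auto intro!: borel_measurable_le)
  have B: "?B c n \<in> events" for c n
    by (rule sets_T[of "\<lambda>\<tau>. \<forall>w\<in>I. split_ratio w \<tau> \<le> c w"])
  let ?e = "\<lambda>m. inverse (real (Suc m))"
  have e: "?e m > 0" for m by simp
  have upper: "prob ?A \<le> (\<Prod>w\<in>I. limit_cdf x y (c w + ?e m))" for m
  proof (rule prob_le_limit[OF A B _ prob_split_ratio_tendsto[OF I]])
    from lim show "AE \<omega> in M. \<omega> \<in> ?A \<longrightarrow> (\<forall>\<^sub>F n in sequentially. \<omega> \<in> ?B (\<lambda>w. c w + ?e m) n)"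
    proof eventually_elim
      case (elim \<omega>)
      show ?case
      proof
        assume \<omega>: "\<omega> \<in> ?A"
        have "\<forall>\<^sub>F n in sequentially. split_ratio w (T n \<omega>) < c w + ?e m" if "w \<in> I" for w
        proof (rule order_tendstoD(2))
          show "(\<lambda>n. split_ratio w (T n \<omega>)) \<longlonglongrightarrow> R w \<omega>"
            using elim that by blast
          have "R w \<omega> \<le> c w" using \<omega> that by blast
          then show "R w \<omega> < c w + ?e m" using e[of m] by linarith
        qed
        then have "\<forall>\<^sub>F n in sequentially. \<forall>w\<in>I. split_ratio w (T n \<omega>) < c w + ?e m"
          using I by (intro eventually_ball_finite) auto
        then show "\<forall>\<^sub>F n in sequentially. \<omega> \<in> ?B (\<lambda>w. c w + ?e m) n"
          by eventually_elim (use \<omega> in \<open>auto intro: less_imp_le\<close>)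
      qed
    qed
  qed
  have lower: "(\<Prod>w\<in>I. limit_cdf x y (c w - ?e m)) \<le> prob ?A" for m
  proof (rule limit_le_prob[OF A B _ prob_split_ratio_tendsto[OF I]])
    from lim AE_space show "AE \<omega> in M. \<omega> \<notin> ?A \<longrightarrow> (\<forall>\<^sub>F n in sequentially. \<omega> \<notin> ?B (\<lambda>w. c w - ?e m) n)"
    proof eventually_elim
      case (elim \<omega>)
      show ?case
      proof
        assume "\<omega> \<notin> ?A"
        then obtain w where w: "w \<in> I" "R w \<omega> > c w"
          using elim by (auto simp: not_le)
        have "\<forall>\<^sub>F n in sequentially. c w < split_ratio w (T n \<omega>)"
          using elim(1) w by (intro order_tendstoD(1)[where f = "\<lambda>n. split_ratio w (T n \<omega>)" and y =
              "R w \<omega>"]) auto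
        then show "\<forall>\<^sub>F n in sequentially. \<omega> \<notin> ?B (\<lambda>w. c w - ?e m) n"
        proof eventually_elim
          case (elim n)
          then have "\<not> split_ratio w (T n \<omega>) \<le> c w - ?e m"
            using e[of m] by linarith
          then show ?case using w(1) by blast
        qed
      qed
    qed
  qed
  have "(\<lambda>m. \<Prod>w\<in>I. limit_cdf x y (c w + ?e m)) \<longlonglongrightarrow> (\<Prod>w\<in>I. limit_cdf x y (c w + 0))"
    by (intro tendsto_prod limit_cdf_tendsto tendsto_add tendsto_const LIMSEQ_inverse_real_of_nat)
  then have 1: "prob ?A \<le> (\<Prod>w\<in>I. limit_cdf x y (c w))"
    using upper by (intro LIMSEQ_le_const[of _ _ "prob ?A"]) auto
  have "(\<lambda>m. \<Prod>w\<in>I. limit_cdf x y (c w - ?e m)) \<longlonglongrightarrow> (\<Prod>w\<in>I. limit_cdf x y (c w - 0))"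
    by (intro tendsto_prod limit_cdf_tendsto tendsto_diff tendsto_const LIMSEQ_inverse_real_of_nat)
  then have 2: "(\<Prod>w\<in>I. limit_cdf x y (c w)) \<le> prob ?A"
    using lower by (intro LIMSEQ_le_const2[of _ _ "prob ?A"]) auto
  from 1 2 show ?thesis by simp
qed

text \<open>The splitting law has no atoms at 0 and 1, so no node loses its whole mass in the limit.\<close>

lemma AE_mass_limit_pos: "AE \<omega> in M. mass_limit i \<omega> > 0"
proof (induction i rule: rev_induct)
  case Nil
  from AE_path show ?case
  proof eventually_elim
    case (elim \<omega>)
    then have "(\<lambda>n. node_mass [] (T n \<omega>)) = (\<lambda>n. 1)"
      by (auto simp: node_mass_def fun_eq_iff add_eq_0_iff_both_eq_0)
    then show ?case
      by (simp add: mass_limit_def)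
  qed
next
  case (snoc j i)
  define R where "R \<omega> = mass_limit (i @ [L1]) \<omega> / mass_limit i \<omega>" for \<omega>
  have R [measurable]: "R \<in> borel_measurable M"
    unfolding R_def by measurable
  \<comment> \<open>The induction hypothesis makes the denominator positive, so \<open>R\<close> is
    a limit of split ratios and its law is known.\<close>
  have lim: "AE \<omega> in M. (\<lambda>n. split_ratio i (T n \<omega>)) \<longlonglongrightarrow> R \<omega>"
    using snoc AE_path AE_mass_limit
    by eventually_elim (auto simp: R_def intro!: path_proportions(2)[where z = "\<lambda>i. mass_limit i _"])
  have cdf: "prob {\<omega> \<in> space M. R \<omega> \<le> c} = limit_cdf x y c" for c
    using prob_limit_ratio[of "{i}" "\<lambda>_. R" "\<lambda>_. c"] lim R by simp
  have ev: "{\<omega> \<in> space M. R \<omega> \<le> c} \<in> events" for c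
    by measurable
  have "AE \<omega> in M. \<omega> \<notin> {\<omega> \<in> space M. R \<omega> \<le> 0}"
    using cdf[of 0] prob_eq_0[OF ev[of 0]] by (simp add: limit_cdf_0)
  then have R0: "AE \<omega> in M. R \<omega> > 0"
    using AE_space by eventually_elim auto
  have ev1: "{\<omega> \<in> space M. R \<omega> < 1} \<in> events"
    by measurable
  \<comment> \<open>Probabilities are known for closed conditions only, so
    \<open>R \<omega> < 1\<close> is exhausted from below.\<close>
  have "limit_cdf x y (1 - inverse (real (Suc m))) \<le> prob {\<omega> \<in> space M. R \<omega> < 1}" for m
  proof -
    have lt: "1 - inverse (real (Suc m)) < 1" by simp
    then have "{\<omega> \<in> space M. R \<omega> \<le> 1 - inverse (real (Suc m))} \<subseteq> {\<omega> \<in> space M. R \<omega> < 1}"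
      using le_less_trans[OF _ lt] by blast
    then show ?thesis
      unfolding cdf[symmetric] by (rule finite_measure_mono[OF _ ev1])
  qed
  moreover have "(\<lambda>m. limit_cdf x y (1 - inverse (real (Suc m)))) \<longlonglongrightarrow> limit_cdf x y (1 - 0)"
    by (intro limit_cdf_tendsto tendsto_diff tendsto_const LIMSEQ_inverse_real_of_nat)
  ultimately have "limit_cdf x y 1 \<le> prob {\<omega> \<in> space M. R \<omega> < 1}"
    by (intro LIMSEQ_le_const2[of _ _ "prob {\<omega> \<in> space M. R \<omega> < 1}"]) auto
  then have "prob {\<omega> \<in> space M. R \<omega> < 1} = 1"
    using x_pos y_pos prob_le_1[of "{\<omega> \<in> space M. R \<omega> < 1}"] by (simp add: limit_cdf_1)
  then have R1: "AE \<omega> in M. R \<omega> < 1"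
    using AE_in_set_eq_1[OF ev1] by (auto elim: eventually_mono)
  from R0 R1 snoc AE_path AE_mass_limit show ?case
  proof eventually_elim
    case (elim \<omega>)
    then have sum: "mass_limit i \<omega> = mass_limit (i @ [L1]) \<omega> + mass_limit (i @ [L2]) \<omega>"
      by (intro path_proportions(3)[where t = "\<lambda>n. T n \<omega>" and z = "\<lambda>i. mass_limit i \<omega>"]) auto
    have "mass_limit (i @ [L1]) \<omega> > 0" "mass_limit (i @ [L1]) \<omega> < mass_limit i \<omega>"
      using elim(1-3) by (simp_all add: R_def zero_less_divide_iff pos_divide_less_eq)
    then show ?case
      using sum by (cases j) auto
  qed
qed

text \<open>Clamping keeps the value in [0, 1] also where \<open>lim\<close> is arbitrary, so that
  the splits lie on the simplex everywhere and not just almost surely.\<close>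

definition split_limit :: "word \<Rightarrow> 'a \<Rightarrow> real" where
  "split_limit i \<omega> = max 0 (min 1 (lim (\<lambda>n. split_ratio i (T n \<omega>))))"

definition V :: "word \<Rightarrow> letter \<Rightarrow> 'a \<Rightarrow> real" where
  "V i j \<omega> = (case j of L1 \<Rightarrow> split_limit i \<omega> | L2 \<Rightarrow> 1 - split_limit i \<omega>)"

lemma split_limit_measurable [measurable]: "split_limit i \<in> borel_measurable M"
proof -
  have [measurable]: "(\<lambda>\<omega>. lim (\<lambda>n. split_ratio i (T n \<omega>))) \<in> borel_measurable M"
    by (rule borel_measurable_lim_metric) (rule borel_measurable_T)
  show ?thesis
    unfolding split_limit_def by measurable
qed

text \<open>Almost surely the split ratios converge to a quotient of masses in [0, 1], which
  clamping leaves unchanged. Additivity of the masses handles the right child.\<close>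

lemma AE_split_limit:
  "AE \<omega> in M. (\<lambda>n. split_ratio i (T n \<omega>)) \<longlonglongrightarrow> split_limit i \<omega> \<and>
    (\<lambda>n. real (card (subtree (T n \<omega>) (i @ [j]))) / real (card (subtree (T n \<omega>) i))) \<longlonglongrightarrow> V i j \<omega>"
  using AE_mass_limit_pos[of i] AE_path AE_mass_limit AE_space
proof eventually_elim
  case (elim \<omega>)
  then have lev: "\<And>n. T n \<omega> \<in> level n" and lim: "\<And>i. (\<lambda>n. node_mass i (T n \<omega>)) \<longlonglongrightarrow> mass_limit i \<omega>"
    by auto
  note p = path_proportions[OF lev lim elim(1)]
  have "mass_limit (i @ [L1]) \<omega> / mass_limit i \<omega> \<in> {0..1}"
    using p(2) split_ratio_bounds[OF T_bin_tree[OF elim(4)], of i]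
    by (auto intro: LIMSEQ_le_const LIMSEQ_le_const2)
  then have sl: "split_limit i \<omega> = mass_limit (i @ [L1]) \<omega> / mass_limit i \<omega>"
    using limI[OF p(2)] by (simp add: split_limit_def)
  have "V i j \<omega> = mass_limit (i @ [j]) \<omega> / mass_limit i \<omega>"
    using p(3) elim(1) by (cases j) (simp_all add: V_def sl field_simps)
  then show ?case
    using p(1)[of j] p(2) sl by simp
qed

lemma prob_split_limit:
  assumes "finite I"
  shows "prob {\<omega> \<in> space M. \<forall>w\<in>I. split_limit w \<omega> \<le> c w} = (\<Prod>w\<in>I. limit_cdf x y (c w))"
proof (rule prob_limit_ratio[OF assms])
  have "AE \<omega> in M. (\<lambda>n. split_ratio w (T n \<omega>)) \<longlonglongrightarrow> split_limit w \<omega>" for w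
    using AE_split_limit[of w] by eventually_elim auto
  then have "AE \<omega> in M. \<forall>w. (\<lambda>n. split_ratio w (T n \<omega>)) \<longlonglongrightarrow> split_limit w \<omega>"
    by (simp add: AE_all_countable)
  then show "AE \<omega> in M. \<forall>w\<in>I. (\<lambda>n. split_ratio w (T n \<omega>)) \<longlonglongrightarrow> split_limit w \<omega>"
    by eventually_elim auto
qed simp

lemma split_limit_bounds: "split_limit i \<omega> \<in> {0..1}"
  by (simp add: split_limit_def)

text \<open>Joint distribution functions that factor give independence of finite subfamilies through
  a generating system stable under intersection, and independence of the whole family is a matter of
  finite subfamilies.\<close>

lemma indep_split_limit: "indep_vars (\<lambda>_. borel) split_limit UNIV"
proof -
  \<comment> \<open>The generator has to contain the whole space. For these variables
    \<open>UNIV\<close> amounts to the threshold 1, because their values lie in [0, 1].\<close>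
  let ?E = "insert UNIV (range atMost) :: real set set"
  have fin: "indep_vars (\<lambda>_. borel) split_limit J" if J: "finite J" "J \<noteq> {}" for J
  proof (subst indep_vars_finite[where E = "\<lambda>_. ?E"])
    show "sets borel = sigma_sets (space borel) ?E"
    proof -
      have "sigma_sets UNIV (range atMost :: real set set) = sigma_sets UNIV ?E"
        by (rule sigma_sets_eqI) (auto intro: sigma_sets_top)
      moreover have "sets (borel :: real measure) = sigma_sets UNIV (range atMost)"
        by (subst borel_eq_atMost) (rule sets_measure_of, simp)
      ultimately show ?thesis by simp
    qed
    show "Int_stable ?E"
      by (auto simp: Int_stable_def)
    show "\<forall>A\<in>J \<rightarrow> ?E. prob (\<Inter>j\<in>J. split_limit j -` A j \<inter> space M) =
        (\<Prod>j\<in>J. prob (split_limit j -` A j \<inter> space M))"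
    proof
      fix A assume A: "A \<in> J \<rightarrow> ?E"
      have "\<forall>j\<in>J. \<exists>c. split_limit j -` A j \<inter> space M = {\<omega> \<in> space M. split_limit j \<omega> \<le> c}"
      proof
        fix j assume "j \<in> J"
        then consider "A j = UNIV" | a where "A j = {..a}"
          using A by fastforce
        then show "\<exists>c. split_limit j -` A j \<inter> space M = {\<omega> \<in> space M. split_limit j \<omega> \<le> c}"
        proof cases
          case 1
          then show ?thesis
            using split_limit_bounds by (intro exI[of _ 1]) auto
        qed auto
      qed
      then obtain c where c: "\<And>j. j \<in> J \<Longrightarrow> split_limit j -` A j \<inter> space M =
          {\<omega> \<in> space M. split_limit j \<omega> \<le> c j}"
        by metis
      have "(\<Inter>j\<in>J. split_limit j -` A j \<inter> space M) = {\<omega> \<in> space M. \<forall>j\<in>J. split_limit j \<omega> \<le> c j}"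
        using c J(2) by auto
      moreover have "prob {\<omega> \<in> space M. split_limit j \<omega> \<le> c j} = limit_cdf x y (c j)" for j
        using prob_split_limit[of "{j}" c] by simp
      ultimately show "prob (\<Inter>j\<in>J. split_limit j -` A j \<inter> space M) =
          (\<Prod>j\<in>J. prob (split_limit j -` A j \<inter> space M))"
        using c by (simp add: prob_split_limit[OF J(1)])
    qed
  qed (use J in auto)
  then show ?thesis
    unfolding indep_vars_def2 by (subst indep_sets_finite_index_sets) auto
qed

end

section \<open>The density of a single split\<close>

lemma emeasure_split_density:
  assumes "x > 0" "y > 0"
  shows "emeasure (density lborel (\<lambda>t. ennreal (h_density x y t) * indicator {0..1} t)) {..a} =
      ennreal (limit_cdf x y a)"
proof -
  let ?F = "\<lambda>t. (x * t^2 + y * (2 * t - t^2)) / (x + y)"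
  have [measurable]: "h_density x y \<in> borel_measurable borel"
    unfolding h_density_def by measurable
  have "emeasure (density lborel (\<lambda>t. ennreal (h_density x y t) * indicator {0..1} t)) {..a} =
      (\<integral>\<^sup>+t. ennreal (h_density x y t) * indicator {0..1} t * indicator {..a} t \<partial>lborel)"
    by (rule emeasure_density) auto
  also have "\<dots> = (\<integral>\<^sup>+t. ennreal (h_density x y t) * indicator {0..min 1 a} t \<partial>lborel)"
    by (intro nn_integral_cong) (auto split: split_indicator)
  also have "\<dots> = ennreal (limit_cdf x y a)"
  proof (cases "a < 0")
    case True
    then show ?thesis by (simp add: limit_cdf_def)
  next
    case False
    have "(\<integral>\<^sup>+t. ennreal (h_density x y t) * indicator {0..min 1 a} t \<partial>lborel) =
        ennreal (?F (min 1 a) - ?F 0)"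
    proof (rule nn_integral_FTC_Icc)
      show "(?F has_real_derivative h_density x y t) (at t)" for t
      proof -
        have "(?F has_real_derivative (x * (2 * t) + y * (2 - 2 * t)) / (x + y)) (at t)"
          using assms by (intro DERIV_cdivide) (auto intro!: derivative_eq_intros)
        moreover have "x * (2 * t) + y * (2 - 2 * t) = 2 * x * t + 2 * y * (1 - t)"
          by (simp add: algebra_simps)
        ultimately show ?thesis
          by (simp only: h_density_def)
      qed
      show "0 \<le> h_density x y t" if "t \<in> {0..min 1 a}" for t
        using that assms by (simp add: h_density_def)
    qed (use False in auto)
    then show ?thesis
      using False by (simp add: limit_cdf_def Let_def max_def)
  qed
  finally show ?thesis .
qed

lemma real_distribution_split_density:
  assumes "x > 0" "y > 0"
  shows "real_distribution (density lborel (\<lambda>t. ennreal (h_density x y t) * indicator {0..1} t))"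
      (is "real_distribution ?D")
proof -
  have [measurable]: "h_density x y \<in> borel_measurable borel"
    unfolding h_density_def by measurable
  have "emeasure ?D UNIV = emeasure ?D {..1}"
    by (subst (1 2) emeasure_density) (auto intro!: nn_integral_cong split: split_indicator)
  also have "\<dots> = 1"
    using assms by (simp add: emeasure_split_density limit_cdf_1)
  finally have "prob_space ?D"
    by (intro prob_spaceI) simp
  then show ?thesis
    by (simp add: real_distribution_def real_distribution_axioms_def)
qed

context growth_chain
begin

lemma distr_split_limit:
  "distr M borel (split_limit i) = density lborel (\<lambda>t. ennreal (h_density x y t) * indicator {0..1} t)"
proof (rule cdf_unique)
  show "real_distribution (distr M borel (split_limit i))"
    by (rule real_distribution_distr) simp
  show "real_distribution (density lborel (\<lambda>t. ennreal (h_density x y t) * indicator {0..1} t))"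
    by (rule real_distribution_split_density[OF x_pos y_pos])
  show "cdf (distr M borel (split_limit i)) =
      cdf (density lborel (\<lambda>t. ennreal (h_density x y t) * indicator {0..1} t))"
  proof
    fix a
    have "cdf (distr M borel (split_limit i)) a = prob {\<omega> \<in> space M. split_limit i \<omega> \<le> a}"
      by (simp add: cdf_def measure_distr vimage_def Int_def conj_commute)
    also have "\<dots> = limit_cdf x y a"
      using prob_split_limit[of "{i}" "\<lambda>_. a"] by simp
    also have "\<dots> = cdf (density lborel (\<lambda>t. ennreal (h_density x y t) * indicator {0..1} t)) a"
    proof -
      have "limit_cdf x y a \<ge> 0"
        using prob_split_limit[of "{i}" "\<lambda>_. a"] by (simp flip: \<open>prob _ = limit_cdf x y a\<close>)
      then show ?thesis
        by (simp add: cdf_def measure_def emeasure_split_density[OF x_pos y_pos])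
    qed
    finally show "cdf (distr M borel (split_limit i)) a = \<dots>" .
  qed
qed

lemma splits_iid:
  "(\<forall>i j. AE \<omega> in M.
      (\<lambda>n. real (card (subtree (T n \<omega>) (i @ [j]))) / real (card (subtree (T n \<omega>) i))) \<longlonglongrightarrow> V i j \<omega>) \<and>
   (\<forall>i. \<forall>\<omega>\<in>space M. (V i L1 \<omega>, V i L2 \<omega>) \<in> std_simplex) \<and>
   indep_vars (\<lambda>_. borel) (\<lambda>i \<omega>. (V i L1 \<omega>, V i L2 \<omega>)) UNIV \<and>
   (\<forall>i. distr M borel (\<lambda>\<omega>. (V i L1 \<omega>, V i L2 \<omega>)) = split_law x y)"
proof (intro conjI allI ballI)
  have pair: "(\<lambda>t :: real. (t, 1 - t)) \<in> borel \<rightarrow>\<^sub>M borel"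
    by (intro borel_measurable_Pair) auto
  fix i j
  show "AE \<omega> in M. (\<lambda>n. real (card (subtree (T n \<omega>) (i @ [j]))) / real (card (subtree (T n \<omega>) i))) \<longlonglongrightarrow>
      V i j \<omega>"
    using AE_split_limit[of i j] by eventually_elim auto
  show "(V i L1 \<omega>, V i L2 \<omega>) \<in> std_simplex" for \<omega>
    using split_limit_bounds by (auto simp: V_def std_simplex_def)
  show "indep_vars (\<lambda>_. borel) (\<lambda>i \<omega>. (V i L1 \<omega>, V i L2 \<omega>)) UNIV"
    using indep_vars_compose2[OF indep_split_limit, of "\<lambda>_ t. (t, 1 - t)" "\<lambda>_. borel"] pair
    by (simp add: V_def)
  have "distr M borel (\<lambda>\<omega>. (V i L1 \<omega>, V i L2 \<omega>)) =
      distr (distr M borel (split_limit i)) borel (\<lambda>t. (t, 1 - t))"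
    by (subst distr_distr[OF pair]) (auto simp: V_def o_def)
  then show "distr M borel (\<lambda>\<omega>. (V i L1 \<omega>, V i L2 \<omega>)) = split_law x y"
    by (simp add: split_law_def distr_split_limit)
qed

end

section \<open>The random walks of maximal entropy\<close>

lemma bin_trees_harm_pos:
  "x > 0 \<Longrightarrow> y > 0 \<Longrightarrow> {\<tau> \<in> bin_trees. restrict (growth_harm x y) bin_trees \<tau> > 0} = bin_trees"
  using growth_harm_pos by auto

text \<open>There is only one limit point and it is positive everywhere, so the state space in
  \<open>merw\<close> is the set of all trees.\<close>

lemma merw_iff:
  assumes "x > 0" "y > 0"
  shows "merw x y M T \<longleftrightarrow>
    markov_chain M bin_trees root_tree (trans_prob x y (restrict (growth_harm x y) bin_trees)) T"
  unfolding merw_def limit_point_iff[OF assms]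
      by (simp only: simp_thms ex_simps bin_trees_harm_pos[OF assms])

lemma growth_chain_of_merw:
  assumes "x > 0" "y > 0" "merw x y M T"
  shows "growth_chain M x y T"
proof -
  let ?P = "trans_prob x y (restrict (growth_harm x y) bin_trees)"
  have mc: "markov_chain M bin_trees root_tree ?P T"
    using assms by (simp add: merw_iff)
  then interpret prob_space M
    by (simp add: markov_chain_def)
  have T: "T n \<in> M \<rightarrow>\<^sub>M count_space bin_trees" for n
    using mc by (simp add: markov_chain_def)
  have ev: "{\<omega> \<in> space M. T n \<omega> = a} \<in> events" for n a
  proof -
    have "{\<omega> \<in> space M. T n \<omega> = a} = T n -` ({a} \<inter> bin_trees) \<inter> space M"
      using measurable_space[OF T[of n]] by auto
    then show ?thesis
      using measurable_sets[OF T[of n], of "{a} \<inter> bin_trees"] by simp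
  qed
  have step: "prob {\<omega> \<in> space M. (\<forall>k\<le>n. T k \<omega> = s k) \<and> T (Suc n) \<omega> = t} =
      prob {\<omega> \<in> space M. \<forall>k\<le>n. T k \<omega> = s k} * ?P (s n) t" if t: "t \<in> bin_trees" for n s t
  proof (cases "prob {\<omega> \<in> space M. \<forall>k\<le>n. T k \<omega> = s k} > 0")
    case True
    then have "\<P>(\<omega> in M. T (Suc n) \<omega> = t \<bar> \<forall>k\<le>n. T k \<omega> = s k) = ?P (s n) t"
      using mc t by (simp add: markov_chain_def)
    then show ?thesis
      using True by (simp add: cond_prob_def conj_commute divide_eq_eq mult.commute)
  next
    case False
    \<comment> \<open>A null history gives no information through the conditional probability, but
      then both sides of the product form vanish.\<close>
    let ?A = "{\<omega> \<in> space M. (\<forall>k\<le>n. T k \<omega> = s k) \<and> T (Suc n) \<omega> = t}"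
    let ?B = "{\<omega> \<in> space M. \<forall>k\<le>n. T k \<omega> = s k}"
    have "{\<omega> \<in> space M. \<forall>k\<in>{..n}. T k \<omega> = s k} \<in> events"
      by (intro sets.sets_Collect_finite_All ev) auto
    then have "prob ?A \<le> prob ?B"
      by (intro finite_measure_mono Collect_mono) (blast, simp only: Ball_def atMost_iff)
    moreover have B: "prob ?B = 0"
      using False zero_less_measure_iff by blast
    ultimately have "prob ?A = 0"
      by (simp only: measure_le_0_iff)
    then show ?thesis
      by (simp only: B mult_zero_left)
  qed
  show ?thesis
  proof
    show "AE \<omega> in M. T 0 \<omega> = root_tree"
      using mc by (simp add: markov_chain_def)
  qed (rule assms T step; assumption?)+
qed

section \<open>Existence of the walk by the Ionescu-Tulcea theorem\<close>

definition step_law :: "real \<Rightarrow> real \<Rightarrow> tree \<Rightarrow> tree measure" where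
  "step_law x y \<tau> = density (count_space bin_trees)
     (\<lambda>\<sigma>. ennreal (trans_prob x y (restrict (growth_harm x y) bin_trees) \<tau> \<sigma>))"

lemma emeasure_step_law:
  assumes "t \<in> bin_trees"
  shows "emeasure (step_law x y \<tau>) {t} =
      ennreal (trans_prob x y (restrict (growth_harm x y) bin_trees) \<tau> t)"
  unfolding step_law_def using assms
  by (subst emeasure_density) (simp_all add: nn_integral_indicator_singleton)

lemma prob_space_step_law:
  assumes "x > 0" "y > 0" "\<tau> \<in> bin_trees"
  shows "prob_space (step_law x y \<tau>)"
proof (rule prob_spaceI)
  let ?P = "trans_prob x y (restrict (growth_harm x y) bin_trees) \<tau>"
  have P: "?P (insert v \<tau>) = step_prob x y \<tau> v" if "v \<in> slots \<tau>" for v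
    by (rule trans_prob_insert[OF assms that])
  have "emeasure (step_law x y \<tau>) (space (step_law x y \<tau>)) =
      (\<integral>\<^sup>+\<sigma>. ennreal (?P \<sigma>) \<partial>count_space bin_trees)"
    unfolding step_law_def by (simp add: emeasure_density) (auto
        intro!: nn_integral_cong split: split_indicator)
  also have "\<dots> = (\<Sum>\<sigma> | edge \<tau> \<sigma>. ennreal (?P \<sigma>))"
  proof (rule nn_integral_count_space'[OF finite_edges])
    show "ennreal (?P \<sigma>) = 0" if "\<sigma> \<notin> {\<sigma>. edge \<tau> \<sigma>}" for \<sigma>
      using that trans_prob_nonzero_iff[OF assms, of \<sigma>] by simp
  qed (use edge_bin_tree in auto)
  also have "\<dots> = (\<Sum>v\<in>slots \<tau>. ennreal (step_prob x y \<tau> v))"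
    unfolding sum_edges[OF assms(3)] using P by simp
  also have "\<dots> = ennreal (\<Sum>v\<in>slots \<tau>. step_prob x y \<tau> v)"
    using step_prob_pos[OF assms(1,2)] by (intro sum_ennreal) (auto intro: less_imp_le)
  also have "\<dots> = 1"
    using sum_step_prob(2)[OF assms] by simp
  finally show "emeasure (step_law x y \<tau>) (space (step_law x y \<tau>)) = 1" .
qed

text \<open>The kernel with index n sees the coordinates below n. There are none for n = 0, so the
  starting tree is itself produced by a kernel, a point mass at the root.\<close>

definition grow_kernel :: "real \<Rightarrow> real \<Rightarrow> nat \<Rightarrow> (nat \<Rightarrow> tree) \<Rightarrow> tree measure" where
  "grow_kernel x y n \<omega> =
      (case n of 0 \<Rightarrow> return (count_space bin_trees) root_tree | Suc m \<Rightarrow> step_law x y (\<omega> m))"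

lemma Ionescu_Tulcea_grow_kernel:
  assumes "x > 0" "y > 0"
  shows "Ionescu_Tulcea (grow_kernel x y) (\<lambda>_. count_space bin_trees)"
  unfolding Ionescu_Tulcea_def
proof (intro conjI allI impI)
  fix n
  have ret: "prob_space (return (count_space bin_trees) root_tree)"
    by (rule prob_space_return) (simp add: root_tree_bin_tree)
  show "prob_space (grow_kernel x y n \<omega>)" if "\<omega> \<in> space (PiM {0..<n} (\<lambda>_. count_space bin_trees))" for \<omega>
  proof (cases n)
    case (Suc m)
    then have "\<omega> m \<in> bin_trees"
      using that by (auto simp: space_PiM dest: PiE_mem)
    then show ?thesis
      using prob_space_step_law[OF assms] Suc by (simp add: grow_kernel_def)
  qed (simp add: grow_kernel_def ret)
  show "grow_kernel x y n \<in> PiM {0..<n} (\<lambda>_. count_space bin_trees) \<rightarrow>\<^sub>M subprob_algebra (count_space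
      bin_trees)"
  proof (cases n)
    case 0
    have "return (count_space bin_trees) root_tree \<in> space (subprob_algebra (count_space bin_trees))"
      using ret by (simp add: space_subprob_algebra prob_space_imp_subprob_space)
    moreover have "grow_kernel x y 0 = (\<lambda>_. return (count_space bin_trees) root_tree)"
      by (simp add: grow_kernel_def fun_eq_iff)
    ultimately show ?thesis
      using 0 by simp
  next
    case (Suc m)
    have "step_law x y \<in> count_space bin_trees \<rightarrow>\<^sub>M subprob_algebra (count_space bin_trees)"
      using prob_space_step_law[OF assms]
      by (auto simp: space_subprob_algebra prob_space_imp_subprob_space step_law_def)
    moreover have "(\<lambda>\<omega>. \<omega> m) \<in> PiM {0..<n} (\<lambda>_. count_space bin_trees) \<rightarrow>\<^sub>M count_space bin_trees"
      using Suc by (intro measurable_component_singleton) auto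
    ultimately have "(\<lambda>\<omega>. step_law x y (\<omega> m)) \<in> PiM {0..<n} (\<lambda>_. count_space bin_trees) \<rightarrow>\<^sub>M
        subprob_algebra (count_space bin_trees)"
      by (rule measurable_compose[rotated])
    moreover have "grow_kernel x y n = (\<lambda>\<omega>. step_law x y (\<omega> m))"
      using Suc by (simp add: grow_kernel_def fun_eq_iff)
    ultimately show ?thesis by simp
  qed
qed

lemma merw_exists:
  assumes "x > 0" "y > 0"
  shows "\<exists>(M :: (nat \<Rightarrow> tree) measure) T. merw x y M T"
proof -
  let ?B = "\<lambda>_ :: nat. count_space bin_trees" and ?K = "grow_kernel x y"
  let ?P = "trans_prob x y (restrict (growth_harm x y) bin_trees)"
  interpret IT: Ionescu_Tulcea ?K ?B
    by (rule Ionescu_Tulcea_grow_kernel[OF assms])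
  \<comment> \<open>Cylinders fix the first \<open>n\<close> coordinates, and \<open>Q n s\<close>
    is the probability that a run from the empty history follows \<open>s\<close> so far.\<close>
  define cyl where "cyl n s = {\<omega> \<in> space (PiM {0..<n} ?B). \<forall>k\<in>{0..<n}. \<omega> k = s k}" for n s
  define Q where "Q n s = emeasure (IT.C 0 n (\<lambda>_. undefined)) (cyl n s)" for n s
  have comp: "{\<omega> \<in> space (PiM I ?B). \<omega> k = a} \<in> sets (PiM I ?B)" if "k \<in> I" for I k a
  proof -
    have "(\<lambda>\<omega>. \<omega> k) \<in> PiM I ?B \<rightarrow>\<^sub>M count_space bin_trees"
      using that by (rule measurable_component_singleton)
    then have "(\<lambda>\<omega>. \<omega> k) -` ({a} \<inter> bin_trees) \<inter> space (PiM I ?B) \<in> sets (PiM I ?B)"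
      by (rule measurable_sets) auto
    moreover have "(\<lambda>\<omega>. \<omega> k) -` ({a} \<inter> bin_trees) \<inter> space (PiM I ?B) = {\<omega> \<in> space (PiM I ?B). \<omega> k = a}"
      using that by (auto simp: space_PiM dest: PiE_mem)
    ultimately show ?thesis by simp
  qed
  have cyl: "cyl n s \<in> sets (PiM {0..<n} ?B)" for n s
    unfolding cyl_def by (intro sets.sets_Collect_finite_All comp) auto
  have undef: "(\<lambda>_. undefined) \<in> space (PiM {0..<0} ?B)"
    by (simp add: space_PiM)
  have Q0: "Q 0 s = 1" for s
    using undef by (simp add: Q_def cyl_def)
  \<comment> \<open>On the cylinder the last coordinate is fixed, so the kernel is the same for all
    its points and the integral reduces to a product.\<close>
  have Q_Suc: "Q (Suc n) s = Q n s * emeasure (?K n s) {s n}" if s: "s n \<in> bin_trees" for n s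
  proof -
    let ?C = "IT.C 0 n (\<lambda>_. undefined)"
    have sp: "space ?C = space (PiM {0..<n} ?B)"
      using IT.space_C[OF undef, of n] by simp
    have st: "sets ?C = sets (PiM {0..<n} ?B)"
      using IT.sets_C[OF undef, of n] by simp
    interpret C: prob_space ?C
      by (rule IT.prob_space_C[OF undef])
    have "Q (Suc n) s = emeasure (Giry_Monad.bind ?C (IT.eP n)) (cyl (Suc n) s)"
      by (simp add: Q_def)
    also have "\<dots> = (\<integral>\<^sup>+\<omega>. emeasure (IT.eP n \<omega>) (cyl (Suc n) s) \<partial>(?C))"
    proof (rule emeasure_bind)
      show "IT.eP n \<in> ?C \<rightarrow>\<^sub>M subprob_algebra (PiM {0..<Suc n} ?B)"
        using IT.measurable_eP[of n] by (simp add: measurable_cong_sets[OF st refl])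
    qed (use C.not_empty cyl in auto)
    also have "\<dots> = (\<integral>\<^sup>+\<omega>. emeasure (?K n s) {s n} * indicator (cyl n s) \<omega> \<partial>(?C))"
    proof (rule nn_integral_cong)
      fix \<omega> assume "\<omega> \<in> space ?C"
      then have \<omega>: "\<omega> \<in> space (PiM {0..<n} ?B)"
        by (simp only: sp)
      have "(\<lambda>t. fun_upd \<omega> n t) -` cyl (Suc n) s \<inter> bin_trees = (if \<omega> \<in> cyl n s then {s n} else {})"
        using \<omega> s by (auto simp: cyl_def space_PiM PiE_iff extensional_def less_Suc_eq)
      moreover have "?K n \<omega> = ?K n s" if "\<omega> \<in> cyl n s"
        using that by (cases n) (auto simp: grow_kernel_def cyl_def)
      ultimately show "emeasure (IT.eP n \<omega>) (cyl (Suc n) s) =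
          emeasure (?K n s) {s n} * indicator (cyl n s) \<omega>"
        by (auto simp: IT.emeasure_eP[OF \<omega> cyl] split: split_indicator)
    qed
    also have "\<dots> = emeasure (?K n s) {s n} * Q n s"
      unfolding Q_def using cyl by (intro nn_integral_cmult_indicator) (simp add: st)
    finally show ?thesis by (simp add: mult.commute)
  qed
  define M where "M = IT.PF.lim"
  have spM: "space M = space (PiM UNIV ?B)" and stM: "sets M = sets (PiM UNIV ?B)"
    by (simp_all add: M_def)
  have Q_lim: "emeasure M {\<omega> \<in> space M. \<forall>k<n. \<omega> k = s k} = Q n s" for n s
  proof -
    have "{\<omega> \<in> space M. \<forall>k<n. \<omega> k = s k} = IT.PF.emb UNIV {0..<n} (cyl n s)"
      by (auto simp: spM prod_emb_def cyl_def space_PiM PiE_iff)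
    then have "emeasure M {\<omega> \<in> space M. \<forall>k<n. \<omega> k = s k} = emeasure (IT.CI {0..<n}) (cyl n s)"
      unfolding M_def by (simp only: IT.lim[OF _ cyl] finite_atLeastLessThan)
    also have "\<dots> = emeasure (IT.C 0 n (\<lambda>_. undefined)) (IT.PF.emb {0..<n} {0..<n} (cyl n s))"
      by (rule IT.emeasure_CI[OF _ cyl]) simp
    also have "IT.PF.emb {0..<n} {0..<n} (cyl n s) = cyl n s"
      by (intro prod_emb_id) (auto simp: cyl_def space_PiM)
    finally show ?thesis by (simp add: Q_def)
  qed
  interpret prob_space M
    using Q_lim[of 0] by (intro prob_spaceI) (simp add: Q0)
  have prob_Suc: "prob {\<omega> \<in> space M. \<forall>k<Suc n. \<omega> k = s k} =
      prob {\<omega> \<in> space M. \<forall>k<n. \<omega> k = s k} * measure (?K n s) {s n}" if "s n \<in> bin_trees" for n s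
    using Q_Suc[of s n, OF that] unfolding Q_lim[symmetric]
    by (simp add: measure_def enn2real_mult)
  have "markov_chain M bin_trees root_tree ?P (\<lambda>n \<omega>. \<omega> n)"
    unfolding markov_chain_def
  proof (intro conjI allI ballI impI)
    show "prob_space M" by unfold_locales
    show "(\<lambda>\<omega>. \<omega> n) \<in> M \<rightarrow>\<^sub>M count_space bin_trees" for n
      using measurable_component_singleton[of n UNIV ?B] by (simp add: measurable_cong_sets[OF stM refl])
    have ev: "{\<omega> \<in> space M. \<omega> k = a} \<in> events" for k a
      using comp[of k UNIV a] by (simp add: spM stM)
    have "prob {\<omega> \<in> space M. \<forall>k<Suc 0. \<omega> k = root_tree} = 1"
      using prob_Suc[of "\<lambda>_. root_tree" 0] root_tree_bin_tree
      by (simp add: prob_space grow_kernel_def measure_return)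
    then show "AE \<omega> in M. \<omega> 0 = root_tree"
      using AE_in_set_eq_1[OF ev[of 0 root_tree]] by (auto elim: eventually_mono)
    fix n s t assume t: "t \<in> bin_trees" and pos: "prob {\<omega> \<in> space M. \<forall>k\<le>n. \<omega> k = s k} > 0"
    \<comment> \<open>A history of positive probability is followed by some point of the space;
      hence \<open>s n\<close> is a tree and the transition formulas apply.\<close>
    have "{\<omega> \<in> space M. \<forall>k\<le>n. \<omega> k = s k} \<noteq> {}"
      using pos by (metis (no_types) less_irrefl measure_empty)
    then obtain \<omega> where "\<omega> \<in> space M" "\<omega> n = s n"
      by blast
    then have sn: "s n \<in> bin_trees"
      by (metis spM space_PiM space_count_space PiE_mem UNIV_I)
    \<comment> \<open>Appending \<open>t\<close> to the history turns the joint event into a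
      cylinder of length n + 2, to which \<open>prob_Suc\<close> applies.\<close>
    let ?s = "fun_upd s (Suc n) t"
    have "prob {\<omega> \<in> space M. \<forall>k<Suc (Suc n). \<omega> k = ?s k} =
        prob {\<omega> \<in> space M. \<forall>k<Suc n. \<omega> k = ?s k} * measure (?K (Suc n) ?s) {t}"
      using prob_Suc[of ?s "Suc n"] t by simp
    moreover have "measure (?K (Suc n) ?s) {t} = ?P (s n) t"
    proof -
      have "?P (s n) t \<ge> 0"
      proof (cases "edge (s n) t")
        case True
        then obtain v where "v \<in> slots (s n)" "t = insert v (s n)"
          unfolding edge_iff_slot by blast
        then have "?P (s n) t = step_prob x y (s n) v"
          by (simp only: trans_prob_insert[OF assms sn])
        then show ?thesis
          using step_prob_pos[OF assms, of "s n" v] by linarith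
      next
        case False
        then have "?P (s n) t = 0"
          using trans_prob_nonzero_iff[OF assms sn, of t] by blast
        then show ?thesis by simp
      qed
      then show ?thesis
        by (simp add: grow_kernel_def measure_def emeasure_step_law[OF t])
    qed
    moreover have upd: "(\<forall>k<Suc n. \<omega> k = ?s k) \<longleftrightarrow> (\<forall>k\<le>n. \<omega> k = s k)" for \<omega>
      by (simp add: less_Suc_eq_le)
    moreover have "(\<forall>k<Suc (Suc n). \<omega> k = ?s k) \<longleftrightarrow> \<omega> (Suc n) = t \<and> (\<forall>k\<le>n. \<omega> k = s k)" for \<omega>
      unfolding All_less_Suc[of "Suc n"] upd by simp
    ultimately have "prob {\<omega> \<in> space M. \<omega> (Suc n) = t \<and> (\<forall>k\<le>n. \<omega> k = s k)} =
        prob {\<omega> \<in> space M. \<forall>k\<le>n. \<omega> k = s k} * ?P (s n) t"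
      by (simp only:)
    then show "\<P>(\<omega> in M. \<omega> (Suc n) = t \<bar> \<forall>k\<le>n. \<omega> k = s k) = ?P (s n) t"
      unfolding cond_prob_def using pos by (simp only:) simp
  qed
  then show ?thesis
    using merw_iff[OF assms] by blast
qed

theorem theorem4p1:
  fixes x y :: real
  assumes "x > 0" and "y > 0"
  shows
    "(\<exists>!\<phi>. limit_point x y \<phi>) \<and>
     (\<exists>(M :: (nat \<Rightarrow> tree) measure) T. merw x y M T) \<and>
     (\<forall>\<phi>. limit_point x y \<phi> \<longrightarrow>
        positive_harmonic x y \<phi> \<and>
        (\<forall>\<tau>\<in>bin_trees. \<phi> \<tau> = 1 / fact (card \<tau>) * (2 / (x + y)) ^ card (internal \<tau>)) \<and>
        (\<forall>\<tau>\<in>bin_trees. \<forall>\<sigma>\<in>bin_trees. trans_prob x y \<phi> \<tau> \<sigma> \<noteq> 0 \<longleftrightarrow> edge \<tau> \<sigma>) \<and>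
        (\<forall>\<tau>\<in>bin_trees. \<forall>i\<in>\<tau>. \<forall>j. i @ [j] \<notin> \<tau> \<longrightarrow>
           trans_prob x y \<phi> \<tau> (\<tau> \<union> {i @ [j]}) =
             (if i \<in> leaves \<tau> then
                (case j of
                   L1 \<Rightarrow> 2 * x / (x + y) * (1 / (real (card \<tau>) + 1))
                 | L2 \<Rightarrow> 2 * y / (x + y) * (1 / (real (card \<tau>) + 1)))
              else 1 / (real (card \<tau>) + 1)))) \<and>
     (\<forall>(M :: 'a measure) T. merw x y M T \<longrightarrow>
        (\<exists>V :: word \<Rightarrow> letter \<Rightarrow> 'a \<Rightarrow> real.
           (\<forall>i j. AE \<omega> in M.
              (\<lambda>n. real (card (subtree (T n \<omega>) (i @ [j]))) / real (card (subtree (T n \<omega>) i)))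
                \<longlonglongrightarrow> V i j \<omega>) \<and>
           (\<forall>i. \<forall>\<omega>\<in>space M. (V i L1 \<omega>, V i L2 \<omega>) \<in> std_simplex) \<and>
           prob_space.indep_vars M (\<lambda>_. borel) (\<lambda>i \<omega>. (V i L1 \<omega>, V i L2 \<omega>)) UNIV \<and>
           (\<forall>i. distr M borel (\<lambda>\<omega>. (V i L1 \<omega>, V i L2 \<omega>)) = split_law x y)))"
proof -
  let ?\<phi> = "restrict (growth_harm x y) bin_trees"
  have trans: "trans_prob x y ?\<phi> \<tau> (\<tau> \<union> {i @ [j]}) =
      (if i \<in> leaves \<tau> then
         (case j of
            L1 \<Rightarrow> 2 * x / (x + y) * (1 / (real (card \<tau>) + 1))
          | L2 \<Rightarrow> 2 * y / (x + y) * (1 / (real (card \<tau>) + 1)))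
       else 1 / (real (card \<tau>) + 1))"
    if "\<tau> \<in> bin_trees" "i \<in> \<tau>" "i @ [j] \<notin> \<tau>" for \<tau> i j
  proof -
    have "i @ [j] \<in> slots \<tau>"
      using that by (auto simp: slots_def)
    then show ?thesis
      using trans_prob_insert[OF assms that(1)]
      by (simp add: step_prob_def slot_weight_def split: letter.split)
  qed
  have splits: "\<exists>V :: word \<Rightarrow> letter \<Rightarrow> 'a \<Rightarrow> real.
      (\<forall>i j. AE \<omega> in M.
         (\<lambda>n. real (card (subtree (T n \<omega>) (i @ [j]))) / real (card (subtree (T n \<omega>) i)))
           \<longlonglongrightarrow> V i j \<omega>) \<and>
      (\<forall>i. \<forall>\<omega>\<in>space M. (V i L1 \<omega>, V i L2 \<omega>) \<in> std_simplex) \<and>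
      prob_space.indep_vars M (\<lambda>_. borel) (\<lambda>i \<omega>. (V i L1 \<omega>, V i L2 \<omega>)) UNIV \<and>
      (\<forall>i. distr M borel (\<lambda>\<omega>. (V i L1 \<omega>, V i L2 \<omega>)) = split_law x y)"
    if "merw x y M T" for M :: "'a measure" and T
  proof -
    interpret growth_chain M x y T
      by (rule growth_chain_of_merw[OF assms that])
    show ?thesis
      by (rule exI[of _ V]) (rule splits_iid)
  qed
  show ?thesis
    unfolding limit_point_iff[OF assms]
  proof (intro conjI allI impI ballI)
    show "\<exists>!\<phi>. \<phi> = ?\<phi>" by simp
    show "\<exists>(M :: (nat \<Rightarrow> tree) measure) T. merw x y M T"
      by (rule merw_exists[OF assms])
    fix \<phi> assume \<phi>: "\<phi> = ?\<phi>"
    show "positive_harmonic x y \<phi>"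
      unfolding \<phi> by (rule positive_harmonic_harm[OF assms])
    fix \<tau> assume \<tau>: "\<tau> \<in> bin_trees"
    show "\<phi> \<tau> = 1 / fact (card \<tau>) * (2 / (x + y)) ^ card (internal \<tau>)"
      unfolding \<phi> restrict_apply'[OF \<tau>] by (rule growth_harm_def)
    show "trans_prob x y \<phi> \<tau> \<sigma> \<noteq> 0 \<longleftrightarrow> edge \<tau> \<sigma>" for \<sigma>
      unfolding \<phi> by (rule trans_prob_nonzero_iff[OF assms \<tau>])
    fix i j assume "i \<in> \<tau>" "i @ [j] \<notin> \<tau>"
    then show "trans_prob x y \<phi> \<tau> (\<tau> \<union> {i @ [j]}) =
        (if i \<in> leaves \<tau> then
           (case j of
              L1 \<Rightarrow> 2 * x / (x + y) * (1 / (real (card \<tau>) + 1))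
            | L2 \<Rightarrow> 2 * y / (x + y) * (1 / (real (card \<tau>) + 1)))
         else 1 / (real (card \<tau>) + 1))"
      unfolding \<phi> by (rule trans[OF \<tau>])
  qed (rule splits)
qed

end
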